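(* Let $\mu,\sigma>0$ and $0<S<B$ be constants, let $K>0$, let $W$ be a standard one-dimensional Brownian motion, and let $X$ be the solution to $$dX_t=\mu X_t\,dt+\sigma X_t\,dW_t,\qquad X_0=S\ \text{a.s.}$$ Let $\Psi:C[0,T]\to\mathbb{R}$ be a general Lipschitz continuous payoff. Let $$C(B,K,T)=\mathbb{E}\left[\Psi(\{X_t\}_{0\le t\le T})\cdot\mathbf{1}_{\{\max_{0\le t\le T}X_t\ge B\}}\right]$$ be the fair price of the barrier option with payoff $\Psi$, and let $P(B,T):=\mathbb{P}\left(\max_{0\le t\le T}X_t\ge B\right)$. Then the fair price satisfies the following short time asymptotics as $T\to0^+$: $$C(B,K,T)=P(B,T)\left[\Psi\left(\left\{S\left(\tfrac{B}{S}\right)^{t/T}\right\}_{0\le t\le T}\right)+O(\sqrt{T})\right],$$ where the implied constant in the $O$ notation depends only on $\sigma$, $\mu$ and $B$.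
   Context: $C[0,T]$ is the space of continuous real-valued functions on $[0,T]$. $X$ models a stock price with initial price $S$, in a market with no interest rates. The option is an out of the money up-and-in barrier option with barrier $B>S$, strike price $K>0$ and maturity time $T>0$: it pays $\Psi(\{X_t\}_{0\le t\le T})$ if $\sup_{0\le t\le T}X_t\ge B$ and zero otherwise. Its fair price is $C(B,K,T)$ as given in the claim.
   Formalization: The error is bounded by c·L·√T with L the Lipschitz constant of Ψ and c depending only on σ, μ, B (a constant independent of Ψ is impossible, as scaling Ψ shows); c is chosen for all probability spaces on one underlying set, and the law of X is the same on all. *)

theory Defs
  imports "HOL-Probability.Probability"
begin

section \<open>Brownian motion relative to a filtration\<close>

text \<open>
  Time is indexed by the reals and only indices \<open>t \<ge> 0\<close> matter; a filtration on \<open>[0,\<infinity>)\<close> is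
  extended to negative times by \<open>F t = F 0\<close>. No completeness or right-continuity is assumed.
\<close>

locale brownian_motion = prob_space M + filtration "space M" F
  for M :: "'a measure" and F :: "real \<Rightarrow> 'a measure" +
  fixes W :: "real \<Rightarrow> 'a \<Rightarrow> real"
  assumes subalgebra_F: "subalgebra M (F t)"
    and adapted: "0 \<le> t \<Longrightarrow> W t \<in> borel_measurable (F t)"
    and start_zero: "AE \<omega> in M. W 0 \<omega> = 0"
    and continuous_paths: "\<omega> \<in> space M \<Longrightarrow> continuous_on {0..} (\<lambda>t. W t \<omega>)"
    and normal_increments: "0 \<le> s \<Longrightarrow> s < t \<Longrightarrow>
      distributed M lborel (\<lambda>\<omega>. W t \<omega> - W s \<omega>) (normal_density 0 (sqrt (t - s)))"
    and indep_increments: "0 \<le> s \<Longrightarrow> s < t \<Longrightarrow>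
      indep_set (sets (F s)) {(\<lambda>\<omega>. W t \<omega> - W s \<omega>) -` A \<inter> space M |A. A \<in> sets borel}"


section \<open>The Ito integral\<close>

text \<open>
  The data \<open>(n, p, \<xi>)\<close> represent the simple process equal to \<open>\<xi> i\<close> on \<open>(p i, p (i + 1)]\<close> for \<open>i < n\<close>.
\<close>

definition simple_process ::
    "(real \<Rightarrow> 'a measure) \<Rightarrow> nat \<Rightarrow> (nat \<Rightarrow> real) \<Rightarrow> (nat \<Rightarrow> 'a \<Rightarrow> real) \<Rightarrow> bool" where
  "simple_process F n p \<xi> \<longleftrightarrow> 0 \<le> p 0 \<and> (\<forall>i<n. p i \<le> p (Suc i)) \<and>
     (\<forall>i<n. \<xi> i \<in> borel_measurable (F (p i))) \<and>
     (\<exists>C. \<forall>i<n. \<forall>\<omega>\<in>space (F (p i)). \<bar>\<xi> i \<omega>\<bar> \<le> C)"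

definition simple_value ::
    "nat \<Rightarrow> (nat \<Rightarrow> real) \<Rightarrow> (nat \<Rightarrow> 'a \<Rightarrow> real) \<Rightarrow> real \<Rightarrow> 'a \<Rightarrow> real" where
  "simple_value n p \<xi> t \<omega> = (\<Sum>i<n. \<xi> i \<omega> * indicator {p i<..p (Suc i)} t)"

definition simple_integral ::
    "(real \<Rightarrow> 'a \<Rightarrow> real) \<Rightarrow> nat \<Rightarrow> (nat \<Rightarrow> real) \<Rightarrow> (nat \<Rightarrow> 'a \<Rightarrow> real) \<Rightarrow> real \<Rightarrow> 'a \<Rightarrow> real" where
  "simple_integral W n p \<xi> t \<omega> =
     (\<Sum>i<n. \<xi> i \<omega> * (W (min t (p (Suc i))) \<omega> - W (min t (p i)) \<omega>))"

definition progressively_measurable ::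
    "(real \<Rightarrow> 'a measure) \<Rightarrow> (real \<Rightarrow> 'a \<Rightarrow> real) \<Rightarrow> bool" where
  "progressively_measurable F H \<longleftrightarrow>
     (\<forall>t\<ge>0. (\<lambda>(s, \<omega>). H s \<omega>) \<in> borel_measurable (restrict_space borel {0..t} \<Otimes>\<^sub>M F t))"

text \<open>
  \<open>I\<close> is a continuous version of the Ito integral \<open>\<integral> H dW\<close>: on every \<open>[0,T]\<close> there are simple processes
  \<open>H\<^sub>k\<close> with \<open>\<integral>\<^sub>0\<^sup>T (H\<^sub>k - H)\<^sup>2 ds \<rightarrow> 0\<close> in probability, whose elementary integrals converge to \<open>I\<close>
  uniformly on \<open>[0,T]\<close> in probability. The time integral is a nonnegative integral, so that it is
  infinite, rather than zero, when the square is not integrable. Since the filtration need not be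
  complete, \<open>I\<close> is only required to be measurable, not adapted.
\<close>

definition has_ito_integral ::
    "'a measure \<Rightarrow> (real \<Rightarrow> 'a measure) \<Rightarrow> (real \<Rightarrow> 'a \<Rightarrow> real) \<Rightarrow>
     (real \<Rightarrow> 'a \<Rightarrow> real) \<Rightarrow> (real \<Rightarrow> 'a \<Rightarrow> real) \<Rightarrow> bool" where
  "has_ito_integral M F W H I \<longleftrightarrow>
     progressively_measurable F H \<and>
     (\<forall>t\<ge>0. I t \<in> borel_measurable M) \<and>
     (\<forall>\<omega>\<in>space M. continuous_on {0..} (\<lambda>t. I t \<omega>)) \<and>
     (\<forall>T>0. \<exists>n p \<xi>.
        (\<forall>k. simple_process F (n k) (p k) (\<xi> k)) \<and>
        (\<forall>\<epsilon>>0.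
          (\<lambda>k. measure M {\<omega> \<in> space M. ennreal \<epsilon> <
             (\<integral>\<^sup>+s\<in>{0..T}. ennreal ((simple_value (n k) (p k) (\<xi> k) s \<omega> - H s \<omega>)\<^sup>2) \<partial>lborel)})
            \<longlonglongrightarrow> 0) \<and>
        (\<forall>\<epsilon>>0.
          (\<lambda>k. measure M {\<omega> \<in> space M. \<exists>t\<in>{0..T}.
             \<epsilon> < \<bar>simple_integral W (n k) (p k) (\<xi> k) t \<omega> - I t \<omega>\<bar>}) \<longlonglongrightarrow> 0))"


section \<open>Stochastic differential equations\<close>

text \<open>\<open>dX\<^sub>t = a(X\<^sub>t) dt + b(X\<^sub>t) dW\<^sub>t\<close> with \<open>X\<^sub>0 = x\<^sub>0\<close> almost surely.\<close>

definition sde_solution ::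
    "'a measure \<Rightarrow> (real \<Rightarrow> 'a measure) \<Rightarrow> (real \<Rightarrow> 'a \<Rightarrow> real) \<Rightarrow>
     (real \<Rightarrow> real) \<Rightarrow> (real \<Rightarrow> real) \<Rightarrow> real \<Rightarrow> (real \<Rightarrow> 'a \<Rightarrow> real) \<Rightarrow> bool" where
  "sde_solution M F W a b x\<^sub>0 X \<longleftrightarrow>
     (\<forall>t\<ge>0. X t \<in> borel_measurable (F t)) \<and>
     (\<forall>\<omega>\<in>space M. continuous_on {0..} (\<lambda>t. X t \<omega>)) \<and>
     (AE \<omega> in M. X 0 \<omega> = x\<^sub>0) \<and>
     (AE \<omega> in M. \<forall>t\<ge>0. set_integrable lborel {0..t} (\<lambda>s. a (X s \<omega>))) \<and>
     (\<exists>I. has_ito_integral M F W (\<lambda>t \<omega>. b (X t \<omega>)) I \<and>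
        (AE \<omega> in M. \<forall>t\<ge>0. X t \<omega> = X 0 \<omega> + (LBINT s:{0..t}. a (X s \<omega>)) + I t \<omega>))"


section \<open>Barrier options\<close>

text \<open>The metric space \<open>C[0,T]\<close>; its elements are functions that are \<open>undefined\<close> outside \<open>[0,T]\<close>.\<close>

definition path_space :: "real \<Rightarrow> (real \<Rightarrow> real) metric" where
  "path_space T = cfunspace (top_of_set {0..T}) euclidean_metric"

definition lipschitz_payoff :: "real \<Rightarrow> real \<Rightarrow> ((real \<Rightarrow> real) \<Rightarrow> real) \<Rightarrow> bool" where
  "lipschitz_payoff L T \<Psi> \<longleftrightarrow> 0 \<le> L \<and>
     (\<forall>f\<in>mspace (path_space T). \<forall>g\<in>mspace (path_space T).
        dist (\<Psi> f) (\<Psi> g) \<le> L * mdist (path_space T) f g)"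

definition hits_barrier :: "'a measure \<Rightarrow> (real \<Rightarrow> 'a \<Rightarrow> real) \<Rightarrow> real \<Rightarrow> real \<Rightarrow> 'a set" where
  "hits_barrier M X B T = {\<omega> \<in> space M. B \<le> (SUP t\<in>{0..T}. X t \<omega>)}"

definition hitting_prob :: "'a measure \<Rightarrow> (real \<Rightarrow> 'a \<Rightarrow> real) \<Rightarrow> real \<Rightarrow> real \<Rightarrow> real" where
  "hitting_prob M X B T = measure M (hits_barrier M X B T)"

text \<open>The price depends on the strike \<open>K\<close> only through the payoff \<open>\<Psi>\<close>.\<close>

definition barrier_price ::
    "'a measure \<Rightarrow> (real \<Rightarrow> 'a \<Rightarrow> real) \<Rightarrow> ((real \<Rightarrow> real) \<Rightarrow> real) \<Rightarrow> real \<Rightarrow> real \<Rightarrow> real \<Rightarrow> real" where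
  "barrier_price M X \<Psi> B K T =
     (\<integral>\<omega>. \<Psi> (\<lambda>t\<in>{0..T}. X t \<omega>) * indicator (hits_barrier M X B T) \<omega> \<partial>M)"

end

theory Submission
  imports Defs
begin

text \<open>
  Put \<open>\<nu> = \<mu> - \<sigma>\<^sup>2 / 2\<close>, \<open>a = ln (B / S)\<close> and \<open>Y t = \<sigma> (W t - W 0) + \<nu> t\<close>. The solution is \<open>X t = S exp (Y t)\<close>:
  the product of an Euler scheme for \<open>X\<close>, driven by the simple processes that define the Ito integral, with
  \<open>exp (- Y t)\<close> moves in each step by terms of mean \<open>o(h)\<close> and small variance, so it is constant in the limit.

  Let \<open>D\<close> be the maximal deviation of \<open>Y\<close> from the line \<open>a t / T\<close>. Since \<open>S = B exp (- a)\<close>, the path \<open>X\<close> differs from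
  \<open>S (B / S) powr (t / T)\<close> by at most \<open>B D exp D\<close>, so it suffices to bound the expectation of \<open>exp (2 D / sqrt T)\<close> on the
  barrier event by a multiple of its probability, uniformly in \<open>a\<close>. Conditioning at the first passage over \<open>a\<close>
  replaces the barrier event by \<open>Y T \<ge> a\<close>, at the price of a larger exponent and a constant: afterwards \<open>Y\<close> has
  bounded exponential moments and ends above \<open>a\<close> with probability bounded below. On \<open>Y T \<ge> a\<close> one has
  \<open>D \<le> (Y T - a) + \<sigma> max \<bar>b\<bar>\<close>, where the Brownian bridge \<open>b\<close> is independent of the endpoint, and the overshoot
  \<open>Y T - a\<close> of a Gaussian has exponential moments on the scale \<open>sqrt T\<close> uniformly in \<open>a\<close>.
\<close>

section \<open>Increments of Brownian motion\<close>

text \<open>\<open>has_ito_integral\<close> controls everything in probability only, so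
  second-moment estimates cannot be applied to the solution directly: coefficients are cut off once
  their quadratic sum is too large, and errors are measured on events of nearly full probability.
  First passage is treated on finite grids, where it is a finite disjoint decomposition into events
  of the past; the continuous barrier is recovered by Fatou's lemma with a slightly lowered level.
  The scale is \<open>sqrt T\<close>: for \<open>T \<le> 1\<close>, \<open>D exp D\<close> is at
  most \<open>sqrt T exp (2 D / sqrt T)\<close>, which yields both the rate and the exponent 2.
  Short time also enters as \<open>\<bar>\<nu>\<bar> sqrt T \<le> \<sigma>\<close>: over any
  remaining time the drift is beaten by one standard deviation of the noise, so the bounds on the
  barrier event depend on \<open>\<sigma>\<close> alone. Hence the final constant is
  \<open>B * hitting_const \<sigma>\<close>, multiplied by the Lipschitz constant, while
  \<open>\<mu>\<close> enters through the admissible range of \<open>T\<close>.\<close>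

lemma grid_mono:
  fixes t :: "nat \<Rightarrow> real"
  assumes "\<And>i. i < n \<Longrightarrow> t i < t (Suc i)" "i \<le> k" "k \<le> n"
  shows "t i \<le> t k"
  using assms(2,3)
proof (induction k)
  case (Suc k)
  then show ?case
    using assms(1)[of k] by (cases "i = Suc k") auto
qed simp

context brownian_motion
begin

lemma W_measurable [measurable]: "0 \<le> t \<Longrightarrow> W t \<in> borel_measurable M"
  using adapted subalgebra_F measurable_from_subalg by blast

lemma sets_F_subset: "sets (F t) \<subseteq> sets M"
  using subalgebra_F[of t] by (simp add: subalgebra_def)

lemma measurable_F_M: "f \<in> F t \<rightarrow>\<^sub>M N \<Longrightarrow> f \<in> M \<rightarrow>\<^sub>M N"
  using subalgebra_F measurable_from_subalg by blast

lemma measurable_F_mono: "f \<in> F s \<rightarrow>\<^sub>M N \<Longrightarrow> s \<le> t \<Longrightarrow> f \<in> F t \<rightarrow>\<^sub>M N"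
  using sets_F_mono[of s t] space_F[of s] space_F[of t] by (auto simp: measurable_def)

lemma adapted_mono: "0 \<le> s \<Longrightarrow> s \<le> t \<Longrightarrow> W s \<in> borel_measurable (F t)"
  using adapted measurable_F_mono by blast

lemma increment_measurable: "0 \<le> s \<Longrightarrow> s \<le> t \<Longrightarrow> (\<lambda>\<omega>. W t \<omega> - W s \<omega>) \<in> borel_measurable M"
  by (intro borel_measurable_diff W_measurable) auto

lemma increment_distr:
  "0 \<le> s \<Longrightarrow> s < t \<Longrightarrow>
    distr M borel (\<lambda>\<omega>. W t \<omega> - W s \<omega>) = density lborel (\<lambda>x. ennreal (normal_density 0 (sqrt (t - s)) x))"
  using normal_increments[of s t] unfolding distributed_def
  by (metis (mono_tags, lifting) distr_cong sets_lborel)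

text \<open>Independence is assumed for events of the past and preimages under the increment.
  Rectangles determine a product of sigma-finite measures, so this already gives the law of the pair
  for past data \<open>G\<close> in any measurable space.\<close>

lemma increment_joint_distr:
  assumes "0 \<le> s" "s < t" and G: "G \<in> F s \<rightarrow>\<^sub>M N"
  shows "distr M (N \<Otimes>\<^sub>M borel) (\<lambda>\<omega>. (G \<omega>, W t \<omega> - W s \<omega>)) =
    distr M N G \<Otimes>\<^sub>M density lborel (\<lambda>x. ennreal (normal_density 0 (sqrt (t - s)) x))"
proof -
  let ?D = "\<lambda>\<omega>. W t \<omega> - W s \<omega>"
  let ?L = "density lborel (\<lambda>x. ennreal (normal_density 0 (sqrt (t - s)) x))"
  have [measurable]: "G \<in> M \<rightarrow>\<^sub>M N" "?D \<in> borel_measurable M"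
    using G measurable_F_M increment_measurable assms by auto
  interpret P: prob_space ?L
    using assms(2) by (intro prob_space_normal_density) simp
  interpret Q: prob_space "distr M N G"
    by (rule prob_space_distr) simp
  have "distr M N G \<Otimes>\<^sub>M ?L = distr M (N \<Otimes>\<^sub>M borel) (\<lambda>\<omega>. (G \<omega>, ?D \<omega>))"
  proof (rule pair_measure_eqI)
    fix A B assume A: "A \<in> sets (distr M N G)" and B: "B \<in> sets ?L"
    have [measurable]: "A \<in> sets N" "B \<in> sets borel"
      using A B by auto
    have "G -` A \<inter> space M \<in> sets (F s)"
      using measurable_sets[OF G, of A] space_F[of s] by simp
    then have "prob ((G -` A \<inter> space M) \<inter> (?D -` B \<inter> space M)) = prob (G -` A \<inter> space M) * prob (?D -` B \<inter> space M)"
      using indep_setD[OF indep_increments[OF assms(1,2)]] \<open>B \<in> sets borel\<close> by blast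
    moreover have "(\<lambda>\<omega>. (G \<omega>, ?D \<omega>)) -` (A \<times> B) \<inter> space M = (G -` A \<inter> space M) \<inter> (?D -` B \<inter> space M)"
      by auto
    moreover have "emeasure ?L B = emeasure M (?D -` B \<inter> space M)"
      using increment_distr[OF assms(1,2)] emeasure_distr[of ?D M borel B] by simp
    ultimately show "emeasure (distr M N G) A * emeasure ?L B =
        emeasure (distr M (N \<Otimes>\<^sub>M borel) (\<lambda>\<omega>. (G \<omega>, ?D \<omega>))) (A \<times> B)"
      by (simp add: emeasure_distr emeasure_eq_measure ennreal_mult)
  qed (auto intro: P.sigma_finite_measure_axioms Q.sigma_finite_measure_axioms cong: sets_pair_measure_cong)
  then show ?thesis by simp
qed

text \<open>The working form of independence: the past is frozen and the Gaussian increment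
  integrated out, even when the integrand does not factor. The bridge argument needs this
  generality.\<close>

lemma increment_disintegration:
  assumes "0 \<le> s" "s < t" and G: "G \<in> F s \<rightarrow>\<^sub>M N" and K [measurable]: "K \<in> borel_measurable (N \<Otimes>\<^sub>M borel)"
  shows "(\<integral>\<^sup>+\<omega>. K (G \<omega>, W t \<omega> - W s \<omega>) \<partial>M) =
    (\<integral>\<^sup>+\<omega>. (\<integral>\<^sup>+x. ennreal (normal_density 0 (sqrt (t - s)) x) * K (G \<omega>, x) \<partial>lborel) \<partial>M)"
proof -
  let ?D = "\<lambda>\<omega>. W t \<omega> - W s \<omega>"
  let ?n = "\<lambda>x. ennreal (normal_density 0 (sqrt (t - s)) x)"
  have [measurable]: "G \<in> M \<rightarrow>\<^sub>M N" "?D \<in> borel_measurable M"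
    using G measurable_F_M increment_measurable assms by auto
  interpret P: prob_space "density lborel ?n"
    using assms(2) by (intro prob_space_normal_density) simp
  have Kd [measurable]: "K \<in> borel_measurable (distr M N G \<Otimes>\<^sub>M density lborel ?n)"
    using K by (subst measurable_cong_sets[OF sets_pair_measure_cong refl, of _ N _ borel]) auto
  have "(\<integral>\<^sup>+\<omega>. K (G \<omega>, ?D \<omega>) \<partial>M) = (\<integral>\<^sup>+z. K z \<partial>distr M (N \<Otimes>\<^sub>M borel) (\<lambda>\<omega>. (G \<omega>, ?D \<omega>)))"
    by (subst nn_integral_distr) auto
  also have "\<dots> = (\<integral>\<^sup>+z. K z \<partial>(distr M N G \<Otimes>\<^sub>M density lborel ?n))"
    using increment_joint_distr[OF assms(1-3)] by simp
  also have "\<dots> = (\<integral>\<^sup>+g. (\<integral>\<^sup>+x. K (g, x) \<partial>density lborel ?n) \<partial>distr M N G)"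
    by (subst P.nn_integral_fst[symmetric]) auto
  also have "\<dots> = (\<integral>\<^sup>+\<omega>. (\<integral>\<^sup>+x. K (G \<omega>, x) \<partial>density lborel ?n) \<partial>M)"
    by (subst nn_integral_distr) (auto intro!: P.borel_measurable_nn_integral_fst cong: measurable_cong_sets)
  also have "\<dots> = (\<integral>\<^sup>+\<omega>. (\<integral>\<^sup>+x. ?n x * K (G \<omega>, x) \<partial>lborel) \<partial>M)"
  proof (intro nn_integral_cong)
    fix \<omega> assume "\<omega> \<in> space M"
    then have "G \<omega> \<in> space N"
      using measurable_space[OF measurable_F_M[OF G]] by simp
    then show "(\<integral>\<^sup>+x. K (G \<omega>, x) \<partial>density lborel ?n) = (\<integral>\<^sup>+x. ?n x * K (G \<omega>, x) \<partial>lborel)"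
      by (intro nn_integral_density) auto
  qed
  finally show ?thesis .
qed

lemma increment_nn_integral:
  fixes G :: "'a \<Rightarrow> ennreal" and f :: "real \<Rightarrow> ennreal"
  assumes "0 \<le> s" "s < t" and G: "G \<in> borel_measurable (F s)" and f [measurable]: "f \<in> borel_measurable borel"
  shows "(\<integral>\<^sup>+\<omega>. G \<omega> * f (W t \<omega> - W s \<omega>) \<partial>M) =
    (\<integral>\<^sup>+\<omega>. G \<omega> \<partial>M) * (\<integral>\<^sup>+x. ennreal (normal_density 0 (sqrt (t - s)) x) * f x \<partial>lborel)"
proof -
  have [measurable]: "G \<in> borel_measurable M"
    using G measurable_F_M by blast
  have "(\<integral>\<^sup>+\<omega>. G \<omega> * f (W t \<omega> - W s \<omega>) \<partial>M) =
      (\<integral>\<^sup>+\<omega>. (\<integral>\<^sup>+x. ennreal (normal_density 0 (sqrt (t - s)) x) * (G \<omega> * f x) \<partial>lborel) \<partial>M)"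
    using increment_disintegration[OF assms(1-3), of "\<lambda>(g, x). g * f x"] by simp
  also have "\<dots> = (\<integral>\<^sup>+\<omega>. G \<omega> * (\<integral>\<^sup>+x. ennreal (normal_density 0 (sqrt (t - s)) x) * f x \<partial>lborel) \<partial>M)"
    by (intro nn_integral_cong) (simp add: nn_integral_cmult[symmetric] mult_ac)
  finally show ?thesis
    by (simp add: nn_integral_multc)
qed

end

section \<open>The explicit solution of the linear stochastic differential equation\<close>

context brownian_motion
begin

lemma increment_integral:
  fixes G :: "'a \<Rightarrow> real" and f :: "real \<Rightarrow> real"
  assumes st: "0 \<le> s" "s < t" and G: "G \<in> borel_measurable (F s)" "integrable M G"
    and f [measurable]: "f \<in> borel_measurable borel"
    and fi: "integrable lborel (\<lambda>x. normal_density 0 (sqrt (t - s)) x * f x)"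
  shows "integrable M (\<lambda>\<omega>. G \<omega> * f (W t \<omega> - W s \<omega>))"
    and "(\<integral>\<omega>. G \<omega> * f (W t \<omega> - W s \<omega>) \<partial>M) =
      (\<integral>\<omega>. G \<omega> \<partial>M) * (\<integral>x. normal_density 0 (sqrt (t - s)) x * f x \<partial>lborel)"
proof -
  let ?D = "\<lambda>\<omega>. W t \<omega> - W s \<omega>"
  have [measurable]: "?D \<in> borel_measurable M"
    using increment_measurable st by auto
  have "indep_var borel G borel ?D"
    unfolding indep_var_distribution_eq
    using increment_joint_distr[OF st G(1)] increment_distr[OF st] measurable_F_M[OF G(1)] by simp
  then have "indep_var borel (id \<circ> G) borel (f \<circ> ?D)"
    by (rule indep_var_compose) auto
  then have iv: "indep_var borel G borel (\<lambda>\<omega>. f (?D \<omega>))"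
    by (simp add: comp_def)
  have i: "integrable M (\<lambda>\<omega>. f (?D \<omega>))"
    using fi distributed_integrable[OF normal_increments[OF st], of f] by simp
  show "integrable M (\<lambda>\<omega>. G \<omega> * f (?D \<omega>))"
    by (rule indep_var_integrable[OF iv G(2) i])
  show "(\<integral>\<omega>. G \<omega> * f (?D \<omega>) \<partial>M) =
      (\<integral>\<omega>. G \<omega> \<partial>M) * (\<integral>x. normal_density 0 (sqrt (t - s)) x * f x \<partial>lborel)"
    using indep_var_lebesgue_integral[OF iv G(2) i] distributed_integral[OF normal_increments[OF st], of f] by simp
qed

text \<open>The Ito isometry in discrete form. The cross term of the new summand with the partial
  sum is a past-measurable factor times a centred function of the next increment, so its mean is
  zero; bounded coefficients make every product integrable.\<close>

lemma martingale_sum_second_moment: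
  fixes \<theta> :: "nat \<Rightarrow> 'a \<Rightarrow> real" and \<psi> :: "nat \<Rightarrow> real \<Rightarrow> real" and t :: "nat \<Rightarrow> real"
  assumes t0: "0 \<le> t 0" and t: "\<And>i. i < n \<Longrightarrow> t i < t (Suc i)"
    and \<theta>: "\<And>i. i < n \<Longrightarrow> \<theta> i \<in> borel_measurable (F (t i))"
    and bd: "\<And>i \<omega>. i < n \<Longrightarrow> \<omega> \<in> space M \<Longrightarrow> \<bar>\<theta> i \<omega>\<bar> \<le> b i"
    and \<psi> [measurable]: "\<And>i. i < n \<Longrightarrow> \<psi> i \<in> borel_measurable borel"
    and i1: "\<And>i. i < n \<Longrightarrow> integrable lborel (\<lambda>x. normal_density 0 (sqrt (t (Suc i) - t i)) x * \<psi> i x)"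
    and i2: "\<And>i. i < n \<Longrightarrow> integrable lborel (\<lambda>x. normal_density 0 (sqrt (t (Suc i) - t i)) x * (\<psi> i x)\<^sup>2)"
    and m1: "\<And>i. i < n \<Longrightarrow> (\<integral>x. normal_density 0 (sqrt (t (Suc i) - t i)) x * \<psi> i x \<partial>lborel) = 0"
    and m2: "\<And>i. i < n \<Longrightarrow> (\<integral>x. normal_density 0 (sqrt (t (Suc i) - t i)) x * (\<psi> i x)\<^sup>2 \<partial>lborel) \<le> C * (t (Suc i) - t i)"
  defines "S \<equiv> \<lambda>k \<omega>. \<Sum>i<k. \<theta> i \<omega> * \<psi> i (W (t (Suc i)) \<omega> - W (t i) \<omega>)"
  shows "integrable M (\<lambda>\<omega>. (S n \<omega>)\<^sup>2) \<and>
    (\<integral>\<omega>. (S n \<omega>)\<^sup>2 \<partial>M) \<le> C * (\<integral>\<omega>. (\<Sum>i<n. (\<theta> i \<omega>)\<^sup>2 * (t (Suc i) - t i)) \<partial>M)"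
proof -
  have tpos: "0 \<le> t k" if "k \<le> n" for k
    using that by (induction k) (use t0 t in \<open>auto intro: less_imp_le order_trans simp: Suc_le_eq\<close>)
  have tmono: "t i \<le> t k" if "i \<le> k" "k \<le> n" for i k
    using grid_mono[of n t i k] t that by blast
  have Smeas: "S k \<in> borel_measurable (F (t k))" if "k \<le> n" for k
    unfolding S_def
  proof (intro borel_measurable_sum borel_measurable_times)
    fix i assume i: "i \<in> {..<k}"
    show "\<theta> i \<in> borel_measurable (F (t k))"
      using i that \<theta>[of i] tmono[of i k] measurable_F_mono by auto
    have "W (t (Suc i)) \<in> borel_measurable (F (t k))" "W (t i) \<in> borel_measurable (F (t k))"
      using i that tmono tpos by (auto intro!: adapted_mono simp: Suc_le_eq)
    then show "(\<lambda>\<omega>. \<psi> i (W (t (Suc i)) \<omega> - W (t i) \<omega>)) \<in> borel_measurable (F (t k))"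
      using i that by (intro measurable_compose[OF _ \<psi>] borel_measurable_diff) auto
  qed
  have \<theta>M: "\<theta> i \<in> borel_measurable M" if "i < n" for i
    using measurable_F_M[OF \<theta>[OF that]] .
  have bnn: "0 \<le> b i" if "i < n" for i
    using bd[OF that] not_empty by (metis abs_ge_zero all_not_in_conv order_trans)
  have \<theta>2: "integrable M (\<lambda>\<omega>. (\<theta> i \<omega>)\<^sup>2)" if "i < n" for i
  proof (rule integrable_const_bound[where B="(b i)\<^sup>2"])
    show "AE \<omega> in M. norm ((\<theta> i \<omega>)\<^sup>2) \<le> (b i)\<^sup>2"
    proof (rule AE_I2)
      fix \<omega> assume "\<omega> \<in> space M"
      then have "\<bar>\<theta> i \<omega>\<bar>\<^sup>2 \<le> (b i)\<^sup>2"
        using bd[OF that] by (intro power_mono) auto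
      then show "norm ((\<theta> i \<omega>)\<^sup>2) \<le> (b i)\<^sup>2"
        by simp
    qed
  qed (use \<theta>M[OF that] in measurable)
  have "integrable M (\<lambda>\<omega>. (S k \<omega>)\<^sup>2) \<and>
    (\<integral>\<omega>. (S k \<omega>)\<^sup>2 \<partial>M) \<le> C * (\<Sum>i<k. (t (Suc i) - t i) * (\<integral>\<omega>. (\<theta> i \<omega>)\<^sup>2 \<partial>M))" if "k \<le> n" for k
    using that
  proof (induction k)
    case 0
    then show ?case by (simp add: S_def)
  next
    case (Suc k)
    then have k: "k < n" by simp
    have IH1: "integrable M (\<lambda>\<omega>. (S k \<omega>)\<^sup>2)" and IH2: "(\<integral>\<omega>. (S k \<omega>)\<^sup>2 \<partial>M) \<le> C * (\<Sum>i<k. (t (Suc i) - t i) * (\<integral>\<omega>. (\<theta> i \<omega>)\<^sup>2 \<partial>M))"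
      using Suc by auto
    note st = tpos[OF less_imp_le[OF k]] t[OF k]
    let ?D = "\<lambda>\<omega>. W (t (Suc k)) \<omega> - W (t k) \<omega>"
    have SF: "S k \<in> borel_measurable (F (t k))"
      using Smeas k by simp
    have Si: "integrable M (S k)"
      using IH1 measurable_F_M[OF SF] by (rule square_integrable_imp_integrable[rotated])
    have "integrable M (\<lambda>\<omega>. S k \<omega> * \<theta> k \<omega>)"
    proof (rule Bochner_Integration.integrable_bound[of M "\<lambda>\<omega>. S k \<omega> * b k"])
      show "AE \<omega> in M. norm (S k \<omega> * \<theta> k \<omega>) \<le> norm (S k \<omega> * b k)"
        using bd[OF k] bnn[OF k] by (intro AE_I2) (auto simp: abs_mult intro!: mult_left_mono)
    qed (use Si \<theta>M[OF k] measurable_F_M[OF SF] in auto)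
    moreover have "(\<lambda>\<omega>. S k \<omega> * \<theta> k \<omega>) \<in> borel_measurable (F (t k))"
      using SF \<theta>[OF k] by measurable
    ultimately have c: "integrable M (\<lambda>\<omega>. S k \<omega> * \<theta> k \<omega> * \<psi> k (?D \<omega>))"
        "(\<integral>\<omega>. S k \<omega> * \<theta> k \<omega> * \<psi> k (?D \<omega>) \<partial>M) = 0"
      using increment_integral[OF st, of "\<lambda>\<omega>. S k \<omega> * \<theta> k \<omega>" "\<psi> k"] i1[OF k] m1[OF k] \<psi>[OF k] by auto
    have "(\<lambda>\<omega>. (\<theta> k \<omega>)\<^sup>2) \<in> borel_measurable (F (t k))"
      using \<theta>[OF k] by measurable
    note d = increment_integral[OF st this \<theta>2[OF k] _ i2[OF k]]
    have d1: "integrable M (\<lambda>\<omega>. (\<theta> k \<omega>)\<^sup>2 * (\<psi> k (?D \<omega>))\<^sup>2)"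
      using d(1) \<psi>[OF k] by simp
    have d2: "(\<integral>\<omega>. (\<theta> k \<omega>)\<^sup>2 * (\<psi> k (?D \<omega>))\<^sup>2 \<partial>M) \<le> C * ((t (Suc k) - t k) * (\<integral>\<omega>. (\<theta> k \<omega>)\<^sup>2 \<partial>M))"
      using d(2) \<psi>[OF k] mult_left_mono[OF m2[OF k], of "\<integral>\<omega>. (\<theta> k \<omega>)\<^sup>2 \<partial>M"] by (simp add: mult_ac)
    have eq: "(S (Suc k) \<omega>)\<^sup>2 = (S k \<omega>)\<^sup>2 + 2 * (S k \<omega> * \<theta> k \<omega> * \<psi> k (?D \<omega>)) + (\<theta> k \<omega>)\<^sup>2 * (\<psi> k (?D \<omega>))\<^sup>2" for \<omega>
      unfolding S_def by (simp add: power2_eq_square algebra_simps)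
    show ?case
      unfolding eq using IH1 IH2 c d1 d2 by (simp add: algebra_simps)
  qed
  from this[of n] show ?thesis
    using \<theta>2 by (simp add: mult_ac)
qed

text \<open>An inequality of Lenglart type. No bound on \<open>\<theta>\<close> is assumed, so it is
  truncated to \<open>\<eta>\<close>, which agrees with \<open>\<theta>\<close> off the exceptional
  event. In the constant, \<open>2 * C\<close> comes from the centred sum and the term with
  \<open>C\<^sup>2\<close> from the accumulated means, by
  \<open>(S + d)\<^sup>2 \<le> 2 * S\<^sup>2 + 2 * d\<^sup>2\<close>.\<close>

lemma discrete_stochastic_sum_bound:
  fixes \<theta> :: "nat \<Rightarrow> 'a \<Rightarrow> real" and \<psi> :: "nat \<Rightarrow> real \<Rightarrow> real" and t :: "nat \<Rightarrow> real"
  assumes t0: "0 \<le> t 0" and t: "\<And>i. i < n \<Longrightarrow> t i < t (Suc i)"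
    and \<theta>: "\<And>i. i < n \<Longrightarrow> \<theta> i \<in> borel_measurable (F (t i))"
    and \<psi> [measurable]: "\<And>i. i < n \<Longrightarrow> \<psi> i \<in> borel_measurable borel"
    and i1: "\<And>i. i < n \<Longrightarrow> integrable lborel (\<lambda>x. normal_density 0 (sqrt (t (Suc i) - t i)) x * \<psi> i x)"
    and i2: "\<And>i. i < n \<Longrightarrow> integrable lborel (\<lambda>x. normal_density 0 (sqrt (t (Suc i) - t i)) x * (\<psi> i x)\<^sup>2)"
    and m1: "\<And>i. i < n \<Longrightarrow> \<bar>\<integral>x. normal_density 0 (sqrt (t (Suc i) - t i)) x * \<psi> i x \<partial>lborel\<bar> \<le> C * (t (Suc i) - t i)"
    and m2: "\<And>i. i < n \<Longrightarrow> (\<integral>x. normal_density 0 (sqrt (t (Suc i) - t i)) x * (\<psi> i x)\<^sup>2 \<partial>lborel) \<le> C * (t (Suc i) - t i)"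
    and "0 < \<delta>" "0 < \<epsilon>" "0 \<le> C"
  shows "prob {\<omega>\<in>space M. \<epsilon> \<le> \<bar>\<Sum>i<n. \<theta> i \<omega> * \<psi> i (W (t (Suc i)) \<omega> - W (t i) \<omega>)\<bar>} \<le>
    prob {\<omega>\<in>space M. \<delta> < (\<Sum>i<n. (\<theta> i \<omega>)\<^sup>2 * (t (Suc i) - t i))} + (2 * C + 2 * C\<^sup>2 * (t n - t 0)) * \<delta> / \<epsilon>\<^sup>2"
proof -
  define h where "h i = t (Suc i) - t i" for i
  define \<phi> where "\<phi> i = normal_density 0 (sqrt (h i))" for i
  define m where "m i = (\<integral>x. \<phi> i x * \<psi> i x \<partial>lborel)" for i
  define D where "D i \<omega> = W (t (Suc i)) \<omega> - W (t i) \<omega>" for i \<omega>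
  \<comment> \<open>The running sum includes index \<open>i\<close> and is known at time
    \<open>t i\<close>, so the cutoff stays adapted. Cutting before the excess occurs, and not
    after, keeps the quadratic sum of \<open>\<eta>\<close> below \<open>\<delta>\<close> without
    overshoot.\<close>
  define \<eta> where "\<eta> i \<omega> = (if (\<Sum>j\<le>i. (\<theta> j \<omega>)\<^sup>2 * h j) \<le> \<delta> then \<theta> i \<omega> else 0)" for i \<omega>
  have h: "0 < h i" if "i < n" for i
    using t[OF that] by (simp add: h_def)
  have h0: "0 \<le> h i" if "i < n" for i
    using h[OF that] by simp
  have tpos: "0 \<le> t k" if "k \<le> n" for k
    using that by (induction k) (use t0 t in \<open>auto intro: less_imp_le order_trans simp: Suc_le_eq\<close>)
  have tmono: "t i \<le> t k" if "i \<le> k" "k \<le> n" for i k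
    using grid_mono[of n t i k] t that by blast
  have \<eta>_le: "(\<Sum>i<k. (\<eta> i \<omega>)\<^sup>2 * h i) \<le> \<delta>" if "k \<le> n" for k \<omega>
    using that
  proof (induction k)
    case 0
    then show ?case using \<open>0 < \<delta>\<close> by simp
  next
    case (Suc k)
    show ?case
    proof (cases "(\<Sum>j\<le>k. (\<theta> j \<omega>)\<^sup>2 * h j) \<le> \<delta>")
      case True
      have "(\<Sum>i<Suc k. (\<eta> i \<omega>)\<^sup>2 * h i) \<le> (\<Sum>i<Suc k. (\<theta> i \<omega>)\<^sup>2 * h i)"
        using Suc.prems h by (intro sum_mono mult_right_mono) (auto simp: \<eta>_def h0)
      then show ?thesis
        using True by (simp add: lessThan_Suc_atMost)
    next
      case False
      then show ?thesis
        using Suc by (simp add: \<eta>_def)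
    qed
  qed
  have \<eta>_meas: "\<eta> i \<in> borel_measurable (F (t i))" if "i < n" for i
  proof -
    have "\<theta> j \<in> borel_measurable (F (t i))" if "j \<le> i" for j
      using \<theta>[of j] tmono[of j i] that \<open>i < n\<close> measurable_F_mono by auto
    then have "(\<lambda>\<omega>. \<Sum>j\<le>i. (\<theta> j \<omega>)\<^sup>2 * h j) \<in> borel_measurable (F (t i))" "\<theta> i \<in> borel_measurable (F (t i))"
      by auto
    then show ?thesis
      unfolding \<eta>_def by measurable
  qed
  \<comment> \<open>A single term of a sum bounded by \<open>\<delta>\<close> gives a deterministic
    bound. It may blow up as the mesh shrinks, which is harmless because it serves integrability
    alone.\<close>
  have \<eta>_bd: "\<bar>\<eta> i \<omega>\<bar> \<le> sqrt (\<delta> / h i)" if "i < n" for i \<omega>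
  proof -
    have "(\<eta> i \<omega>)\<^sup>2 * h i \<le> (\<Sum>j<Suc i. (\<eta> j \<omega>)\<^sup>2 * h j)"
      using that h by (intro member_le_sum) (auto intro!: mult_nonneg_nonneg h0)
    also have "\<dots> \<le> \<delta>"
      using \<eta>_le[of "Suc i"] that by simp
    finally have "(\<eta> i \<omega>)\<^sup>2 \<le> \<delta> / h i"
      using h[OF that] by (simp add: field_simps)
    then show ?thesis
      by (metis real_sqrt_abs real_sqrt_le_iff)
  qed
  have \<phi>i: "integrable lborel (\<phi> i)" "(\<integral>x. \<phi> i x \<partial>lborel) = 1" if "i < n" for i
    using h[OF that] by (auto simp: \<phi>_def)
  have i1': "integrable lborel (\<lambda>x. \<phi> i x * \<psi> i x)" and i2': "integrable lborel (\<lambda>x. \<phi> i x * (\<psi> i x)\<^sup>2)" if "i < n" for i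
    using i1[OF that] i2[OF that] by (auto simp: \<phi>_def h_def)
  define S where "S \<omega> = (\<Sum>i<n. \<eta> i \<omega> * (\<psi> i (D i \<omega>) - m i))" for \<omega>
  have "integrable M (\<lambda>\<omega>. (S \<omega>)\<^sup>2) \<and>
    (\<integral>\<omega>. (S \<omega>)\<^sup>2 \<partial>M) \<le> C * (\<integral>\<omega>. (\<Sum>i<n. (\<eta> i \<omega>)\<^sup>2 * (t (Suc i) - t i)) \<partial>M)"
    unfolding S_def D_def
  proof (rule martingale_sum_second_moment[where b="\<lambda>i. sqrt (\<delta> / h i)"])
    fix i assume i: "i < n"
    note a = i1'[OF i] i2'[OF i] \<phi>i[OF i]
    show "integrable lborel (\<lambda>x. normal_density 0 (sqrt (t (Suc i) - t i)) x * (\<psi> i x - m i))"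
      using a by (simp add: \<phi>_def h_def right_diff_distrib)
    show "(\<integral>x. normal_density 0 (sqrt (t (Suc i) - t i)) x * (\<psi> i x - m i) \<partial>lborel) = 0"
      using a by (simp add: \<phi>_def h_def right_diff_distrib m_def)
    have sq: "(\<lambda>x. normal_density 0 (sqrt (t (Suc i) - t i)) x * (\<psi> i x - m i)\<^sup>2) =
       (\<lambda>x. \<phi> i x * (\<psi> i x)\<^sup>2 - 2 * m i * (\<phi> i x * \<psi> i x) + (m i)\<^sup>2 * \<phi> i x)"
      by (auto simp: \<phi>_def h_def power2_eq_square algebra_simps)
    show "integrable lborel (\<lambda>x. normal_density 0 (sqrt (t (Suc i) - t i)) x * (\<psi> i x - m i)\<^sup>2)"
      unfolding sq using a by simp
    have "(\<integral>x. normal_density 0 (sqrt (t (Suc i) - t i)) x * (\<psi> i x - m i)\<^sup>2 \<partial>lborel) = (\<integral>x. \<phi> i x * (\<psi> i x)\<^sup>2 \<partial>lborel) - (m i)\<^sup>2"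
      unfolding sq using a by (simp add: m_def power2_eq_square)
    also have "\<dots> \<le> (\<integral>x. \<phi> i x * (\<psi> i x)\<^sup>2 \<partial>lborel)"
      by simp
    also have "\<dots> \<le> C * (t (Suc i) - t i)"
      using m2[OF i] by (simp add: \<phi>_def h_def)
    finally show "(\<integral>x. normal_density 0 (sqrt (t (Suc i) - t i)) x * (\<psi> i x - m i)\<^sup>2 \<partial>lborel) \<le> C * (t (Suc i) - t i)" .
  qed (use t0 t \<eta>_meas \<eta>_bd \<psi> in auto)
  then have S1: "integrable M (\<lambda>\<omega>. (S \<omega>)\<^sup>2)" and S2: "(\<integral>\<omega>. (S \<omega>)\<^sup>2 \<partial>M) \<le> C * (\<integral>\<omega>. (\<Sum>i<n. (\<eta> i \<omega>)\<^sup>2 * h i) \<partial>M)"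
    by (auto simp: h_def)
  have \<eta>M [measurable]: "\<eta> i \<in> borel_measurable M" if "i < n" for i
    using measurable_F_M[OF \<eta>_meas[OF that]] .
  have "integrable M (\<lambda>\<omega>. \<Sum>i<n. (\<eta> i \<omega>)\<^sup>2 * h i)"
  proof (rule integrable_const_bound[where B=\<delta>])
    show "AE \<omega> in M. norm (\<Sum>i<n. (\<eta> i \<omega>)\<^sup>2 * h i) \<le> \<delta>"
    proof (rule AE_I2)
      fix \<omega>
      have "0 \<le> (\<Sum>i<n. (\<eta> i \<omega>)\<^sup>2 * h i)"
        by (auto intro!: sum_nonneg mult_nonneg_nonneg h0)
      then show "norm (\<Sum>i<n. (\<eta> i \<omega>)\<^sup>2 * h i) \<le> \<delta>"
        using \<eta>_le[of n \<omega>] by simp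
    qed
  qed auto
  then have "(\<integral>\<omega>. (\<Sum>i<n. (\<eta> i \<omega>)\<^sup>2 * h i) \<partial>M) \<le> \<delta>"
    using \<eta>_le[of n] by (intro integral_le_const) auto
  then have S3: "(\<integral>\<omega>. (S \<omega>)\<^sup>2 \<partial>M) \<le> C * \<delta>"
    using S2 \<open>0 \<le> C\<close> by (meson mult_left_mono order_trans)
  define Z where "Z \<omega> = (\<Sum>i<n. \<eta> i \<omega> * \<psi> i (D i \<omega>))" for \<omega>
  have hsum: "(\<Sum>i<n. h i) = t n - t 0"
    unfolding h_def by (simp add: sum_lessThan_telescope)
  have Z_le: "(Z \<omega>)\<^sup>2 \<le> 2 * (S \<omega>)\<^sup>2 + 2 * C\<^sup>2 * (t n - t 0) * \<delta>" for \<omega>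
  proof -
    \<comment> \<open>The means are of order \<open>h i\<close>. Splitting \<open>h i\<close> into
      two factors \<open>sqrt (h i)\<close> lets Cauchy-Schwarz bound their total by the quadratic
      sum of \<open>\<eta>\<close> and the length of the time interval.\<close>
    define d where "d = (\<Sum>i<n. \<eta> i \<omega> * m i)"
    have "\<bar>d\<bar> \<le> (\<Sum>i<n. \<bar>\<eta> i \<omega>\<bar> * (C * h i))"
      unfolding d_def using m1
      by (intro order_trans[OF sum_abs] sum_mono) (auto simp: abs_mult m_def \<phi>_def h_def intro!: mult_left_mono)
    also have "\<dots> = (\<Sum>i<n. (\<bar>\<eta> i \<omega>\<bar> * sqrt (h i)) * (C * sqrt (h i)))"
      using h by (intro sum.cong refl) (auto simp: mult_ac h0 simp flip: real_sqrt_mult)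
    finally have "d\<^sup>2 \<le> (\<Sum>i<n. (\<bar>\<eta> i \<omega>\<bar> * sqrt (h i)) * (C * sqrt (h i)))\<^sup>2"
      by (metis abs_ge_zero power2_abs power_mono)
    also have "\<dots> \<le> (\<Sum>i<n. (\<bar>\<eta> i \<omega>\<bar> * sqrt (h i))\<^sup>2) * (\<Sum>i<n. (C * sqrt (h i))\<^sup>2)"
      by (rule Cauchy_Schwarz_ineq_sum)
    also have "(\<Sum>i<n. (\<bar>\<eta> i \<omega>\<bar> * sqrt (h i))\<^sup>2) = (\<Sum>i<n. (\<eta> i \<omega>)\<^sup>2 * h i)"
      using h by (intro sum.cong refl) (auto simp: power_mult_distrib h0)
    also have "(\<Sum>i<n. (C * sqrt (h i))\<^sup>2) = C\<^sup>2 * (t n - t 0)"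
      using h by (simp add: power_mult_distrib h0 hsum[symmetric] sum_distrib_left)
    also have "(\<Sum>i<n. (\<eta> i \<omega>)\<^sup>2 * h i) * (C\<^sup>2 * (t n - t 0)) \<le> \<delta> * (C\<^sup>2 * (t n - t 0))"
      using \<eta>_le[of n \<omega>] tmono[of 0 n] by (intro mult_right_mono) auto
    finally have "d\<^sup>2 \<le> C\<^sup>2 * (t n - t 0) * \<delta>"
      by (simp add: mult_ac)
    moreover have "Z \<omega> = S \<omega> + d"
      by (simp add: Z_def S_def d_def sum.distrib[symmetric] algebra_simps)
    moreover have "(S \<omega> + d)\<^sup>2 \<le> 2 * (S \<omega>)\<^sup>2 + 2 * d\<^sup>2"
      using sum_squares_bound[of "S \<omega>" d] by (simp add: power2_sum)
    ultimately show ?thesis by simp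
  qed
  have [measurable]: "D i \<in> borel_measurable M" if "i < n" for i
    unfolding D_def using tpos[of i] tmono[of i "Suc i"] that by (intro increment_measurable) auto
  have [measurable]: "(\<lambda>\<omega>. \<psi> i (D i \<omega>)) \<in> borel_measurable M" if "i < n" for i
    using that by measurable
  have [measurable]: "Z \<in> borel_measurable M"
    unfolding Z_def by measurable
  have Zi: "integrable M (\<lambda>\<omega>. (Z \<omega>)\<^sup>2)"
  proof (rule Bochner_Integration.integrable_bound[of M "\<lambda>\<omega>. 2 * (S \<omega>)\<^sup>2 + 2 * C\<^sup>2 * (t n - t 0) * \<delta>"])
    show "AE \<omega> in M. norm ((Z \<omega>)\<^sup>2) \<le> norm (2 * (S \<omega>)\<^sup>2 + 2 * C\<^sup>2 * (t n - t 0) * \<delta>)"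
      using Z_le by (intro AE_I2) (auto intro: order_trans[OF _ abs_ge_self])
  qed (use S1 in auto)
  have "(\<integral>\<omega>. (Z \<omega>)\<^sup>2 \<partial>M) \<le> (\<integral>\<omega>. 2 * (S \<omega>)\<^sup>2 + 2 * C\<^sup>2 * (t n - t 0) * \<delta> \<partial>M)"
    using Z_le by (intro integral_mono Zi) (use S1 in auto)
  also have "\<dots> = 2 * (\<integral>\<omega>. (S \<omega>)\<^sup>2 \<partial>M) + 2 * C\<^sup>2 * (t n - t 0) * \<delta>"
    using S1 by (simp add: prob_space)
  also have "\<dots> \<le> (2 * C + 2 * C\<^sup>2 * (t n - t 0)) * \<delta>"
    using S3 by (simp add: algebra_simps)
  finally have Z2: "(\<integral>\<omega>. (Z \<omega>)\<^sup>2 \<partial>M) \<le> (2 * C + 2 * C\<^sup>2 * (t n - t 0)) * \<delta>" .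
  have "prob {\<omega>\<in>space M. \<epsilon>\<^sup>2 \<le> (Z \<omega>)\<^sup>2} \<le> (\<integral>\<omega>. (Z \<omega>)\<^sup>2 \<partial>M) / \<epsilon>\<^sup>2"
    using \<open>0 < \<epsilon>\<close> Zi by (intro integral_Markov_inequality_measure[where A="{}"]) auto
  also have "\<dots> \<le> (2 * C + 2 * C\<^sup>2 * (t n - t 0)) * \<delta> / \<epsilon>\<^sup>2"
    using Z2 by (intro divide_right_mono) auto
  finally have P: "prob {\<omega>\<in>space M. \<epsilon>\<^sup>2 \<le> (Z \<omega>)\<^sup>2} \<le> (2 * C + 2 * C\<^sup>2 * (t n - t 0)) * \<delta> / \<epsilon>\<^sup>2" .
  have \<theta>M [measurable]: "\<theta> i \<in> borel_measurable M" if "i < n" for i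
    using measurable_F_M[OF \<theta>[OF that]] .
  have sub: "{\<omega>\<in>space M. \<epsilon> \<le> \<bar>\<Sum>i<n. \<theta> i \<omega> * \<psi> i (D i \<omega>)\<bar>} \<subseteq>
      {\<omega>\<in>space M. \<delta> < (\<Sum>i<n. (\<theta> i \<omega>)\<^sup>2 * h i)} \<union> {\<omega>\<in>space M. \<epsilon>\<^sup>2 \<le> (Z \<omega>)\<^sup>2}"
  proof safe
    fix \<omega> assume \<omega>: "\<omega> \<in> space M" "\<epsilon> \<le> \<bar>\<Sum>i<n. \<theta> i \<omega> * \<psi> i (D i \<omega>)\<bar>" "\<not> \<epsilon>\<^sup>2 \<le> (Z \<omega>)\<^sup>2"
    show "\<delta> < (\<Sum>i<n. (\<theta> i \<omega>)\<^sup>2 * h i)"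
    proof (rule ccontr)
      assume "\<not> ?thesis"
      then have le: "(\<Sum>i<n. (\<theta> i \<omega>)\<^sup>2 * h i) \<le> \<delta>" by simp
      have "\<eta> i \<omega> = \<theta> i \<omega>" if "i < n" for i
      proof -
        have "(\<Sum>j\<le>i. (\<theta> j \<omega>)\<^sup>2 * h j) \<le> (\<Sum>j<n. (\<theta> j \<omega>)\<^sup>2 * h j)"
          using that h by (intro sum_mono2) (auto intro!: mult_nonneg_nonneg h0)
        then show ?thesis using le by (simp add: \<eta>_def)
      qed
      then have "Z \<omega> = (\<Sum>i<n. \<theta> i \<omega> * \<psi> i (D i \<omega>))"
        by (simp add: Z_def)
      then have "\<epsilon> \<le> \<bar>Z \<omega>\<bar>" using \<omega> by simp
      then have "\<epsilon>\<^sup>2 \<le> (Z \<omega>)\<^sup>2"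
        using \<open>0 < \<epsilon>\<close> by (metis less_imp_le power2_abs power_mono)
      then show False using \<omega> by simp
    qed
  qed
  have "prob {\<omega>\<in>space M. \<epsilon> \<le> \<bar>\<Sum>i<n. \<theta> i \<omega> * \<psi> i (D i \<omega>)\<bar>} \<le>
     prob ({\<omega>\<in>space M. \<delta> < (\<Sum>i<n. (\<theta> i \<omega>)\<^sup>2 * h i)} \<union> {\<omega>\<in>space M. \<epsilon>\<^sup>2 \<le> (Z \<omega>)\<^sup>2})"
    by (intro finite_measure_mono sub) measurable
  also have "\<dots> \<le> prob {\<omega>\<in>space M. \<delta> < (\<Sum>i<n. (\<theta> i \<omega>)\<^sup>2 * h i)} + prob {\<omega>\<in>space M. \<epsilon>\<^sup>2 \<le> (Z \<omega>)\<^sup>2}"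
    by (intro measure_Un_le) measurable
  finally show ?thesis
    using P unfolding D_def h_def by simp
qed

end

section \<open>Exponential moments of one Gaussian step\<close>

lemma normal_density_exp:
  assumes "0 < h"
  shows "normal_density 0 (sqrt h) x * exp (s * x) = exp (s\<^sup>2 * h / 2) * normal_density (s * h) (sqrt h) x"
proof -
  have "- (x\<^sup>2 / (2 * h)) + s * x = s\<^sup>2 * h / 2 + - ((x - s * h)\<^sup>2 / (2 * h))"
    using assms by (simp add: power2_eq_square field_simps)
  then show ?thesis
    using assms by (simp add: normal_density_def exp_add[symmetric])
qed

text \<open>The factor \<open>exp (s * x)\<close> moves the mean of the Gaussian to
  \<open>s * h\<close>. Writing \<open>c + d * x\<close> as
  \<open>(c + d * s * h) + d * (x - s * h)\<close> reduces everything to the first two central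
  moments.\<close>

lemma normal_exp_moments:
  fixes h s c d :: real
  assumes "0 < h"
  shows "integrable lborel (\<lambda>x. normal_density 0 (sqrt h) x * ((c + d * x)\<^sup>2 * exp (s * x)))" (is ?i2)
    and "(\<integral>x. normal_density 0 (sqrt h) x * ((c + d * x)\<^sup>2 * exp (s * x)) \<partial>lborel) =
      exp (s\<^sup>2 * h / 2) * ((c + d * s * h)\<^sup>2 + d\<^sup>2 * h)" (is ?e2)
    and "integrable lborel (\<lambda>x. normal_density 0 (sqrt h) x * ((c + d * x) * exp (s * x)))" (is ?i1)
    and "(\<integral>x. normal_density 0 (sqrt h) x * ((c + d * x) * exp (s * x)) \<partial>lborel) =
      exp (s\<^sup>2 * h / 2) * (c + d * s * h)" (is ?e1)
proof -
  let ?\<phi> = "normal_density (s * h) (sqrt h)"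
  let ?k = "c + d * s * h"
  have p: "0 < sqrt h" using assms by simp
  have 2: "has_bochner_integral lborel (\<lambda>x. ?\<phi> x * (x - s * h)\<^sup>2) h"
    using normal_moment_even[OF p, of "s * h" 1] assms by (simp add: fact_2 numeral_2_eq_2)
  have 1: "has_bochner_integral lborel (\<lambda>x. ?\<phi> x * (x - s * h)) 0"
    using normal_moment_odd[OF p, of "s * h" 0] by simp
  have 0: "has_bochner_integral lborel ?\<phi> 1"
    using p by (simp add: has_bochner_integral_iff)
  have "has_bochner_integral lborel (\<lambda>x. exp (s\<^sup>2 * h / 2) * (?k\<^sup>2 * ?\<phi> x + (2 * ?k * d) * (?\<phi> x * (x - s * h)) + d\<^sup>2 * (?\<phi> x * (x - s * h)\<^sup>2)))
     (exp (s\<^sup>2 * h / 2) * (?k\<^sup>2 * 1 + (2 * ?k * d) * 0 + d\<^sup>2 * h))"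
    by (intro has_bochner_integral_add has_bochner_integral_mult_right 0 1 2)
  moreover have "(\<lambda>x. exp (s\<^sup>2 * h / 2) * (?k\<^sup>2 * ?\<phi> x + (2 * ?k * d) * (?\<phi> x * (x - s * h)) + d\<^sup>2 * (?\<phi> x * (x - s * h)\<^sup>2))) =
     (\<lambda>x. normal_density 0 (sqrt h) x * ((c + d * x)\<^sup>2 * exp (s * x)))"
  proof
    fix x
    have "normal_density 0 (sqrt h) x * ((c + d * x)\<^sup>2 * exp (s * x)) = (normal_density 0 (sqrt h) x * exp (s * x)) * (c + d * x)\<^sup>2"
      by simp
    also have "\<dots> = exp (s\<^sup>2 * h / 2) * ?\<phi> x * (?k + d * (x - s * h))\<^sup>2"
      unfolding normal_density_exp[OF assms] by (simp add: algebra_simps)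
    finally show "exp (s\<^sup>2 * h / 2) * (?k\<^sup>2 * ?\<phi> x + (2 * ?k * d) * (?\<phi> x * (x - s * h)) + d\<^sup>2 * (?\<phi> x * (x - s * h)\<^sup>2)) =
      normal_density 0 (sqrt h) x * ((c + d * x)\<^sup>2 * exp (s * x))"
      unfolding power2_sum power_mult_distrib by (simp only: distrib_left distrib_right mult_ac)
  qed
  ultimately have "has_bochner_integral lborel (\<lambda>x. normal_density 0 (sqrt h) x * ((c + d * x)\<^sup>2 * exp (s * x)))
     (exp (s\<^sup>2 * h / 2) * (?k\<^sup>2 * 1 + (2 * ?k * d) * 0 + d\<^sup>2 * h))"
    by (simp only:)
  then show ?i2 ?e2
    by (auto simp: has_bochner_integral_iff)
  have "has_bochner_integral lborel (\<lambda>x. exp (s\<^sup>2 * h / 2) * (?k * ?\<phi> x + d * (?\<phi> x * (x - s * h))))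
     (exp (s\<^sup>2 * h / 2) * (?k * 1 + d * 0))"
    by (intro has_bochner_integral_add has_bochner_integral_mult_right 0 1)
  moreover have "(\<lambda>x. exp (s\<^sup>2 * h / 2) * (?k * ?\<phi> x + d * (?\<phi> x * (x - s * h)))) =
     (\<lambda>x. normal_density 0 (sqrt h) x * ((c + d * x) * exp (s * x)))"
  proof
    fix x
    have "normal_density 0 (sqrt h) x * ((c + d * x) * exp (s * x)) = (normal_density 0 (sqrt h) x * exp (s * x)) * (c + d * x)"
      by simp
    also have "\<dots> = exp (s\<^sup>2 * h / 2) * ?\<phi> x * (?k + d * (x - s * h))"
      unfolding normal_density_exp[OF assms] by (simp add: algebra_simps)
    finally show "exp (s\<^sup>2 * h / 2) * (?k * ?\<phi> x + d * (?\<phi> x * (x - s * h))) =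
      normal_density 0 (sqrt h) x * ((c + d * x) * exp (s * x))"
      by (simp only: distrib_left distrib_right mult_ac)
  qed
  ultimately have "has_bochner_integral lborel (\<lambda>x. normal_density 0 (sqrt h) x * ((c + d * x) * exp (s * x)))
     (exp (s\<^sup>2 * h / 2) * (?k * 1 + d * 0))"
    by (simp only:)
  then show ?i1 ?e1
    by (auto simp: has_bochner_integral_iff)
qed

text \<open>To first order the two factors cancel, leaving an error quadratic in \<open>x\<close>.
  This cancellation is what makes the mean of an exact Euler step negligible.\<close>

lemma exp_times_one_minus_bounds:
  fixes x :: real
  assumes "\<bar>x\<bar> \<le> 1"
  shows "exp x * (1 - x) \<le> 1" "1 - x\<^sup>2 \<le> exp x * (1 - x)"
proof -
  have "exp x * (1 - x) \<le> exp x * exp (- x)"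
    using exp_ge_add_one_self[of "- x"] by (intro mult_left_mono) auto
  then show "exp x * (1 - x) \<le> 1"
    by (simp add: exp_minus)
  have "(1 + x) * (1 - x) \<le> exp x * (1 - x)"
    using assms exp_ge_add_one_self[of x] by (intro mult_right_mono) auto
  then show "1 - x\<^sup>2 \<le> exp x * (1 - x)"
    by (simp add: power2_eq_square algebra_simps)
qed

text \<open>\<open>q\<close> is the one-step factor of the reciprocal of the explicit solution. The
  numerator of the first function is the relative error of an exact Euler step: its mean and second
  moment are both of order \<open>h\<^sup>2\<close>. Division by \<open>sqrt h\<close> brings the
  second moment to order \<open>h\<close>, so that all three functions satisfy the same bounds. The
  conditions on \<open>h\<close> keep the two rates of the exponential factors, times
  \<open>h\<close>, within \<open>[-1, 1]\<close>; \<open>C\<close> dominates the constants of the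
  three cases.\<close>

lemma gbm_step_moments:
  fixes \<mu> \<sigma> :: real
  defines "q \<equiv> \<lambda>h x. exp (- \<sigma> * x + (\<sigma>\<^sup>2 / 2 - \<mu>) * h)"
  defines "C \<equiv> 3 * (\<sigma>\<^sup>2 - \<mu>)\<^sup>2 + 3 * (\<mu> - 2 * \<sigma>\<^sup>2)\<^sup>2 + 3 * \<bar>\<sigma>\<bar> + 12 * \<sigma>\<^sup>2 + 3"
  assumes h: "0 < h" "h \<le> 1" "\<bar>\<sigma>\<^sup>2 - \<mu>\<bar> * h \<le> 1" "\<bar>3 * \<sigma>\<^sup>2 - 2 * \<mu>\<bar> * h \<le> 1"
    and \<psi>: "\<psi> \<in> {\<lambda>x. ((1 + \<mu> * h + \<sigma> * x) * q h x - 1) / sqrt h, \<lambda>x. x * q h x, \<lambda>x. h * q h x}"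
  shows "integrable lborel (\<lambda>x. normal_density 0 (sqrt h) x * \<psi> x)"
    and "integrable lborel (\<lambda>x. normal_density 0 (sqrt h) x * (\<psi> x)\<^sup>2)"
    and "\<bar>\<integral>x. normal_density 0 (sqrt h) x * \<psi> x \<partial>lborel\<bar> \<le> C * h"
    and "(\<integral>x. normal_density 0 (sqrt h) x * (\<psi> x)\<^sup>2 \<partial>lborel) \<le> C * h"
proof -
  let ?A = "\<sigma>\<^sup>2 - \<mu>" and ?B = "3 * \<sigma>\<^sup>2 - 2 * \<mu>" and ?\<phi> = "normal_density 0 (sqrt h)" and ?k = "\<mu> - 2 * \<sigma>\<^sup>2"
  have A1: "\<bar>?A * h\<bar> \<le> 1" and B1: "\<bar>?B * h\<bar> \<le> 1"
    using h by (auto simp: abs_mult)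
  have e3: "exp x \<le> 3" if "\<bar>x\<bar> \<le> 1" for x :: real
    using that exp_le by (meson abs_le_D1 exp_le_cancel_iff order_trans)
  have q1: "q h x = exp ((\<sigma>\<^sup>2 / 2 - \<mu>) * h) * exp (- \<sigma> * x)" for x
    by (simp add: q_def exp_add[symmetric] algebra_simps)
  have q2: "(q h x)\<^sup>2 = exp ((\<sigma>\<^sup>2 - 2 * \<mu>) * h) * exp (- 2 * \<sigma> * x)" for x
    by (simp add: q_def power2_eq_square exp_add[symmetric] algebra_simps)
  have lin: "integrable lborel (\<lambda>x. ?\<phi> x * ((c + d * x) * q h x))"
      "(\<integral>x. ?\<phi> x * ((c + d * x) * q h x) \<partial>lborel) = exp (?A * h) * (c - d * \<sigma> * h)" for c d
  proof -
    have eq: "(\<lambda>x. ?\<phi> x * ((c + d * x) * q h x)) = (\<lambda>x. exp ((\<sigma>\<^sup>2 / 2 - \<mu>) * h) * (?\<phi> x * ((c + d * x) * exp (- \<sigma> * x))))"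
      by (auto simp: q1)
    show "integrable lborel (\<lambda>x. ?\<phi> x * ((c + d * x) * q h x))"
      unfolding eq using normal_exp_moments(3)[OF h(1), of c d "- \<sigma>"] by simp
    have "exp ((\<sigma>\<^sup>2 / 2 - \<mu>) * h) * exp ((- \<sigma>)\<^sup>2 * h / 2) = exp (?A * h)"
      unfolding exp_add[symmetric] by (simp add: field_simps)
    then show "(\<integral>x. ?\<phi> x * ((c + d * x) * q h x) \<partial>lborel) = exp (?A * h) * (c - d * \<sigma> * h)"
      unfolding eq using normal_exp_moments(4)[OF h(1), of c d "- \<sigma>"] by simp
  qed
  have quad: "integrable lborel (\<lambda>x. ?\<phi> x * ((c + d * x) * q h x)\<^sup>2)"
      "(\<integral>x. ?\<phi> x * ((c + d * x) * q h x)\<^sup>2 \<partial>lborel) = exp (?B * h) * ((c - 2 * d * \<sigma> * h)\<^sup>2 + d\<^sup>2 * h)" for c d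
  proof -
    have eq: "(\<lambda>x. ?\<phi> x * ((c + d * x) * q h x)\<^sup>2) =
       (\<lambda>x. exp ((\<sigma>\<^sup>2 - 2 * \<mu>) * h) * (?\<phi> x * ((c + d * x)\<^sup>2 * exp (- 2 * \<sigma> * x))))"
      by (auto simp: power_mult_distrib q2)
    show "integrable lborel (\<lambda>x. ?\<phi> x * ((c + d * x) * q h x)\<^sup>2)"
      unfolding eq using normal_exp_moments(1)[OF h(1), of c d "- 2 * \<sigma>"] by simp
    have "exp ((\<sigma>\<^sup>2 - 2 * \<mu>) * h) * exp ((- 2 * \<sigma>)\<^sup>2 * h / 2) = exp (?B * h)"
      unfolding exp_add[symmetric] by (simp add: field_simps)
    moreover have "c + d * (- 2 * \<sigma>) * h = c - 2 * d * \<sigma> * h"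
      by simp
    ultimately show "(\<integral>x. ?\<phi> x * ((c + d * x) * q h x)\<^sup>2 \<partial>lborel) = exp (?B * h) * ((c - 2 * d * \<sigma> * h)\<^sup>2 + d\<^sup>2 * h)"
      unfolding eq integral_mult_right_zero normal_exp_moments(2)[OF h(1), of c d "- 2 * \<sigma>"]
      by (metis mult.assoc)
  qed
  have \<phi>: "integrable lborel ?\<phi>" "(\<integral>x. ?\<phi> x \<partial>lborel) = 1"
    using h by auto
  have hh: "h * h \<le> h" using h by (simp add: mult_le_cancel_left1)
  from \<psi> consider (1) "\<psi> = (\<lambda>x. ((1 + \<mu> * h + \<sigma> * x) * q h x - 1) / sqrt h)"
    | (2) "\<psi> = (\<lambda>x. x * q h x)" | (3) "\<psi> = (\<lambda>x. h * q h x)"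
    by auto
  then have "integrable lborel (\<lambda>x. ?\<phi> x * \<psi> x) \<and> integrable lborel (\<lambda>x. ?\<phi> x * (\<psi> x)\<^sup>2) \<and>
    \<bar>\<integral>x. ?\<phi> x * \<psi> x \<partial>lborel\<bar> \<le> C * h \<and> (\<integral>x. ?\<phi> x * (\<psi> x)\<^sup>2 \<partial>lborel) \<le> C * h"
  proof cases
    case 1
    let ?r = "\<lambda>x. (1 + \<mu> * h + \<sigma> * x) * q h x"
    note l = lin[of "1 + \<mu> * h" \<sigma>] and qd = quad[of "1 + \<mu> * h" \<sigma>]
    have l2: "(\<integral>x. ?\<phi> x * ?r x \<partial>lborel) = exp (?A * h) * (1 - ?A * h)"
      using l(2) by (simp add: power2_eq_square algebra_simps)
    \<comment> \<open>With \<open>?k = \<mu> - 2 * \<sigma>\<^sup>2\<close> the linear coefficient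
      is exactly \<open>- ?B\<close>, the negative of the rate in the exponential factor, so the
      cancellation bound applies to the second moment as well.\<close>
    have sq: "(1 + \<mu> * h - 2 * \<sigma> * \<sigma> * h)\<^sup>2 + \<sigma>\<^sup>2 * h = (1 - ?B * h) + ?k\<^sup>2 * h\<^sup>2"
      by (simp add: power2_eq_square algebra_simps)
    have q2: "(\<integral>x. ?\<phi> x * (?r x)\<^sup>2 \<partial>lborel) = exp (?B * h) * (1 - ?B * h) + exp (?B * h) * (?k\<^sup>2 * h\<^sup>2)"
      using qd(2) unfolding sq by (simp add: algebra_simps)
    have e1: "(\<lambda>x. ?\<phi> x * \<psi> x) = (\<lambda>x. (?\<phi> x * ?r x - ?\<phi> x) / sqrt h)"
      unfolding 1 by (auto simp: right_diff_distrib diff_divide_distrib)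
    have i1: "integrable lborel (\<lambda>x. ?\<phi> x * \<psi> x)"
      unfolding e1 using l(1) \<phi> by auto
    have "(\<integral>x. ?\<phi> x * \<psi> x \<partial>lborel) = (exp (?A * h) * (1 - ?A * h) - 1) / sqrt h"
      unfolding e1 using l(1) l2 \<phi> by simp
    moreover have "\<bar>exp (?A * h) * (1 - ?A * h) - 1\<bar> \<le> (?A * h)\<^sup>2"
      using exp_times_one_minus_bounds[OF A1] by (simp add: abs_le_iff)
    ultimately have "\<bar>\<integral>x. ?\<phi> x * \<psi> x \<partial>lborel\<bar> \<le> (?A * h)\<^sup>2 / sqrt h"
      using h by (simp add: abs_divide divide_right_mono)
    also have "\<dots> = ?A\<^sup>2 * h * (h / sqrt h)"
      by (simp add: power2_eq_square)
    also have "h / sqrt h = sqrt h"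
      using h by (simp add: real_div_sqrt)
    also have "?A\<^sup>2 * h * sqrt h \<le> ?A\<^sup>2 * h * 1"
      using h by (intro mult_left_mono) auto
    also have "\<dots> \<le> C * h"
      unfolding C_def using h by (simp add: mult_right_mono)
    finally have b1: "\<bar>\<integral>x. ?\<phi> x * \<psi> x \<partial>lborel\<bar> \<le> C * h" .
    have e2: "(\<lambda>x. ?\<phi> x * (\<psi> x)\<^sup>2) = (\<lambda>x. (?\<phi> x * (?r x)\<^sup>2 - 2 * (?\<phi> x * ?r x) + ?\<phi> x) / h)"
      unfolding 1 using h by (auto simp: power_divide power2_eq_square field_simps)
    have i2: "integrable lborel (\<lambda>x. ?\<phi> x * (\<psi> x)\<^sup>2)"
      unfolding e2 using l(1) qd(1) \<phi> by auto
    have "(\<integral>x. ?\<phi> x * (\<psi> x)\<^sup>2 \<partial>lborel) =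
       (exp (?B * h) * (1 - ?B * h) + exp (?B * h) * (?k\<^sup>2 * h\<^sup>2) - 2 * (exp (?A * h) * (1 - ?A * h)) + 1) / h"
      unfolding e2 using l(1) qd(1) \<phi> l2 q2 by simp
    \<comment> \<open>The constants cancel as \<open>1 - 2 + 1\<close> and the linear terms are
      already gone, which leaves order \<open>h\<^sup>2\<close> before the division by
      \<open>h\<close>.\<close>
    also have "\<dots> \<le> (1 + 3 * (?k\<^sup>2 * h\<^sup>2) - 2 * (1 - (?A * h)\<^sup>2) + 1) / h"
      using exp_times_one_minus_bounds[OF A1] exp_times_one_minus_bounds[OF B1] e3[OF B1] h
      by (intro divide_right_mono add_mono diff_mono mult_right_mono) auto
    also have "\<dots> = (3 * ?k\<^sup>2 + 2 * ?A\<^sup>2) * h"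
      using h by (simp add: power2_eq_square field_simps)
    also have "\<dots> \<le> C * h"
      unfolding C_def using h by (intro mult_right_mono) auto
    finally show ?thesis using i1 b1 i2 by blast
  next
    case 2
    note l = lin[of 0 1] and qd = quad[of 0 1]
    have "\<bar>\<integral>x. ?\<phi> x * \<psi> x \<partial>lborel\<bar> = exp (?A * h) * (\<bar>\<sigma>\<bar> * h)"
      unfolding 2 using l(2) h by (simp add: abs_mult)
    also have "\<dots> \<le> 3 * (\<bar>\<sigma>\<bar> * h)"
      using e3[OF A1] h by (intro mult_right_mono) auto
    also have "\<dots> \<le> C * h"
      unfolding C_def mult.assoc[symmetric] using h by (intro mult_right_mono) auto
    finally have b1: "\<bar>\<integral>x. ?\<phi> x * \<psi> x \<partial>lborel\<bar> \<le> C * h" .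
    have "(\<integral>x. ?\<phi> x * (\<psi> x)\<^sup>2 \<partial>lborel) = exp (?B * h) * (4 * \<sigma>\<^sup>2 * (h * h) + h)"
      unfolding 2 using qd(2) by (simp add: power2_eq_square mult_ac)
    also have "\<dots> \<le> 3 * (4 * \<sigma>\<^sup>2 * h + h)"
      using e3[OF B1] h hh by (intro mult_mono add_mono mult_left_mono) auto
    also have "\<dots> = (12 * \<sigma>\<^sup>2 + 3) * h"
      by (simp add: algebra_simps)
    also have "\<dots> \<le> C * h"
      unfolding C_def using h by (intro mult_right_mono) auto
    finally show ?thesis using l(1) qd(1) b1 unfolding 2 by simp
  next
    case 3
    note l = lin[of h 0] and qd = quad[of h 0]
    have "\<bar>\<integral>x. ?\<phi> x * \<psi> x \<partial>lborel\<bar> = exp (?A * h) * h"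
      unfolding 3 using l(2) h by (simp add: abs_mult)
    also have "\<dots> \<le> 3 * h"
      using e3[OF A1] h by (intro mult_right_mono) auto
    also have "\<dots> \<le> C * h"
      unfolding C_def using h by (intro mult_right_mono) auto
    finally have b1: "\<bar>\<integral>x. ?\<phi> x * \<psi> x \<partial>lborel\<bar> \<le> C * h" .
    have "(\<integral>x. ?\<phi> x * (\<psi> x)\<^sup>2 \<partial>lborel) = exp (?B * h) * (h * h)"
      unfolding 3 using qd(2) by (simp add: power2_eq_square mult_ac)
    also have "\<dots> \<le> 3 * h"
      using e3[OF B1] h hh by (intro mult_mono) auto
    also have "\<dots> \<le> C * h"
      unfolding C_def using h by (intro mult_right_mono) auto
    finally show ?thesis using l(1) qd(1) b1 unfolding 3 by simp
  qed
  then show "integrable lborel (\<lambda>x. ?\<phi> x * \<psi> x)" "integrable lborel (\<lambda>x. ?\<phi> x * (\<psi> x)\<^sup>2)"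
    "\<bar>\<integral>x. ?\<phi> x * \<psi> x \<partial>lborel\<bar> \<le> C * h" "(\<integral>x. ?\<phi> x * (\<psi> x)\<^sup>2 \<partial>lborel) \<le> C * h"
    by auto
qed

section \<open>Reduction to countably many times and finite grids\<close>

lemma le_on_rationals_imp_le:
  fixes f :: "real \<Rightarrow> real"
  assumes "0 < T" and f: "continuous_on {0..T} f" and U: "open U"
    and le: "\<And>q. q \<in> \<rat> \<Longrightarrow> q \<in> {0..T} \<Longrightarrow> q \<in> U \<Longrightarrow> f q \<le> c"
    and t: "t \<in> {0..T}" "t \<in> U"
  shows "f t \<le> c"
proof (rule ccontr)
  assume "\<not> f t \<le> c"
  then obtain d where d: "0 < d" "\<And>s. s \<in> {0..T} \<Longrightarrow> dist s t < d \<Longrightarrow> dist (f s) (f t) < f t - c"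
    using f t unfolding continuous_on_iff by (metis diff_gt_0_iff_gt not_le)
  obtain d' where d': "0 < d'" "\<And>s. dist s t < d' \<Longrightarrow> s \<in> U"
    using U t by (auto simp: open_dist)
  have "max 0 (t - min d d') < min T (t + min d d')"
    using \<open>0 < T\<close> t d d' by auto
  then obtain q where q: "q \<in> \<rat>" "max 0 (t - min d d') < q" "q < min T (t + min d d')"
    using Rats_dense_in_real by blast
  then have "dist q t < d" "dist q t < d'" "q \<in> {0..T}"
    by (auto simp: dist_real_def)
  with d d' le[OF q(1)] show False
    by (force simp: dist_real_def)
qed

text \<open>On a grid that contains the breakpoints of a simple process, the process is constant on
  each cell; merging them with a uniform mesh also makes the cells short. Sorting a finite set
  removes repetitions, so the times increase strictly.\<close>

lemma exists_fine_grid: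
  fixes P :: "real set"
  assumes "finite P" "0 < T" "0 < r"
  obtains n :: nat and t :: "nat \<Rightarrow> real" where "t 0 = 0" "t n = T"
    "\<And>i. i < n \<Longrightarrow> t i < t (Suc i)" "\<And>i. i < n \<Longrightarrow> t (Suc i) - t i \<le> r"
    "\<And>i p. i < n \<Longrightarrow> p \<in> P \<Longrightarrow> p \<le> t i \<or> t (Suc i) \<le> p"
proof -
  obtain m :: nat where m: "T / r < real m"
    using reals_Archimedean2 by blast
  then have m0: "0 < real m"
    using assms by (metis divide_pos_pos less_trans)
  define Q where "Q = (P \<inter> {0..T}) \<union> (\<lambda>k. real k * T / real m) ` {..m}"
  have Q: "finite Q" "Q \<subseteq> {0..T}" "0 \<in> Q" "T \<in> Q"
    using assms m0 by (auto simp: Q_def field_simps image_iff intro!: bexI[of _ 0] bexI[of _ m])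
  define l where "l = sorted_list_of_set Q"
  have l: "set l = Q" "sorted_wrt (<) l"
    using Q by (auto simp: l_def)
  have ne: "l \<noteq> []" using l Q by auto
  define n where "n = length l - 1"
  define t where "t i = l ! i" for i
  have len: "length l = Suc n"
    using ne by (simp add: n_def)
  have inc: "t i < t j" if "i < j" "j \<le> n" for i j
    using sorted_wrt_nth_less[OF l(2), of i j] that len by (simp add: t_def)
  have inc': "t i \<le> t j" if "i \<le> j" "j \<le> n" for i j
    using inc[of i j] that by (cases "i = j") auto
  have tQ: "t i \<in> Q" if "i \<le> n" for i
    using that l len by (auto simp: t_def)
  have Qt: "\<exists>i\<le>n. x = t i" if "x \<in> Q" for x
    using that l len by (metis in_set_conv_nth less_Suc_eq_le t_def)
  have gap: "x \<le> t i \<or> t (Suc i) \<le> x" if "x \<in> Q" "i < n" for x i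
  proof -
    obtain j where j: "j \<le> n" "x = t j" using Qt[OF \<open>x \<in> Q\<close>] by blast
    then show ?thesis
      using inc'[of j i] inc'[of "Suc i" j] that by (cases "j \<le> i") auto
  qed
  show thesis
  proof
    obtain i where "i \<le> n" "0 = t i" using Qt Q by blast
    moreover have "0 \<le> t 0" using tQ[of 0] Q by auto
    ultimately show "t 0 = 0" using inc'[of 0 i] by simp
    obtain i where "i \<le> n" "T = t i" using Qt Q by blast
    moreover have "t n \<le> T" using tQ[of n] Q by auto
    ultimately show "t n = T" using inc'[of i n] by simp
    fix i assume i: "i < n"
    show "t i < t (Suc i)" using inc i by simp
    show "p \<le> t i \<or> t (Suc i) \<le> p" if "p \<in> P" for p
    proof (cases "p \<in> Q")
      case True then show ?thesis using gap i by blast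
    next
      case False
      then have "p < 0 \<or> T < p" using that by (auto simp: Q_def)
      then show ?thesis using tQ[of i] tQ[of "Suc i"] i Q by force
    qed
    show "t (Suc i) - t i \<le> r"
    proof (rule ccontr)
      assume c: "\<not> ?thesis"
      have r: "T / real m < r"
        using m m0 assms by (simp add: field_simps)
      \<comment> \<open>The first mesh point strictly to the right of \<open>t i\<close>. In a cell
        longer than \<open>r\<close>, hence longer than \<open>T / m\<close>, it would lie strictly
        inside.\<close>
      define k where "k = nat (floor (t i * real m / T)) + 1"
      have ti: "0 \<le> t i" "t i \<le> T" "0 \<le> t (Suc i)" "t (Suc i) \<le> T"
        using tQ[of i] tQ[of "Suc i"] i Q by auto
      have k0: "real k = of_int (floor (t i * real m / T)) + 1"
        using ti m0 assms by (simp add: k_def)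
      have k1: "t i * real m / T < real k" "real k \<le> t i * real m / T + 1"
        unfolding k0 by linarith+
      have k2: "t i < real k * T / real m"
        using k1(1) m0 assms by (simp add: field_simps)
      have "real k * T / real m \<le> (t i * real m / T + 1) * T / real m"
        using k1(2) m0 assms by (intro divide_right_mono mult_right_mono) auto
      also have "\<dots> = t i + T / real m"
        using m0 assms by (simp add: field_simps)
      finally have k3: "real k * T / real m < t (Suc i)"
        using c r by simp
      then have "real k * T / real m < T"
        using ti by simp
      then have "k \<le> m"
        using m0 assms by (simp add: field_simps)
      then have "real k * T / real m \<in> Q"
        by (auto simp: Q_def)
      then show False
        using gap[OF _ i] k2 k3 by fastforce
    qed
  qed
qed

text \<open>A discrete product rule in which \<open>U\<close> moves multiplicatively and
  \<open>V\<close> additively. Factoring out the current value \<open>U i\<close> leaves a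
  coefficient that is known at the left end of the cell.\<close>

lemma sum_diff_telescope_product:
  fixes U q V :: "nat \<Rightarrow> real"
  assumes "\<And>i. i < n \<Longrightarrow> U (Suc i) = U i * q i" "\<And>i. i < n \<Longrightarrow> V (Suc i) = V i + a i"
  shows "V n * U n - V 0 * U 0 = (\<Sum>i<n. U i * (a i * q i + V i * (q i - 1)))"
  using assms
proof (induction n)
  case (Suc n)
  have "V n * U n - V 0 * U 0 = (\<Sum>i<n. U i * (a i * q i + V i * (q i - 1)))"
    using Suc by simp
  moreover have "V (Suc n) * U (Suc n) = V n * U n + U n * (a n * q n + V n * (q n - 1))"
    using Suc.prems by (simp add: algebra_simps)
  ultimately show ?case by simp
qed simp

section \<open>The Euler scheme against the reciprocal solution\<close>

context brownian_motion
begin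

text \<open>
  \<open>V\<close> is an Euler scheme and \<open>U\<close> the reciprocal of the explicit solution. The product \<open>V U\<close> moves in one
  step by a sum of three terms, each a past-measurable coefficient times a function of the increment.
\<close>

lemma euler_scheme_bound:
  fixes \<mu> \<sigma> :: real and t :: "nat \<Rightarrow> real" and g x :: "nat \<Rightarrow> 'a \<Rightarrow> real"
  defines "U \<equiv> \<lambda>i \<omega>. exp (- \<sigma> * W (t i) \<omega> + (\<sigma>\<^sup>2 / 2 - \<mu>) * t i)"
  defines "V \<equiv> \<lambda>k \<omega>. x 0 \<omega> + (\<Sum>j<k. \<mu> * x j \<omega> * (t (Suc j) - t j) + g j \<omega> * (W (t (Suc j)) \<omega> - W (t j) \<omega>))"
  defines "C \<equiv> 3 * (\<sigma>\<^sup>2 - \<mu>)\<^sup>2 + 3 * (\<mu> - 2 * \<sigma>\<^sup>2)\<^sup>2 + 3 * \<bar>\<sigma>\<bar> + 12 * \<sigma>\<^sup>2 + 3"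
  assumes t0: "t 0 = 0" and t: "\<And>i. i < n \<Longrightarrow> t i < t (Suc i)"
    and r: "\<And>i. i < n \<Longrightarrow> t (Suc i) - t i \<le> r" "r \<le> 1" "\<bar>\<sigma>\<^sup>2 - \<mu>\<bar> * r \<le> 1" "\<bar>3 * \<sigma>\<^sup>2 - 2 * \<mu>\<bar> * r \<le> 1"
    and x: "\<And>i. i \<le> n \<Longrightarrow> x i \<in> borel_measurable (F (t i))"
    and g: "\<And>i. i < n \<Longrightarrow> g i \<in> borel_measurable (F (t i))"
    and \<delta>: "0 < \<delta>" "0 < \<epsilon>"
    and G: "G \<in> events"
    and G1: "\<And>\<omega>. \<omega> \<in> G \<Longrightarrow> (\<Sum>i<n. (U i \<omega> * V i \<omega>)\<^sup>2 * (t (Suc i) - t i)\<^sup>2) \<le> \<delta>"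
    and G2: "\<And>\<omega>. \<omega> \<in> G \<Longrightarrow> (\<Sum>i<n. (U i \<omega> * (g i \<omega> - \<sigma> * V i \<omega>))\<^sup>2 * (t (Suc i) - t i)) \<le> \<delta>"
    and G3: "\<And>\<omega>. \<omega> \<in> G \<Longrightarrow> (\<Sum>i<n. (\<mu> * U i \<omega> * (x i \<omega> - V i \<omega>))\<^sup>2 * (t (Suc i) - t i)) \<le> \<delta>"
  shows "prob {\<omega>\<in>space M. 3 * \<epsilon> \<le> \<bar>V n \<omega> * U n \<omega> - x 0 \<omega> * U 0 \<omega>\<bar>} \<le>
    3 * (prob (space M - G) + (2 * C + 2 * C\<^sup>2 * t n) * \<delta> / \<epsilon>\<^sup>2)"
    and "{\<omega>\<in>space M. 3 * \<epsilon> \<le> \<bar>V n \<omega> * U n \<omega> - x 0 \<omega> * U 0 \<omega>\<bar>} \<in> events"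
proof -
  define h where "h i = t (Suc i) - t i" for i
  define D where "D i \<omega> = W (t (Suc i)) \<omega> - W (t i) \<omega>" for i \<omega>
  define q where "q i y = exp (- \<sigma> * y + (\<sigma>\<^sup>2 / 2 - \<mu>) * h i)" for i y
  define \<psi>1 where "\<psi>1 i = (\<lambda>y. ((1 + \<mu> * h i + \<sigma> * y) * q i y - 1) / sqrt (h i))" for i
  define \<psi>2 where "\<psi>2 i = (\<lambda>y. y * q i y)" for i
  define \<psi>3 where "\<psi>3 i = (\<lambda>y. h i * q i y)" for i
  \<comment> \<open>The factor \<open>sqrt (h i)\<close> undoes the division in
    \<open>\<psi>1\<close>. As a result the quadratic sum of \<open>\<theta>1\<close> carries
    \<open>h i\<close> squared and is small by the mesh alone, whereas those of
    \<open>\<theta>2\<close> and \<open>\<theta>3\<close> are small when \<open>g\<close> is close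
    to \<open>\<sigma> * V\<close> and \<open>x\<close> is close to \<open>V\<close>.\<close>
  define \<theta>1 where "\<theta>1 i \<omega> = U i \<omega> * V i \<omega> * sqrt (h i)" for i \<omega>
  define \<theta>2 where "\<theta>2 i \<omega> = U i \<omega> * (g i \<omega> - \<sigma> * V i \<omega>)" for i \<omega>
  define \<theta>3 where "\<theta>3 i \<omega> = \<mu> * U i \<omega> * (x i \<omega> - V i \<omega>)" for i \<omega>
  have h: "0 < h i" if "i < n" for i
    using t[OF that] by (simp add: h_def)
  have tmono: "t i \<le> t k" if "i \<le> k" "k \<le> n" for i k
    using grid_mono[of n t i k] t that by blast
  have tpos: "0 \<le> t k" if "k \<le> n" for k
    using tmono[of 0 k] that t0 by simp
  have WF: "W (t j) \<in> borel_measurable (F (t i))" if "j \<le> i" "i \<le> n" for i j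
    using that tpos tmono by (intro adapted_mono) auto
  have xF: "x j \<in> borel_measurable (F (t i))" if "j \<le> i" "i \<le> n" for i j
    using that measurable_F_mono[OF x[of j] tmono[of j i]] by auto
  have gF: "g j \<in> borel_measurable (F (t i))" if "j \<le> i" "i \<le> n" "j < n" for i j
    using that measurable_F_mono[OF g[of j] tmono[of j i]] by auto
  have UF: "U i \<in> borel_measurable (F (t i))" if "i \<le> n" for i
    unfolding U_def using WF[of i i] that by measurable
  have VF: "V i \<in> borel_measurable (F (t i))" if "i \<le> n" for i
    unfolding V_def using xF gF WF that by (intro borel_measurable_add borel_measurable_sum borel_measurable_times borel_measurable_diff) auto
  have step: "V n \<omega> * U n \<omega> - x 0 \<omega> * U 0 \<omega> =
     (\<Sum>i<n. \<theta>1 i \<omega> * \<psi>1 i (D i \<omega>)) + (\<Sum>i<n. \<theta>2 i \<omega> * \<psi>2 i (D i \<omega>)) + (\<Sum>i<n. \<theta>3 i \<omega> * \<psi>3 i (D i \<omega>))" for \<omega>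
  proof -
    have "V n \<omega> * U n \<omega> - V 0 \<omega> * U 0 \<omega> =
      (\<Sum>i<n. U i \<omega> * ((\<mu> * x i \<omega> * h i + g i \<omega> * D i \<omega>) * q i (D i \<omega>) + V i \<omega> * (q i (D i \<omega>) - 1)))"
    proof (rule sum_diff_telescope_product)
      fix i
      show "U (Suc i) \<omega> = U i \<omega> * q i (D i \<omega>)"
        unfolding U_def q_def D_def h_def exp_add[symmetric] by (simp add: field_simps)
      show "V (Suc i) \<omega> = V i \<omega> + (\<mu> * x i \<omega> * h i + g i \<omega> * D i \<omega>)"
        by (simp add: V_def h_def D_def)
    qed
    \<comment> \<open>Insert \<open>\<sigma> * V i\<close> for \<open>g i\<close> and
      \<open>V i\<close> for \<open>x i\<close>: the exact Euler step of \<open>V\<close> gives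
      \<open>\<psi>1\<close>, and the errors of the diffusion and drift coefficients give
      \<open>\<psi>2\<close> and \<open>\<psi>3\<close>.\<close>
    also have "\<dots> = (\<Sum>i<n. \<theta>1 i \<omega> * \<psi>1 i (D i \<omega>) + \<theta>2 i \<omega> * \<psi>2 i (D i \<omega>) + \<theta>3 i \<omega> * \<psi>3 i (D i \<omega>))"
    proof (rule sum.cong[OF refl])
      fix i assume "i \<in> {..<n}"
      then have "sqrt (h i) \<noteq> 0" using h[of i] by simp
      then have "\<theta>1 i \<omega> * \<psi>1 i (D i \<omega>) = U i \<omega> * V i \<omega> * ((1 + \<mu> * h i + \<sigma> * D i \<omega>) * q i (D i \<omega>) - 1)"
        by (simp add: \<theta>1_def \<psi>1_def)
      then show "U i \<omega> * ((\<mu> * x i \<omega> * h i + g i \<omega> * D i \<omega>) * q i (D i \<omega>) + V i \<omega> * (q i (D i \<omega>) - 1)) =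
          \<theta>1 i \<omega> * \<psi>1 i (D i \<omega>) + \<theta>2 i \<omega> * \<psi>2 i (D i \<omega>) + \<theta>3 i \<omega> * \<psi>3 i (D i \<omega>)"
        unfolding \<theta>2_def \<psi>2_def \<theta>3_def \<psi>3_def by (simp add: algebra_simps)
    qed
    finally show ?thesis
      by (simp add: sum.distrib V_def)
  qed
  have bound: "prob {\<omega>\<in>space M. \<epsilon> \<le> \<bar>\<Sum>i<n. \<theta> i \<omega> * \<psi> i (D i \<omega>)\<bar>} \<le>
      prob (space M - G) + (2 * C + 2 * C\<^sup>2 * t n) * \<delta> / \<epsilon>\<^sup>2"
    if \<theta>: "\<And>i. i < n \<Longrightarrow> \<theta> i \<in> borel_measurable (F (t i))"
      and \<psi>: "\<And>i. i < n \<Longrightarrow> \<psi> i \<in> {\<psi>1 i, \<psi>2 i, \<psi>3 i}"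
      and \<theta>G: "\<And>\<omega>. \<omega> \<in> G \<Longrightarrow> (\<Sum>i<n. (\<theta> i \<omega>)\<^sup>2 * h i) \<le> \<delta>" for \<theta> \<psi>
  proof -
    have hr: "h i \<le> 1" "\<bar>\<sigma>\<^sup>2 - \<mu>\<bar> * h i \<le> 1" "\<bar>3 * \<sigma>\<^sup>2 - 2 * \<mu>\<bar> * h i \<le> 1" if "i < n" for i
      using r(1)[OF that] r(2-4) mult_left_mono[OF r(1)[OF that], of "\<bar>\<sigma>\<^sup>2 - \<mu>\<bar>"]
        mult_left_mono[OF r(1)[OF that], of "\<bar>3 * \<sigma>\<^sup>2 - 2 * \<mu>\<bar>"] by (auto simp: h_def)
    have \<psi>': "\<psi> i \<in> {\<lambda>y. ((1 + \<mu> * h i + \<sigma> * y) * exp (- \<sigma> * y + (\<sigma>\<^sup>2 / 2 - \<mu>) * h i) - 1) / sqrt (h i),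
        \<lambda>y. y * exp (- \<sigma> * y + (\<sigma>\<^sup>2 / 2 - \<mu>) * h i), \<lambda>y. h i * exp (- \<sigma> * y + (\<sigma>\<^sup>2 / 2 - \<mu>) * h i)}" if "i < n" for i
      using \<psi>[OF that] by (simp add: \<psi>1_def \<psi>2_def \<psi>3_def q_def)
    note m = gbm_step_moments[OF h hr \<psi>', folded C_def]
    have \<psi>m: "\<psi> i \<in> borel_measurable borel" if "i < n" for i
      using \<psi>'[OF that] by auto
    have "prob {\<omega>\<in>space M. \<epsilon> \<le> \<bar>\<Sum>i<n. \<theta> i \<omega> * \<psi> i (W (t (Suc i)) \<omega> - W (t i) \<omega>)\<bar>} \<le>
      prob {\<omega>\<in>space M. \<delta> < (\<Sum>i<n. (\<theta> i \<omega>)\<^sup>2 * (t (Suc i) - t i))} + (2 * C + 2 * C\<^sup>2 * (t n - t 0)) * \<delta> / \<epsilon>\<^sup>2"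
      using m t0 t \<theta> \<psi>m \<delta> by (intro discrete_stochastic_sum_bound) (auto simp: h_def C_def)
    moreover have "prob {\<omega>\<in>space M. \<delta> < (\<Sum>i<n. (\<theta> i \<omega>)\<^sup>2 * h i)} \<le> prob (space M - G)"
      using \<theta>G G by (intro finite_measure_mono) (auto simp: not_le[symmetric])
    ultimately show ?thesis
      using t0 by (simp add: D_def h_def)
  qed
  have b1: "prob {\<omega>\<in>space M. \<epsilon> \<le> \<bar>\<Sum>i<n. \<theta>1 i \<omega> * \<psi>1 i (D i \<omega>)\<bar>} \<le> prob (space M - G) + (2 * C + 2 * C\<^sup>2 * t n) * \<delta> / \<epsilon>\<^sup>2"
  proof (rule bound)
    show "(\<Sum>i<n. (\<theta>1 i \<omega>)\<^sup>2 * h i) \<le> \<delta>" if "\<omega> \<in> G" for \<omega>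
    proof -
      have "(\<Sum>i<n. (\<theta>1 i \<omega>)\<^sup>2 * h i) = (\<Sum>i<n. (U i \<omega> * V i \<omega>)\<^sup>2 * (t (Suc i) - t i)\<^sup>2)"
      proof (rule sum.cong[OF refl])
        fix i assume "i \<in> {..<n}"
        then have "(sqrt (h i))\<^sup>2 = h i" using h[of i] by simp
        then show "(\<theta>1 i \<omega>)\<^sup>2 * h i = (U i \<omega> * V i \<omega>)\<^sup>2 * (t (Suc i) - t i)\<^sup>2"
          by (simp add: \<theta>1_def power_mult_distrib) (simp add: h_def power2_eq_square)
      qed
      then show ?thesis using G1[OF that] by simp
    qed
  qed (use UF VF in \<open>auto simp: \<theta>1_def[abs_def]\<close>)
  have b2: "prob {\<omega>\<in>space M. \<epsilon> \<le> \<bar>\<Sum>i<n. \<theta>2 i \<omega> * \<psi>2 i (D i \<omega>)\<bar>} \<le> prob (space M - G) + (2 * C + 2 * C\<^sup>2 * t n) * \<delta> / \<epsilon>\<^sup>2"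
    by (rule bound) (use UF VF g G2 in \<open>auto simp: \<theta>2_def[abs_def] h_def\<close>)
  have b3: "prob {\<omega>\<in>space M. \<epsilon> \<le> \<bar>\<Sum>i<n. \<theta>3 i \<omega> * \<psi>3 i (D i \<omega>)\<bar>} \<le> prob (space M - G) + (2 * C + 2 * C\<^sup>2 * t n) * \<delta> / \<epsilon>\<^sup>2"
    by (rule bound) (use UF VF x G3 in \<open>auto simp: \<theta>3_def[abs_def] h_def\<close>)
  have DM: "D i \<in> borel_measurable M" if "i < n" for i
    unfolding D_def using tpos[of i] tmono[of i "Suc i"] that by (intro increment_measurable) auto
  have UM: "U i \<in> borel_measurable M" "V i \<in> borel_measurable M" "x i \<in> borel_measurable M" if "i \<le> n" for i
    using measurable_F_M[OF UF[OF that]] measurable_F_M[OF VF[OF that]] measurable_F_M[OF x[OF that]] .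
  have gM: "g i \<in> borel_measurable M" if "i < n" for i
    using measurable_F_M[OF g[OF that]] .
  have qM [measurable]: "q i \<in> borel_measurable borel" for i
    unfolding q_def by measurable
  have [measurable]: "\<psi>1 i \<in> borel_measurable borel" "\<psi>2 i \<in> borel_measurable borel" "\<psi>3 i \<in> borel_measurable borel" for i
    unfolding \<psi>1_def \<psi>2_def \<psi>3_def by measurable
  have m1: "(\<lambda>\<omega>. \<Sum>i<n. \<theta>1 i \<omega> * \<psi>1 i (D i \<omega>)) \<in> borel_measurable M"
    unfolding \<theta>1_def using UM DM
    by (intro borel_measurable_sum borel_measurable_times borel_measurable_const measurable_compose[OF DM]) auto
  have m2: "(\<lambda>\<omega>. \<Sum>i<n. \<theta>2 i \<omega> * \<psi>2 i (D i \<omega>)) \<in> borel_measurable M"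
    unfolding \<theta>2_def using UM gM
    by (intro borel_measurable_sum borel_measurable_times borel_measurable_diff borel_measurable_const measurable_compose[OF DM]) auto
  have m3: "(\<lambda>\<omega>. \<Sum>i<n. \<theta>3 i \<omega> * \<psi>3 i (D i \<omega>)) \<in> borel_measurable M"
    unfolding \<theta>3_def using UM
    by (intro borel_measurable_sum borel_measurable_times borel_measurable_diff borel_measurable_const measurable_compose[OF DM]) auto
  have three: "3 * y = y + y + y" for y :: real
    by simp
  let ?A = "\<lambda>Z. {\<omega>\<in>space M. \<epsilon> \<le> \<bar>Z \<omega>\<bar>}"
  let ?Z1 = "\<lambda>\<omega>. \<Sum>i<n. \<theta>1 i \<omega> * \<psi>1 i (D i \<omega>)" and ?Z2 = "\<lambda>\<omega>. \<Sum>i<n. \<theta>2 i \<omega> * \<psi>2 i (D i \<omega>)"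
    and ?Z3 = "\<lambda>\<omega>. \<Sum>i<n. \<theta>3 i \<omega> * \<psi>3 i (D i \<omega>)"
  have ev: "?A ?Z1 \<in> events" "?A ?Z2 \<in> events" "?A ?Z3 \<in> events"
    using m1 m2 m3 by measurable
  have "prob {\<omega>\<in>space M. 3 * \<epsilon> \<le> \<bar>V n \<omega> * U n \<omega> - x 0 \<omega> * U 0 \<omega>\<bar>} \<le> prob ((?A ?Z1 \<union> ?A ?Z2) \<union> ?A ?Z3)"
    unfolding step using ev by (intro finite_measure_mono) auto
  also have "\<dots> \<le> prob (?A ?Z1) + prob (?A ?Z2) + prob (?A ?Z3)"
    using ev measure_Un_le[of "?A ?Z1" M "?A ?Z2"] measure_Un_le[of "?A ?Z1 \<union> ?A ?Z2" M "?A ?Z3"] by auto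
  finally show "prob {\<omega>\<in>space M. 3 * \<epsilon> \<le> \<bar>V n \<omega> * U n \<omega> - x 0 \<omega> * U 0 \<omega>\<bar>} \<le>
    3 * (prob (space M - G) + (2 * C + 2 * C\<^sup>2 * t n) * \<delta> / \<epsilon>\<^sup>2)"
    using add_mono[OF add_mono[OF b1 b2] b3] unfolding three by (rule order_trans)
  have "(\<lambda>\<omega>. V n \<omega> * U n \<omega> - x 0 \<omega> * U 0 \<omega>) \<in> borel_measurable M"
    using UM[of n] UM[of 0] by simp
  then show "{\<omega>\<in>space M. 3 * \<epsilon> \<le> \<bar>V n \<omega> * U n \<omega> - x 0 \<omega> * U 0 \<omega>\<bar>} \<in> events"
    by measurable
qed

text \<open>Simple processes are constant on intervals open on the left, so on a refining grid the
  value on a cell is read off at its right end. It is nevertheless known at the left end, because a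
  breakpoint below \<open>t (Suc i)\<close> is already at most \<open>t i\<close>.\<close>

lemma simple_integral_refining_grid:
  assumes sp: "simple_process F m p \<xi>"
    and t: "\<And>i. i < n \<Longrightarrow> t i < t (Suc i)" and t0: "t 0 = 0"
    and gap: "\<And>i l. i < n \<Longrightarrow> l \<le> m \<Longrightarrow> p l \<le> t i \<or> t (Suc i) \<le> p l"
    and i: "i < n"
  shows "simple_integral W m p \<xi> (t (Suc i)) \<omega> - simple_integral W m p \<xi> (t i) \<omega> =
      simple_value m p \<xi> (t (Suc i)) \<omega> * (W (t (Suc i)) \<omega> - W (t i) \<omega>)"
    and "s \<in> {t i<..t (Suc i)} \<Longrightarrow> simple_value m p \<xi> s \<omega> = simple_value m p \<xi> (t (Suc i)) \<omega>"
    and "simple_value m p \<xi> (t (Suc i)) \<in> borel_measurable (F (t i))"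
proof -
  have pm: "p l \<le> p (Suc l)" if "l < m" for l
    using sp that by (simp add: simple_process_def)
  have cell: "\<xi> l \<omega> * (W (min (t (Suc i)) (p (Suc l))) \<omega> - W (min (t (Suc i)) (p l)) \<omega>) -
      \<xi> l \<omega> * (W (min (t i) (p (Suc l))) \<omega> - W (min (t i) (p l)) \<omega>) =
      \<xi> l \<omega> * indicator {p l<..p (Suc l)} (t (Suc i)) * (W (t (Suc i)) \<omega> - W (t i) \<omega>)" if "l < m" for l
    using gap[OF i, of l] gap[OF i, of "Suc l"] that pm[OF that] t[OF i]
    by (cases "p l = p (Suc l)") (auto simp: min_def indicator_def algebra_simps)
  show "simple_integral W m p \<xi> (t (Suc i)) \<omega> - simple_integral W m p \<xi> (t i) \<omega> =
      simple_value m p \<xi> (t (Suc i)) \<omega> * (W (t (Suc i)) \<omega> - W (t i) \<omega>)"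
    unfolding simple_integral_def simple_value_def sum_subtractf[symmetric] sum_distrib_right
    using cell by (intro sum.cong) auto
  show "simple_value m p \<xi> s \<omega> = simple_value m p \<xi> (t (Suc i)) \<omega>" if "s \<in> {t i<..t (Suc i)}"
    unfolding simple_value_def
  proof (rule sum.cong[OF refl])
    fix l assume "l \<in> {..<m}"
    then show "\<xi> l \<omega> * indicator {p l<..p (Suc l)} s = \<xi> l \<omega> * indicator {p l<..p (Suc l)} (t (Suc i))"
      using gap[OF i, of l] gap[OF i, of "Suc l"] that by (auto simp: indicator_def)
  qed
  show "simple_value m p \<xi> (t (Suc i)) \<in> borel_measurable (F (t i))"
    unfolding simple_value_def
  proof (rule borel_measurable_sum)
    fix l assume l: "l \<in> {..<m}"
    show "(\<lambda>\<omega>. \<xi> l \<omega> * indicator {p l<..p (Suc l)} (t (Suc i))) \<in> borel_measurable (F (t i))"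
    proof (cases "p l < t (Suc i)")
      case True
      then have "p l \<le> t i" using gap[OF i, of l] l by auto
      moreover have "\<xi> l \<in> borel_measurable (F (p l))"
        using sp l by (simp add: simple_process_def)
      ultimately have "\<xi> l \<in> borel_measurable (F (t i))"
        using measurable_F_mono by blast
      then show ?thesis by measurable
    next
      case False
      then show ?thesis by simp
    qed
  qed
qed

end

section \<open>Sums compared with integrals\<close>

lemma left_riemann_sum_bound:
  fixes f :: "real \<Rightarrow> real"
  assumes t0: "t 0 = 0" and t: "\<And>i. i < n \<Longrightarrow> t i < t (Suc i)"
    and f: "continuous_on {0..} f"
    and osc: "\<And>i s. i < n \<Longrightarrow> s \<in> {t i..t (Suc i)} \<Longrightarrow> \<bar>f (t i) - f s\<bar> \<le> e"
    and "k \<le> n"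
  shows "\<bar>(\<Sum>j<k. f (t j) * (t (Suc j) - t j)) - integral {0..t k} f\<bar> \<le> e * t k \<and> 0 \<le> t k"
  using \<open>k \<le> n\<close>
proof (induction k)
  case 0
  then show ?case using t0 by simp
next
  case (Suc k)
  then have IH: "\<bar>(\<Sum>j<k. f (t j) * (t (Suc j) - t j)) - integral {0..t k} f\<bar> \<le> e * t k" "0 \<le> t k" and k: "k < n"
    by auto
  have c: "continuous_on {a..b} f" if "0 \<le> a" for a b
    using f by (rule continuous_on_subset) (use that in auto)
  have "integral {0..t (Suc k)} f = integral {0..t k} f + integral {t k..t (Suc k)} f"
    using IH(2) t[OF k] by (intro Henstock_Kurzweil_Integration.integral_combine[symmetric] integrable_continuous_interval c) auto
  moreover have "integral {t k..t (Suc k)} (\<lambda>s. f (t k) - f s) = f (t k) * (t (Suc k) - t k) - integral {t k..t (Suc k)} f"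
    using t[OF k] IH(2) c[of "t k" "t (Suc k)"]
    by (subst Henstock_Kurzweil_Integration.integral_diff) (auto intro: integrable_continuous_interval)
  moreover have "norm (integral {t k..t (Suc k)} (\<lambda>s. f (t k) - f s)) \<le> e * (t (Suc k) - t k)"
    using t[OF k] IH(2) osc[OF k] by (intro integral_bound continuous_on_diff continuous_on_const c) auto
  ultimately show ?case
    using IH t[OF k] by (simp add: algebra_simps)
qed

text \<open>The nonnegative integral matches the error in \<open>has_ito_integral\<close>.
  Measurability is asked for on \<open>[0, t n]\<close>, because paths are known to be continuous
  for nonnegative times only.\<close>

lemma sum_le_nn_integral_grid:
  fixes F :: "real \<Rightarrow> ennreal"
  assumes t0: "t 0 = 0" and t: "\<And>i. i < n \<Longrightarrow> t i < t (Suc i)"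
    and F [measurable]: "(\<lambda>s. F s * indicator {0..t n} s) \<in> borel_measurable lborel"
    and c: "\<And>i. i < n \<Longrightarrow> 0 \<le> c i" "\<And>i s. i < n \<Longrightarrow> s \<in> {t i<..t (Suc i)} \<Longrightarrow> ennreal (c i) \<le> F s"
  shows "ennreal (\<Sum>i<n. c i * (t (Suc i) - t i)) \<le> (\<integral>\<^sup>+s\<in>{0..t n}. F s \<partial>lborel)"
proof -
  have tmono: "t i \<le> t k" if "i \<le> k" "k \<le> n" for i k
    using grid_mono[of n t i k] t that by blast
  have "ennreal (\<Sum>i<k. c i * (t (Suc i) - t i)) \<le> (\<integral>\<^sup>+s\<in>{0..t k}. F s \<partial>lborel)" if "k \<le> n" for k
    using that
  proof (induction k)
    case 0
    then show ?case by simp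
  next
    case (Suc k)
    then have k: "k < n" by simp
    have m: "(\<lambda>s. F s * indicator A s) \<in> borel_measurable lborel" if "A \<in> sets borel" "A \<subseteq> {0..t n}" for A
    proof -
      have "(\<lambda>s. F s * indicator A s) = (\<lambda>s. F s * indicator {0..t n} s * indicator A s)"
        using that by (auto simp: indicator_def fun_eq_iff)
      then show ?thesis using that by simp
    qed
    have tk: "0 \<le> t k" "t k < t (Suc k)" "t (Suc k) \<le> t n"
      using tmono[of 0 k] tmono[of "Suc k" n] t[OF k] k t0 by auto
    have "ennreal (c k * (t (Suc k) - t k)) = (\<integral>\<^sup>+s\<in>{t k<..t (Suc k)}. ennreal (c k) \<partial>lborel)"
      using tk c(1)[OF k] by (subst nn_integral_cmult_indicator) (auto simp: ennreal_mult)
    also have "\<dots> \<le> (\<integral>\<^sup>+s\<in>{t k<..t (Suc k)}. F s \<partial>lborel)"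
      using c(2)[OF k] by (intro nn_integral_mono) (auto simp: indicator_def)
    finally have le: "ennreal (c k * (t (Suc k) - t k)) \<le> (\<integral>\<^sup>+s\<in>{t k<..t (Suc k)}. F s \<partial>lborel)" .
    have "ennreal (\<Sum>i<Suc k. c i * (t (Suc i) - t i)) \<le>
        (\<integral>\<^sup>+s\<in>{0..t k}. F s \<partial>lborel) + (\<integral>\<^sup>+s\<in>{t k<..t (Suc k)}. F s \<partial>lborel)"
    proof -
      have "0 \<le> (\<Sum>i<k. c i * (t (Suc i) - t i))" "0 \<le> c k * (t (Suc k) - t k)"
        using c(1) less_imp_le[OF t] k by (auto intro!: sum_nonneg mult_nonneg_nonneg)
      then have "ennreal (\<Sum>i<Suc k. c i * (t (Suc i) - t i)) =
          ennreal (\<Sum>i<k. c i * (t (Suc i) - t i)) + ennreal (c k * (t (Suc k) - t k))"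
        by simp
      then show ?thesis
        using Suc le by (simp add: add_mono)
    qed
    also have "\<dots> = (\<integral>\<^sup>+s. F s * indicator {0..t k} s + F s * indicator {t k<..t (Suc k)} s \<partial>lborel)"
      using tk by (intro nn_integral_add[symmetric] m) auto
    also have "\<dots> = (\<integral>\<^sup>+s\<in>{0..t (Suc k)}. F s \<partial>lborel)"
      using tk by (intro nn_integral_cong) (auto simp: indicator_def)
    finally show ?case .
  qed
  then show ?thesis by simp
qed

lemma square_three_terms: "(a + b + c)\<^sup>2 \<le> 3 * a\<^sup>2 + 3 * b\<^sup>2 + 3 * (c::real)\<^sup>2"
proof -
  have "0 \<le> (a - b)\<^sup>2 + (a - c)\<^sup>2 + (b - c)\<^sup>2" by simp
  then show ?thesis by (simp add: power2_eq_square algebra_simps)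
qed

lemma (in prob_space) incseq_events_compl_small:
  assumes "\<And>n. A n \<in> events" "incseq A" "(\<Union>n. A n) = space M" "0 < \<eta>"
  obtains n :: nat where "prob (space M - A n) < \<eta>"
proof -
  have "(\<lambda>n. prob (A n)) \<longlonglongrightarrow> 1"
    using finite_Lim_measure_incseq[of A] assms prob_space by (auto simp: image_subset_iff)
  then have "\<forall>\<^sub>F n in sequentially. 1 - \<eta> < prob (A n)"
    using assms by (intro order_tendstoD(1)) auto
  then obtain n where "1 - \<eta> < prob (A n)"
    by (auto simp: eventually_sequentially)
  then show thesis
    using that[of n] prob_compl[OF assms(1)[of n]] by simp
qed

section \<open>Path events and identification of the solution\<close>

context brownian_motion
begin

lemma event_bounded_on_rationals:
  fixes Y :: "real \<Rightarrow> 'a \<Rightarrow> real"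
  assumes "\<And>q. 0 \<le> q \<Longrightarrow> Y q \<in> borel_measurable M"
  shows "{\<omega> \<in> space M. \<forall>q\<in>\<rat> \<inter> {0..T}. \<bar>Y q \<omega>\<bar> \<le> c} \<in> events"
proof (rule sets.sets_Collect_countable_All')
  show "countable (\<rat> \<inter> {0..T})" using countable_rat by blast
  fix q assume "q \<in> \<rat> \<inter> {0..T}"
  then have [measurable]: "Y q \<in> borel_measurable M" using assms by simp
  show "{\<omega> \<in> space M. \<bar>Y q \<omega>\<bar> \<le> c} \<in> events" by measurable
qed

text \<open>Each continuous path is bounded on a compact interval, but not uniformly over the paths.
  The sets with bound \<open>N\<close> increase to the whole space, so a deterministic bound holds
  off an event of probability below \<open>\<eta>\<close>. Quantifying over rational times makes
  these sets events.\<close>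

lemma bounded_paths_event:
  fixes Y :: "real \<Rightarrow> 'a \<Rightarrow> real"
  assumes "0 < T" and Y: "\<And>q. 0 \<le> q \<Longrightarrow> Y q \<in> borel_measurable M"
    and c: "\<And>\<omega>. \<omega> \<in> space M \<Longrightarrow> continuous_on {0..} (\<lambda>t. Y t \<omega>)" and "0 < \<eta>"
  shows "\<exists>(N::nat) G. G \<in> events \<and> prob (space M - G) < \<eta> \<and> (\<forall>\<omega>\<in>G. \<forall>t\<in>{0..T}. \<bar>Y t \<omega>\<bar> \<le> N)"
proof -
  define A where "A N = {\<omega> \<in> space M. \<forall>q\<in>\<rat> \<inter> {0..T}. \<bar>Y q \<omega>\<bar> \<le> real N}" for N
  have cT: "continuous_on {0..T} (\<lambda>t. \<bar>Y t \<omega>\<bar>)" if "\<omega> \<in> space M" for \<omega>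
    using continuous_on_subset[OF c[OF that], of "{0..T}"] by (auto intro: continuous_on_rabs)
  have A: "\<And>N. A N \<in> events"
    unfolding A_def using Y by (intro event_bounded_on_rationals)
  have "incseq A"
    unfolding A_def incseq_def by (auto intro: order_trans)
  moreover have "(\<Union>N. A N) = space M"
  proof (intro equalityI subsetI)
    fix \<omega> assume \<omega>: "\<omega> \<in> space M"
    have "bounded ((\<lambda>t. \<bar>Y t \<omega>\<bar>) ` {0..T})"
      using cT[OF \<omega>] by (intro compact_imp_bounded compact_continuous_image) auto
    then obtain b where b: "\<forall>t\<in>{0..T}. \<bar>Y t \<omega>\<bar> \<le> b"
      by (auto simp: bounded_iff)
    obtain N :: nat where "b \<le> real N"
      using real_arch_simple by blast
    then have "\<omega> \<in> A N"
      using b \<omega> by (force simp: A_def)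
    then show "\<omega> \<in> (\<Union>N. A N)" by blast
  qed (auto simp: A_def)
  ultimately obtain N where N: "prob (space M - A N) < \<eta>"
    using incseq_events_compl_small[of A] A \<open>0 < \<eta>\<close> by blast
  show ?thesis
  proof (intro exI conjI ballI)
    show "A N \<in> events" by (rule A)
    show "prob (space M - A N) < \<eta>" by (rule N)
    fix \<omega> t assume "\<omega> \<in> A N" "t \<in> {0..T}"
    then show "\<bar>Y t \<omega>\<bar> \<le> real N"
      using le_on_rationals_imp_le[OF \<open>0 < T\<close> cT[of \<omega>], of UNIV "real N" t] by (auto simp: A_def)
  qed
qed

text \<open>The exhaustion used for bounded paths, now applied to uniform continuity: the distance
  at which oscillation \<open>e\<close> is guaranteed becomes deterministic off a small
  event.\<close>

lemma equicontinuous_paths_event: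
  fixes Y :: "real \<Rightarrow> 'a \<Rightarrow> real"
  assumes "0 < T" and Y: "\<And>q. 0 \<le> q \<Longrightarrow> Y q \<in> borel_measurable M"
    and c: "\<And>\<omega>. \<omega> \<in> space M \<Longrightarrow> continuous_on {0..} (\<lambda>t. Y t \<omega>)" and "0 < \<eta>" "0 < e"
  shows "\<exists>r G. 0 < r \<and> G \<in> events \<and> prob (space M - G) < \<eta> \<and>
    (\<forall>\<omega>\<in>G. \<forall>s\<in>{0..T}. \<forall>t\<in>{0..T}. \<bar>s - t\<bar> < r \<longrightarrow> \<bar>Y s \<omega> - Y t \<omega>\<bar> \<le> e)"
proof -
  define A where "A m = {\<omega> \<in> space M. \<forall>q\<in>\<rat> \<inter> {0..T}. \<forall>q'\<in>\<rat> \<inter> {0..T}.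
     \<bar>q - q'\<bar> < 1 / Suc m \<longrightarrow> \<bar>Y q \<omega> - Y q' \<omega>\<bar> \<le> e}" for m
  have cT: "continuous_on {0..T} (\<lambda>t. Y t \<omega>)" if "\<omega> \<in> space M" for \<omega>
    using continuous_on_subset[OF c[OF that], of "{0..T}"] by auto
  have A: "A m \<in> events" for m
  proof -
    have c: "countable (\<rat> \<inter> {0..T})" using countable_rat by blast
    have "{\<omega> \<in> space M. \<bar>q - q'\<bar> < 1 / Suc m \<longrightarrow> \<bar>Y q \<omega> - Y q' \<omega>\<bar> \<le> e} \<in> events"
      if "q \<in> \<rat> \<inter> {0..T}" "q' \<in> \<rat> \<inter> {0..T}" for q q'
    proof -
      have [measurable]: "Y q \<in> borel_measurable M" "Y q' \<in> borel_measurable M" using Y that by auto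
      show ?thesis by measurable
    qed
    then show ?thesis unfolding A_def
      by (intro sets.sets_Collect_countable_All'[OF sets.sets_Collect_countable_All'[OF _ c] c])
  qed
  have "incseq A"
    unfolding incseq_def
  proof (intro allI impI subsetI)
    fix m n \<omega> assume "m \<le> (n::nat)" and \<omega>: "\<omega> \<in> A m"
    then have "1 / real (Suc n) \<le> 1 / real (Suc m)"
      by (intro divide_left_mono) auto
    then show "\<omega> \<in> A n"
      using \<omega> by (auto simp: A_def)
  qed
  moreover have "(\<Union>N. A N) = space M"
  proof (intro equalityI subsetI)
    fix \<omega> assume \<omega>: "\<omega> \<in> space M"
    have "uniformly_continuous_on {0..T} (\<lambda>t. Y t \<omega>)"
      using cT[OF \<omega>] by (intro compact_uniformly_continuous) auto
    then obtain d where d: "0 < d" "\<And>s t. s \<in> {0..T} \<Longrightarrow> t \<in> {0..T} \<Longrightarrow> dist s t < d \<Longrightarrow> dist (Y s \<omega>) (Y t \<omega>) < e"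
      using \<open>0 < e\<close> unfolding uniformly_continuous_on_def by metis
    obtain m :: nat where "1 / Suc m < d"
      using d(1) nat_approx_posE by metis
    then have "\<omega> \<in> A m"
      using d(2) \<omega> by (force simp: A_def dist_real_def)
    then show "\<omega> \<in> (\<Union>N. A N)" by blast
  qed (auto simp: A_def)
  ultimately obtain m where m: "prob (space M - A m) < \<eta>"
    using incseq_events_compl_small[of A] A \<open>0 < \<eta>\<close> by blast
  show ?thesis
  proof (intro exI conjI ballI impI)
    show "0 < 1 / real (Suc m)" by simp
    show "A m \<in> events" by (rule A)
    show "prob (space M - A m) < \<eta>" by (rule m)
    fix \<omega> s t assume \<omega>: "\<omega> \<in> A m" and st: "s \<in> {0..T}" "t \<in> {0..T}" "\<bar>s - t\<bar> < 1 / Suc m"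
    have cY: "continuous_on {0..T} (\<lambda>t. Y t \<omega>)" using \<omega> cT by (simp add: A_def)
    \<comment> \<open>The two time variables are released from the rationals one after the other;
      the open set carries the constraint on their distance.\<close>
    have 1: "\<bar>Y q \<omega> - Y t \<omega>\<bar> \<le> e" if q: "q \<in> \<rat>" "q \<in> {0..T}" "\<bar>q - t\<bar> < 1 / Suc m" "t \<in> {0..T}" for q t
    proof (rule le_on_rationals_imp_le[OF \<open>0 < T\<close>, where U="{t. \<bar>q - t\<bar> < 1 / Suc m}" and f="\<lambda>t. \<bar>Y q \<omega> - Y t \<omega>\<bar>"])
      show "continuous_on {0..T} (\<lambda>t. \<bar>Y q \<omega> - Y t \<omega>\<bar>)"
        using cY by (intro continuous_intros)
      show "open {t. \<bar>q - t\<bar> < 1 / real (Suc m)}"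
        by (intro open_Collect_less continuous_intros)
    qed (use q \<omega> in \<open>auto simp: A_def\<close>)
    show "\<bar>Y s \<omega> - Y t \<omega>\<bar> \<le> e"
    proof (rule le_on_rationals_imp_le[OF \<open>0 < T\<close>, where U="{s. \<bar>s - t\<bar> < 1 / Suc m}" and f="\<lambda>s. \<bar>Y s \<omega> - Y t \<omega>\<bar>"])
      show "continuous_on {0..T} (\<lambda>s. \<bar>Y s \<omega> - Y t \<omega>\<bar>)"
        using cY by (intro continuous_intros)
      show "open {s. \<bar>s - t\<bar> < 1 / real (Suc m)}"
        by (intro open_Collect_less continuous_intros)
      show "\<bar>Y q \<omega> - Y t \<omega>\<bar> \<le> e" if "q \<in> \<rat>" "q \<in> {0..T}" "q \<in> {s. \<bar>s - t\<bar> < 1 / real (Suc m)}" for q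
        using 1[of q t] that st(2) by simp
      show "s \<in> {s. \<bar>s - t\<bar> < 1 / real (Suc m)}"
        using st(3) by simp
    qed (rule st(1))
  qed
qed

lemma simple_process_times_nonneg:
  assumes "simple_process F m p \<xi>" "l \<le> m"
  shows "0 \<le> p l"
  using assms(2,1) by (induction l) (auto simp: simple_process_def Suc_le_eq intro: order_trans)

lemma simple_integral_continuous:
  assumes "simple_process F m p \<xi>" "\<omega> \<in> space M"
  shows "continuous_on {0..} (\<lambda>t. simple_integral W m p \<xi> t \<omega>)"
proof -
  note p = simple_process_times_nonneg[OF assms(1)]
  have "continuous_on {0..} (\<lambda>t. W (min t (p l)) \<omega>)" if "l \<le> m" for l
    using p[OF that] by (intro continuous_on_compose2[OF continuous_paths[OF assms(2)]] continuous_intros) auto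
  then show ?thesis
    unfolding simple_integral_def by (intro continuous_intros) auto
qed

lemma simple_integral_measurable:
  assumes "simple_process F m p \<xi>" "0 \<le> t"
  shows "simple_integral W m p \<xi> t \<in> borel_measurable M"
proof -
  note p = simple_process_times_nonneg[OF assms(1)]
  have "\<xi> l \<in> borel_measurable M" if "l < m" for l
    using assms(1) that measurable_F_M unfolding simple_process_def by blast
  moreover have "W (min t (p l)) \<in> borel_measurable M" if "l \<le> m" for l
    using p[OF that] assms(2) by (intro W_measurable) auto
  ultimately show ?thesis
    unfolding simple_integral_def by (intro borel_measurable_sum borel_measurable_times borel_measurable_diff) auto
qed

lemma simple_integral_0:
  assumes "simple_process F m p \<xi>"
  shows "simple_integral W m p \<xi> 0 \<omega> = 0"
proof -
  note p = simple_process_times_nonneg[OF assms(1)]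
  show ?thesis
    unfolding simple_integral_def using p by (intro sum.neutral) (simp add: min_absorb1)
qed

text \<open>A set that is not measurable has \<open>measure\<close> zero, so a small value in
  \<open>has_ito_integral\<close> is informative only for genuine events. Progressive measurability
  gives joint measurability on \<open>[0, T]\<close>, hence a measurable integral.\<close>

lemma integrated_square_error_event:
  assumes sp: "simple_process F m p \<xi>" and H: "progressively_measurable F H" and "0 \<le> T"
  shows "{\<omega> \<in> space M. \<epsilon> < (\<integral>\<^sup>+s\<in>{0..T}. ennreal ((simple_value m p \<xi> s \<omega> - H s \<omega>)\<^sup>2) \<partial>lborel)} \<in> events"
proof -
  let ?R = "restrict_space lborel {0..T}"
  have \<xi> [measurable]: "\<xi> l \<in> borel_measurable M" if "l < m" for l
    using sp that measurable_F_M unfolding simple_process_def by blast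
  have swap: "(\<lambda>z. (snd z, fst z)) \<in> M \<Otimes>\<^sub>M ?R \<rightarrow>\<^sub>M restrict_space borel {0..T} \<Otimes>\<^sub>M F T"
  proof (rule measurable_Pair)
    have "snd \<in> M \<Otimes>\<^sub>M ?R \<rightarrow>\<^sub>M ?R" by simp
    then show "(\<lambda>z. snd z) \<in> M \<Otimes>\<^sub>M ?R \<rightarrow>\<^sub>M restrict_space borel {0..T}"
      by (simp add: measurable_restrict_space2_iff)
    have "(\<lambda>\<omega>. \<omega>) \<in> M \<rightarrow>\<^sub>M F T"
      by (rule measurable_F_M[of _ T]) simp
    then show "(\<lambda>z. fst z) \<in> M \<Otimes>\<^sub>M ?R \<rightarrow>\<^sub>M F T"
      by (rule measurable_compose[rotated]) simp
  qed
  have "(\<lambda>z. H (fst z) (snd z)) \<in> borel_measurable (restrict_space borel {0..T} \<Otimes>\<^sub>M F T)"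
    using H \<open>0 \<le> T\<close> by (simp add: progressively_measurable_def split_def)
  from measurable_compose[OF swap this] have Hm [measurable]: "(\<lambda>z. H (snd z) (fst z)) \<in> borel_measurable (M \<Otimes>\<^sub>M ?R)"
    by simp
  have sm: "snd \<in> M \<Otimes>\<^sub>M ?R \<rightarrow>\<^sub>M borel"
    by (rule measurable_compose[OF measurable_snd]) (simp add: measurable_restrict_space1)
  have [measurable]: "(\<lambda>z. simple_value m p \<xi> (snd z) (fst z)) \<in> borel_measurable (M \<Otimes>\<^sub>M ?R)"
    unfolding simple_value_def
    by (intro borel_measurable_sum borel_measurable_times measurable_compose[OF measurable_fst \<xi>] measurable_compose[OF sm]) auto
  interpret R: finite_measure ?R
    by (rule finite_measureI) (simp add: emeasure_restrict_space emeasure_lborel_Icc_eq)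
  have "(\<lambda>\<omega>. \<integral>\<^sup>+s. ennreal ((simple_value m p \<xi> s \<omega> - H s \<omega>)\<^sup>2) \<partial>?R) \<in> borel_measurable M"
    by (rule R.borel_measurable_nn_integral) (simp add: case_prod_beta)
  then have [measurable]: "(\<lambda>\<omega>. \<integral>\<^sup>+s\<in>{0..T}. ennreal ((simple_value m p \<xi> s \<omega> - H s \<omega>)\<^sup>2) \<partial>lborel) \<in> borel_measurable M"
    by (subst (asm) nn_integral_restrict_space) auto
  show ?thesis by measurable
qed

text \<open>On an event of nearly full probability the solution follows an Euler scheme
  \<open>V\<close> whose coefficients are sampled from \<open>X\<close> and from an approximating
  simple process. The product of that scheme with \<open>R\<close>, which is the reciprocal of the
  explicit solution up to a factor independent of time, is almost constant in time.\<close>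

lemma gbm_reciprocal_tail_zero:
  fixes \<mu> \<sigma> x0 T \<epsilon> :: real
  assumes sde: "sde_solution M F W (\<lambda>x. \<mu> * x) (\<lambda>x. \<sigma> * x) x0 X" and "0 < T" and "0 < \<epsilon>"
  defines "R \<equiv> \<lambda>t \<omega>. exp (- \<sigma> * W t \<omega> + (\<sigma>\<^sup>2 / 2 - \<mu>) * t)"
  shows "prob {\<omega> \<in> space M. 4 * \<epsilon> \<le> \<bar>X T \<omega> * R T \<omega> - X 0 \<omega> * R 0 \<omega>\<bar>} = 0"
proof -
  define C where "C = 3 * (\<sigma>\<^sup>2 - \<mu>)\<^sup>2 + 3 * (\<mu> - 2 * \<sigma>\<^sup>2)\<^sup>2 + 3 * \<bar>\<sigma>\<bar> + 12 * \<sigma>\<^sup>2 + 3"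
  define C' where "C' = 2 * C + 2 * C\<^sup>2 * T"
  have "3 \<le> C" by (simp add: C_def)
  then have C': "0 < C'"
    using \<open>0 < T\<close> by (simp add: C'_def add_pos_nonneg)
  have XF: "\<And>t. 0 \<le> t \<Longrightarrow> X t \<in> borel_measurable (F t)"
    and Xc: "\<And>\<omega>. \<omega> \<in> space M \<Longrightarrow> continuous_on {0..} (\<lambda>t. X t \<omega>)"
    using sde by (auto simp: sde_solution_def)
  have XM: "\<And>t. 0 \<le> t \<Longrightarrow> X t \<in> borel_measurable M"
    using XF measurable_F_M by blast
  obtain I where I: "has_ito_integral M F W (\<lambda>t \<omega>. \<sigma> * X t \<omega>) I"
    and eq: "AE \<omega> in M. \<forall>t\<ge>0. X t \<omega> = X 0 \<omega> + (LBINT s:{0..t}. \<mu> * X s \<omega>) + I t \<omega>"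
    using sde by (auto simp: sde_solution_def)
  have prog: "progressively_measurable F (\<lambda>t \<omega>. \<sigma> * X t \<omega>)"
    and IM: "\<And>t. 0 \<le> t \<Longrightarrow> I t \<in> borel_measurable M"
    and Ic: "\<And>\<omega>. \<omega> \<in> space M \<Longrightarrow> continuous_on {0..} (\<lambda>t. I t \<omega>)"
    using I by (auto simp: has_ito_integral_def)
  obtain m p \<xi> where sp: "\<And>k. simple_process F (m k) (p k) (\<xi> k)"
    and c1: "\<And>\<epsilon>. 0 < \<epsilon> \<Longrightarrow> (\<lambda>k. measure M {\<omega> \<in> space M. ennreal \<epsilon> <
             (\<integral>\<^sup>+s\<in>{0..T}. ennreal ((simple_value (m k) (p k) (\<xi> k) s \<omega> - \<sigma> * X s \<omega>)\<^sup>2) \<partial>lborel)}) \<longlonglongrightarrow> 0"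
    and c2: "\<And>\<epsilon>. 0 < \<epsilon> \<Longrightarrow> (\<lambda>k. measure M {\<omega> \<in> space M. \<exists>t\<in>{0..T}.
             \<epsilon> < \<bar>simple_integral W (m k) (p k) (\<xi> k) t \<omega> - I t \<omega>\<bar>}) \<longlonglongrightarrow> 0"
    using I \<open>0 < T\<close> unfolding has_ito_integral_def by blast
  have RM: "R t \<in> borel_measurable M" if "0 \<le> t" for t
    using W_measurable[OF that] unfolding R_def by measurable
  have Rc: "continuous_on {0..} (\<lambda>t. R t \<omega>)" if "\<omega> \<in> space M" for \<omega>
    unfolding R_def using continuous_paths[OF that] by (intro continuous_intros)
  let ?E = "{\<omega> \<in> space M. 4 * \<epsilon> \<le> \<bar>X T \<omega> * R T \<omega> - X 0 \<omega> * R 0 \<omega>\<bar>}"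
  \<comment> \<open>Five bad events below \<open>\<eta>\<close> and a null set give
    \<open>5 * \<eta>\<close>; the scheme estimate gives \<open>3 * (5 * \<eta> + \<eta>)\<close>.
    Any factor from 23 on would do.\<close>
  have bound: "prob ?E \<le> 27 * \<eta>" if \<eta>: "0 < \<eta>" for \<eta>
  proof -
    \<comment> \<open>Chosen so that the error term of the scheme estimate,
      \<open>C' * \<delta> / \<epsilon>\<^sup>2\<close>, equals \<open>\<eta>\<close>.\<close>
    define \<delta> where "\<delta> = \<eta> * \<epsilon>\<^sup>2 / C'"
    have \<delta>: "0 < \<delta>" using that C' \<open>0 < \<epsilon>\<close> by (simp add: \<delta>_def)
    obtain N1 :: nat and G1 where G1: "G1 \<in> events" "prob (space M - G1) < \<eta>"
        "\<forall>\<omega>\<in>G1. \<forall>t\<in>{0..T}. \<bar>X t \<omega>\<bar> \<le> N1"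
      using bounded_paths_event[OF \<open>0 < T\<close> XM Xc \<eta>] by metis
    obtain N2 :: nat and G2 where G2: "G2 \<in> events" "prob (space M - G2) < \<eta>"
        "\<forall>\<omega>\<in>G2. \<forall>t\<in>{0..T}. \<bar>R t \<omega>\<bar> \<le> N2"
      using bounded_paths_event[OF \<open>0 < T\<close> RM Rc \<eta>] by metis
    \<comment> \<open>The order of choices matters: first this path bound, then a tolerance
      \<open>e\<close> small relative to it, then the index \<open>k\<close> of the simple process,
      and last the mesh \<open>r\<close>.\<close>
    define N where "N = real (N1 + N2)"
    have N: "0 \<le> N" by (simp add: N_def)
    \<comment> \<open>The distance of scheme and solution in units of \<open>e\<close>:
      \<open>\<bar>\<mu>\<bar> * T\<close> from the Riemann sum of the drift and 1 from the
      stochastic integral.\<close>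
    define b where "b = (\<bar>\<mu>\<bar> * T + 1)"
    have b: "0 \<le> b" using \<open>0 < T\<close> by (simp add: b_def)
    have "\<forall>\<^sub>F e in at_right 0. \<mu>\<^sup>2 * N\<^sup>2 * (b * e)\<^sup>2 * T < \<delta>"
      by (rule order_tendstoD(2)[of _ 0]) (use \<delta> in \<open>auto intro!: tendsto_eq_intros\<close>)
    moreover have "\<forall>\<^sub>F e in at_right 0. N\<^sup>2 * (3 * e + (3 * \<sigma>\<^sup>2 * e\<^sup>2 + 3 * \<sigma>\<^sup>2 * (b * e)\<^sup>2) * T) < \<delta>"
      by (rule order_tendstoD(2)[of _ 0]) (use \<delta> in \<open>auto intro!: tendsto_eq_intros\<close>)
    moreover have "\<forall>\<^sub>F e in at_right 0. N * (b * e) < \<epsilon>"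
      by (rule order_tendstoD(2)[of _ 0]) (use \<open>0 < \<epsilon>\<close> in \<open>auto intro!: tendsto_eq_intros\<close>)
    moreover have "\<forall>\<^sub>F e in at_right 0. 0 < (e::real)"
      by (simp add: eventually_at_right_less)
    ultimately have "\<forall>\<^sub>F e in at_right 0. \<mu>\<^sup>2 * N\<^sup>2 * (b * e)\<^sup>2 * T < \<delta> \<and>
        N\<^sup>2 * (3 * e + (3 * \<sigma>\<^sup>2 * e\<^sup>2 + 3 * \<sigma>\<^sup>2 * (b * e)\<^sup>2) * T) < \<delta> \<and> N * (b * e) < \<epsilon> \<and> 0 < e"
      by eventually_elim blast
    then obtain e where e: "\<mu>\<^sup>2 * N\<^sup>2 * (b * e)\<^sup>2 * T < \<delta>"
        "N\<^sup>2 * (3 * e + (3 * \<sigma>\<^sup>2 * e\<^sup>2 + 3 * \<sigma>\<^sup>2 * (b * e)\<^sup>2) * T) < \<delta>" "N * (b * e) < \<epsilon>" "0 < e"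
      using eventually_happens'[OF trivial_limit_at_right_real] by blast
    obtain r0 G3 where G3: "0 < r0" "G3 \<in> events" "prob (space M - G3) < \<eta>"
        "\<forall>\<omega>\<in>G3. \<forall>s\<in>{0..T}. \<forall>t\<in>{0..T}. \<bar>s - t\<bar> < r0 \<longrightarrow> \<bar>X s \<omega> - X t \<omega>\<bar> \<le> e"
      using equicontinuous_paths_event[OF \<open>0 < T\<close> XM Xc \<eta> e(4)] by metis
    have "\<forall>\<^sub>F k in sequentially. measure M {\<omega> \<in> space M. ennreal e <
             (\<integral>\<^sup>+s\<in>{0..T}. ennreal ((simple_value (m k) (p k) (\<xi> k) s \<omega> - \<sigma> * X s \<omega>)\<^sup>2) \<partial>lborel)} < \<eta> \<and>
         measure M {\<omega> \<in> space M. \<exists>t\<in>{0..T}. e < \<bar>simple_integral W (m k) (p k) (\<xi> k) t \<omega> - I t \<omega>\<bar>} < \<eta>"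
      using order_tendstoD(2)[OF c1[OF e(4)] that] order_tendstoD(2)[OF c2[OF e(4)] that] by (rule eventually_conj)
    then obtain k where k1: "measure M {\<omega> \<in> space M. ennreal e <
             (\<integral>\<^sup>+s\<in>{0..T}. ennreal ((simple_value (m k) (p k) (\<xi> k) s \<omega> - \<sigma> * X s \<omega>)\<^sup>2) \<partial>lborel)} < \<eta>"
      and k2: "measure M {\<omega> \<in> space M. \<exists>t\<in>{0..T}. e < \<bar>simple_integral W (m k) (p k) (\<xi> k) t \<omega> - I t \<omega>\<bar>} < \<eta>"
      by (auto simp: eventually_sequentially)
    define J where "J t \<omega> = simple_integral W (m k) (p k) (\<xi> k) t \<omega>" for t \<omega>
    define H where "H s \<omega> = simple_value (m k) (p k) (\<xi> k) s \<omega>" for s \<omega>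
    define B4 where "B4 = {\<omega> \<in> space M. ennreal e < (\<integral>\<^sup>+s\<in>{0..T}. ennreal ((H s \<omega> - \<sigma> * X s \<omega>)\<^sup>2) \<partial>lborel)}"
    have B4: "B4 \<in> events" "prob B4 < \<eta>"
      using integrated_square_error_event[OF sp prog, of T "ennreal e" k] \<open>0 < T\<close> k1 by (auto simp: B4_def H_def)
    have Jc: "continuous_on {0..} (\<lambda>t. J t \<omega>)" if "\<omega> \<in> space M" for \<omega>
      unfolding J_def using simple_integral_continuous[OF sp that] .
    define B5 where "B5 = {\<omega> \<in> space M. \<exists>t\<in>{0..T}. e < \<bar>J t \<omega> - I t \<omega>\<bar>}"
    \<comment> \<open>Continuity of \<open>J\<close> and \<open>I\<close> replaces all times by
      rational ones, which makes \<open>B5\<close> an event and its small \<open>measure\<close>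
      meaningful.\<close>
    have B5_eq: "B5 = space M - {\<omega> \<in> space M. \<forall>q\<in>\<rat> \<inter> {0..T}. \<bar>J q \<omega> - I q \<omega>\<bar> \<le> e}"
    proof (intro equalityI subsetI)
      fix \<omega> assume "\<omega> \<in> B5"
      then obtain t where t: "\<omega> \<in> space M" "t \<in> {0..T}" "e < \<bar>J t \<omega> - I t \<omega>\<bar>" by (auto simp: B5_def)
      have "continuous_on {0..T} (\<lambda>t. \<bar>J t \<omega> - I t \<omega>\<bar>)"
        using Jc[OF t(1)] Ic[OF t(1)] by (intro continuous_intros) (auto elim: continuous_on_subset)
      from le_on_rationals_imp_le[OF \<open>0 < T\<close> this open_UNIV _ t(2), of e] t(1,3)
      show "\<omega> \<in> space M - {\<omega> \<in> space M. \<forall>q\<in>\<rat> \<inter> {0..T}. \<bar>J q \<omega> - I q \<omega>\<bar> \<le> e}" by force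
    qed (auto simp: B5_def not_le)
    have B5: "B5 \<in> events" "prob B5 < \<eta>"
    proof -
      have "{\<omega> \<in> space M. \<forall>q\<in>\<rat> \<inter> {0..T}. \<bar>J q \<omega> - I q \<omega>\<bar> \<le> e} \<in> events"
        unfolding J_def using simple_integral_measurable[OF sp] IM by (intro event_bounded_on_rationals) auto
      then show "B5 \<in> events" by (auto simp: B5_eq)
      show "prob B5 < \<eta>" using k2 by (simp add: B5_def J_def)
    qed
    obtain B6 where B6: "B6 \<in> null_sets M"
      "{\<omega> \<in> space M. \<not> (\<forall>t\<ge>0. X t \<omega> = X 0 \<omega> + (LBINT s:{0..t}. \<mu> * X s \<omega>) + I t \<omega>)} \<subseteq> B6"
      using eq unfolding eventually_ae_filter by blast
    define B where "B = (((((space M - G1) \<union> (space M - G2)) \<union> (space M - G3)) \<union> B4) \<union> B5) \<union> B6"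
    have Bev: "B \<in> events"
      using G1 G2 G3 B4 B5 B6 by (auto simp: B_def)
    have "prob B \<le> prob (space M - G1) + prob (space M - G2) + prob (space M - G3) + prob B4 + prob B5 + prob B6"
      unfolding B_def using G1 G2 G3 B4 B5 B6
      by (intro order_trans[OF measure_Un_le] add_mono order_refl) auto
    moreover have "prob B6 = 0" using B6 by (simp add: measure_eq_0_null_sets)
    ultimately have pB: "prob B \<le> 5 * \<eta>" using G1 G2 G3 B4 B5 by simp
    define G where "G = space M - B"
    have GB: "space M - G = B"
      using sets.sets_into_space[OF Bev] by (auto simp: G_def)
    have Gev: "G \<in> events" using Bev by (auto simp: G_def)
    have g1: "\<bar>X t \<omega>\<bar> \<le> N" "0 \<le> R t \<omega>" "R t \<omega> \<le> N" if "\<omega> \<in> G" "t \<in> {0..T}" for \<omega> t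
      proof -
      have "\<omega> \<in> G1" "\<omega> \<in> G2" using that by (auto simp: G_def B_def)
      then show "\<bar>X t \<omega>\<bar> \<le> N" "0 \<le> R t \<omega>" "R t \<omega> \<le> N"
        using G1(3) G2(3) that(2) by (force simp: N_def R_def)+
    qed
    have g3: "\<bar>X s \<omega> - X t \<omega>\<bar> \<le> e" if "\<omega> \<in> G" "s \<in> {0..T}" "t \<in> {0..T}" "\<bar>s - t\<bar> < r0" for \<omega> s t
      proof -
      have "\<omega> \<in> G3" using that by (auto simp: G_def B_def)
      then show ?thesis using G3(4) that by blast
    qed
    have g4: "(\<integral>\<^sup>+s\<in>{0..T}. ennreal ((H s \<omega> - \<sigma> * X s \<omega>)\<^sup>2) \<partial>lborel) \<le> ennreal e" if "\<omega> \<in> G" for \<omega>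
      using that by (auto simp: G_def B_def B4_def)
    have g5: "\<bar>J t \<omega> - I t \<omega>\<bar> \<le> e" if "\<omega> \<in> G" "t \<in> {0..T}" for \<omega> t
      using that by (auto simp: G_def B_def B5_def not_less)
    have g6: "X t \<omega> = X 0 \<omega> + integral {0..t} (\<lambda>s. \<mu> * X s \<omega>) + I t \<omega>" if "\<omega> \<in> G" "0 \<le> t" for \<omega> t
    proof -
      have "continuous_on {0..t} (\<lambda>s. \<mu> * X s \<omega>)"
        using Xc[of \<omega>] that by (intro continuous_intros) (auto simp: G_def elim: continuous_on_subset)
      then have "(LBINT s:{0..t}. \<mu> * X s \<omega>) = integral {0..t} (\<lambda>s. \<mu> * X s \<omega>)"
        by (intro set_borel_integral_eq_integral borel_integrable_atLeastAtMost')
      moreover have "X t \<omega> = X 0 \<omega> + (LBINT s:{0..t}. \<mu> * X s \<omega>) + I t \<omega>"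
        using that B6(2) unfolding G_def B_def by blast
      ultimately show ?thesis by simp
    qed
    have "\<forall>\<^sub>F r in at_right 0. (N * (N + b * e))\<^sup>2 * r * T < \<delta>"
      by (rule order_tendstoD(2)[of _ 0]) (use \<delta> in \<open>auto intro!: tendsto_eq_intros\<close>)
    moreover have "\<forall>\<^sub>F r in at_right 0. \<bar>\<sigma>\<^sup>2 - \<mu>\<bar> * r < 1"
      by (rule order_tendstoD(2)[of _ 0]) (auto intro!: tendsto_eq_intros)
    moreover have "\<forall>\<^sub>F r in at_right 0. \<bar>3 * \<sigma>\<^sup>2 - 2 * \<mu>\<bar> * r < 1"
      by (rule order_tendstoD(2)[of _ 0]) (auto intro!: tendsto_eq_intros)
    moreover have "\<forall>\<^sub>F r in at_right 0. r < min 1 r0"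
      using G3(1) by (intro order_tendstoD(2)[of _ 0]) (auto intro!: tendsto_eq_intros)
    moreover have "\<forall>\<^sub>F r in at_right 0. 0 < (r::real)"
      by (simp add: eventually_at_right_less)
    ultimately have "\<forall>\<^sub>F r in at_right 0. (N * (N + b * e))\<^sup>2 * r * T < \<delta> \<and> \<bar>\<sigma>\<^sup>2 - \<mu>\<bar> * r < 1 \<and>
        \<bar>3 * \<sigma>\<^sup>2 - 2 * \<mu>\<bar> * r < 1 \<and> r < min 1 r0 \<and> 0 < r"
      by eventually_elim blast
    then obtain r where r: "(N * (N + b * e))\<^sup>2 * r * T < \<delta>" "\<bar>\<sigma>\<^sup>2 - \<mu>\<bar> * r < 1"
        "\<bar>3 * \<sigma>\<^sup>2 - 2 * \<mu>\<bar> * r < 1" "r < min 1 r0" "0 < r"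
      using eventually_happens'[OF trivial_limit_at_right_real] by blast
    obtain n t where t0: "t 0 = 0" and tn: "t n = T" and ti: "\<And>i. i < n \<Longrightarrow> t i < t (Suc i)"
      and tr: "\<And>i. i < n \<Longrightarrow> t (Suc i) - t i \<le> r"
      and gap': "\<And>i x. i < n \<Longrightarrow> x \<in> p k ` {..m k} \<Longrightarrow> x \<le> t i \<or> t (Suc i) \<le> x"
      using exists_fine_grid[of "p k ` {..m k}" T r] \<open>0 < T\<close> r(5) by (metis finite_atMost finite_imageI)
    have gap: "p k l \<le> t i \<or> t (Suc i) \<le> p k l" if "i < n" "l \<le> m k" for i l
      using gap'[OF that(1), of "p k l"] that by auto
    have tmono: "t i \<le> t j" if "i \<le> j" "j \<le> n" for i j
      using grid_mono[of n t i j] ti that by blast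
    have tT: "t i \<in> {0..T}" if "i \<le> n" for i
      using tmono[of 0 i] tmono[of i n] that t0 tn by auto
    define g where "g i = H (t (Suc i))" for i
    have grid1: "J (t (Suc i)) \<omega> - J (t i) \<omega> = g i \<omega> * (W (t (Suc i)) \<omega> - W (t i) \<omega>)" if "i < n" for i \<omega>
      unfolding J_def H_def g_def
      by (rule simple_integral_refining_grid(1)[OF sp[of k], of n t]) (use ti t0 gap that in blast)+
    have grid2: "H s \<omega> = g i \<omega>" if "i < n" "s \<in> {t i<..t (Suc i)}" for i s \<omega>
      unfolding H_def g_def
      by (rule simple_integral_refining_grid(2)[OF sp[of k], of n t]) (use ti t0 gap that in blast)+
    have gF: "g i \<in> borel_measurable (F (t i))" if "i < n" for i
      unfolding H_def[abs_def] g_def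
      by (rule simple_integral_refining_grid(3)[OF sp[of k], of n t]) (use ti t0 gap that in blast)+
    define V where "V j \<omega> = X (t 0) \<omega> + (\<Sum>l<j. \<mu> * X (t l) \<omega> * (t (Suc l) - t l) + g l \<omega> * (W (t (Suc l)) \<omega> - W (t l) \<omega>))" for j \<omega>
    have hsum: "(\<Sum>i<n. t (Suc i) - t i) = T"
      using t0 tn by (simp add: sum_lessThan_telescope)
    \<comment> \<open>On the refining grid the \<open>g\<close>-part of \<open>V\<close> telescopes
      to the simple integral \<open>J\<close>, so \<open>V - X\<close> consists of a Riemann sum
      error and \<open>J - I\<close>.\<close>
    have VX: "\<bar>V j \<omega> - X (t j) \<omega>\<bar> \<le> b * e" if \<omega>: "\<omega> \<in> G" and j: "j \<le> n" for j \<omega>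
    proof -
      have Jt: "(\<Sum>l<j. g l \<omega> * (W (t (Suc l)) \<omega> - W (t l) \<omega>)) = J (t j) \<omega>"
      proof -
        have "(\<Sum>l<j. g l \<omega> * (W (t (Suc l)) \<omega> - W (t l) \<omega>)) = (\<Sum>l<j. J (t (Suc l)) \<omega> - J (t l) \<omega>)"
          using grid1 j by (intro sum.cong) auto
        also have "\<dots> = J (t j) \<omega>"
          using simple_integral_0[OF sp, of k \<omega>] t0 sum_lessThan_telescope[of "\<lambda>l. J (t l) \<omega>" j] by (simp add: J_def)
        finally show ?thesis .
      qed
      have "\<bar>(\<Sum>l<j. \<mu> * X (t l) \<omega> * (t (Suc l) - t l)) - integral {0..t j} (\<lambda>s. \<mu> * X s \<omega>)\<bar> \<le> (\<bar>\<mu>\<bar> * e) * t j \<and> 0 \<le> t j"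
      proof (rule left_riemann_sum_bound[OF t0 ti _ _ j])
        show "continuous_on {0..} (\<lambda>s. \<mu> * X s \<omega>)"
          using Xc[of \<omega>] \<omega> by (intro continuous_intros) (auto simp: G_def)
        fix i s assume i: "i < n" and s: "s \<in> {t i..t (Suc i)}"
        have "\<bar>X (t i) \<omega> - X s \<omega>\<bar> \<le> e"
          using s tr[OF i] r(4) tT[of i] tT[of "Suc i"] i by (intro g3[OF \<omega>]) auto
        then show "\<bar>\<mu> * X (t i) \<omega> - \<mu> * X s \<omega>\<bar> \<le> \<bar>\<mu>\<bar> * e"
          by (simp add: right_diff_distrib[symmetric] abs_mult mult_left_mono)
      qed
      then have 1: "\<bar>(\<Sum>l<j. \<mu> * X (t l) \<omega> * (t (Suc l) - t l)) - integral {0..t j} (\<lambda>s. \<mu> * X s \<omega>)\<bar> \<le> (\<bar>\<mu>\<bar> * e) * t j" by blast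
      also have "\<dots> \<le> (\<bar>\<mu>\<bar> * e) * T"
        using tT[OF j] e(4) by (intro mult_left_mono) auto
      finally have 1: "\<bar>(\<Sum>l<j. \<mu> * X (t l) \<omega> * (t (Suc l) - t l)) - integral {0..t j} (\<lambda>s. \<mu> * X s \<omega>)\<bar> \<le> (\<bar>\<mu>\<bar> * e) * T" .
      have "V j \<omega> - X (t j) \<omega> = ((\<Sum>l<j. \<mu> * X (t l) \<omega> * (t (Suc l) - t l)) - integral {0..t j} (\<lambda>s. \<mu> * X s \<omega>)) + (J (t j) \<omega> - I (t j) \<omega>)"
        using g6[OF \<omega>, of "t j"] tT[OF j] t0 by (simp add: V_def sum.distrib Jt)
      moreover have "(\<bar>\<mu>\<bar> * e) * T + e = b * e"
        by (simp add: b_def algebra_simps)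
      ultimately show ?thesis
        using 1 g5[OF \<omega> tT[OF j]] by linarith
    qed
    have be: "0 \<le> b * e" using b e(4) by simp
    have RN: "(R (t i) \<omega>)\<^sup>2 \<le> N\<^sup>2" if "\<omega> \<in> G" "i < n" for i \<omega>
      using g1[OF that(1) tT[of i]] that by (intro power_mono) auto
    have t1: "(\<Sum>i<n. (R (t i) \<omega> * V i \<omega>)\<^sup>2 * (t (Suc i) - t i)\<^sup>2) \<le> \<delta>" if \<omega>: "\<omega> \<in> G" for \<omega>
    proof -
      have "(\<Sum>i<n. (R (t i) \<omega> * V i \<omega>)\<^sup>2 * (t (Suc i) - t i)\<^sup>2) \<le> (\<Sum>i<n. (N * (N + b * e))\<^sup>2 * (r * (t (Suc i) - t i)))"
      proof (intro sum_mono mult_mono)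
        fix i assume i: "i \<in> {..<n}"
        have "\<bar>V i \<omega>\<bar> \<le> N + b * e"
          using VX[OF \<omega>, of i] g1(1)[OF \<omega> tT[of i]] i by auto
        then have "\<bar>R (t i) \<omega> * V i \<omega>\<bar> \<le> N * (N + b * e)"
          using g1[OF \<omega> tT[of i]] i N unfolding abs_mult by (intro mult_mono) auto
        then have "\<bar>R (t i) \<omega> * V i \<omega>\<bar>\<^sup>2 \<le> (N * (N + b * e))\<^sup>2"
          by (intro power_mono) auto
        then show "(R (t i) \<omega> * V i \<omega>)\<^sup>2 \<le> (N * (N + b * e))\<^sup>2" by simp
        show "(t (Suc i) - t i)\<^sup>2 \<le> r * (t (Suc i) - t i)"
          using tr[of i] ti[of i] i unfolding power2_eq_square by (intro mult_right_mono) auto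
      qed auto
      also have "\<dots> = (N * (N + b * e))\<^sup>2 * r * T"
        unfolding sum_distrib_left[symmetric] hsum by simp
      finally show ?thesis using r(1) by simp
    qed
    have t3: "(\<Sum>i<n. (\<mu> * R (t i) \<omega> * (X (t i) \<omega> - V i \<omega>))\<^sup>2 * (t (Suc i) - t i)) \<le> \<delta>" if \<omega>: "\<omega> \<in> G" for \<omega>
    proof -
      have "(\<Sum>i<n. (\<mu> * R (t i) \<omega> * (X (t i) \<omega> - V i \<omega>))\<^sup>2 * (t (Suc i) - t i)) \<le> (\<Sum>i<n. (\<mu>\<^sup>2 * N\<^sup>2 * (b * e)\<^sup>2) * (t (Suc i) - t i))"
        unfolding power_mult_distrib[of _ "_ - _"] power_mult_distrib[of \<mu>]
      proof (intro sum_mono mult_mono)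
        fix i assume i: "i \<in> {..<n}"
        show "(R (t i) \<omega>)\<^sup>2 \<le> N\<^sup>2" using RN[OF \<omega>] i by auto
        have "\<bar>X (t i) \<omega> - V i \<omega>\<bar>\<^sup>2 \<le> (b * e)\<^sup>2"
          using VX[OF \<omega>, of i] i by (intro power_mono) (auto simp: abs_minus_commute)
        then show "(X (t i) \<omega> - V i \<omega>)\<^sup>2 \<le> (b * e)\<^sup>2" by simp
      qed (use ti in \<open>auto intro: less_imp_le\<close>)
      also have "\<dots> = \<mu>\<^sup>2 * N\<^sup>2 * (b * e)\<^sup>2 * T"
        unfolding sum_distrib_left[symmetric] hsum by simp
      finally show ?thesis using e(1) by simp
    qed
    have t2: "(\<Sum>i<n. (R (t i) \<omega> * (g i \<omega> - \<sigma> * V i \<omega>))\<^sup>2 * (t (Suc i) - t i)) \<le> \<delta>" if \<omega>: "\<omega> \<in> G" for \<omega>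
    proof -
      \<comment> \<open>The coefficient error is split through \<open>\<sigma> * X s\<close> and
        \<open>\<sigma> * X (t i)\<close>. The first part is small after integration over time, the
        other two uniformly; \<open>K\<close> collects the uniform parts.\<close>
      define K where "K = 3 * \<sigma>\<^sup>2 * e\<^sup>2 + 3 * \<sigma>\<^sup>2 * (b * e)\<^sup>2"
      have K: "0 \<le> K" by (simp add: K_def)
      have "\<omega> \<in> space M" using \<omega> by (simp add: G_def)
      have Hm: "(\<lambda>s. H s \<omega>) \<in> borel_measurable lborel"
        unfolding H_def simple_value_def by measurable
      have Xm: "(\<lambda>s. X s \<omega> * indicator {0..T} s) \<in> borel_measurable lborel"
      proof -
        have "continuous_on {0..T} (\<lambda>s. X s \<omega>)"
          using Xc[OF \<open>\<omega> \<in> space M\<close>] by (rule continuous_on_subset) auto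
        from borel_measurable_continuous_on_indicator[OF _ this] show ?thesis
          by (simp add: mult.commute)
      qed
      have eqi: "(\<lambda>s. ennreal ((H s \<omega> - \<sigma> * X s \<omega>)\<^sup>2) * indicator {0..T} s) =
          (\<lambda>s. ennreal ((H s \<omega> - \<sigma> * (X s \<omega> * indicator {0..T} s))\<^sup>2) * indicator {0..T} s)"
        by (auto simp: indicator_def)
      have dm [measurable]: "(\<lambda>s. ennreal ((H s \<omega> - \<sigma> * X s \<omega>)\<^sup>2) * indicator {0..T} s) \<in> borel_measurable lborel"
        unfolding eqi using Hm Xm by measurable
      define Q where "Q s = 3 * ennreal ((H s \<omega> - \<sigma> * X s \<omega>)\<^sup>2) + ennreal K" for s
      have Qi: "(\<lambda>s. Q s * indicator {0..T} s) = (\<lambda>s. 3 * (ennreal ((H s \<omega> - \<sigma> * X s \<omega>)\<^sup>2) * indicator {0..T} s) + ennreal K * indicator {0..T} s)"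
        by (auto simp: Q_def indicator_def)
      have "ennreal (\<Sum>i<n. (g i \<omega> - \<sigma> * V i \<omega>)\<^sup>2 * (t (Suc i) - t i)) \<le> (\<integral>\<^sup>+s\<in>{0..t n}. Q s \<partial>lborel)"
      proof (rule sum_le_nn_integral_grid[OF t0 ti])
        show "(\<lambda>s. Q s * indicator {0..t n} s) \<in> borel_measurable lborel"
          unfolding tn Qi by measurable
        fix i s assume i: "i < n" and s: "s \<in> {t i<..t (Suc i)}"
        have "g i \<omega> - \<sigma> * V i \<omega> = (H s \<omega> - \<sigma> * X s \<omega>) + \<sigma> * (X s \<omega> - X (t i) \<omega>) + \<sigma> * (X (t i) \<omega> - V i \<omega>)"
          using grid2[OF i s] by (simp add: algebra_simps)
        then have "(g i \<omega> - \<sigma> * V i \<omega>)\<^sup>2 \<le> 3 * (H s \<omega> - \<sigma> * X s \<omega>)\<^sup>2 + 3 * (\<sigma> * (X s \<omega> - X (t i) \<omega>))\<^sup>2 + 3 * (\<sigma> * (X (t i) \<omega> - V i \<omega>))\<^sup>2"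
          using square_three_terms by simp
        moreover have "(X s \<omega> - X (t i) \<omega>)\<^sup>2 \<le> e\<^sup>2"
        proof -
          have "\<bar>X s \<omega> - X (t i) \<omega>\<bar>\<^sup>2 \<le> e\<^sup>2"
            using s tr[OF i] r(4) tT[of i] tT[of "Suc i"] i by (intro power_mono g3[OF \<omega>]) auto
          then show ?thesis by simp
        qed
        moreover have "(X (t i) \<omega> - V i \<omega>)\<^sup>2 \<le> (b * e)\<^sup>2"
        proof -
          have "\<bar>X (t i) \<omega> - V i \<omega>\<bar>\<^sup>2 \<le> (b * e)\<^sup>2"
            using VX[OF \<omega>, of i] i by (intro power_mono) (auto simp: abs_minus_commute)
          then show ?thesis by simp
        qed
        ultimately have "(g i \<omega> - \<sigma> * V i \<omega>)\<^sup>2 \<le> 3 * (H s \<omega> - \<sigma> * X s \<omega>)\<^sup>2 +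
              3 * (\<sigma> * (X s \<omega> - X (t i) \<omega>))\<^sup>2 + 3 * (\<sigma> * (X (t i) \<omega> - V i \<omega>))\<^sup>2"
          and "\<sigma>\<^sup>2 * (X s \<omega> - X (t i) \<omega>)\<^sup>2 \<le> \<sigma>\<^sup>2 * e\<^sup>2"
          and "\<sigma>\<^sup>2 * (X (t i) \<omega> - V i \<omega>)\<^sup>2 \<le> \<sigma>\<^sup>2 * (b * e)\<^sup>2"
          by (auto intro: mult_left_mono)
        then have "(g i \<omega> - \<sigma> * V i \<omega>)\<^sup>2 \<le> 3 * (H s \<omega> - \<sigma> * X s \<omega>)\<^sup>2 + K"
          unfolding K_def power_mult_distrib[of \<sigma>] by simp
        then have "ennreal ((g i \<omega> - \<sigma> * V i \<omega>)\<^sup>2) \<le> ennreal (3 * (H s \<omega> - \<sigma> * X s \<omega>)\<^sup>2 + K)"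
          by (rule ennreal_leI)
        also have "\<dots> = Q s"
          using K by (simp add: Q_def ennreal_plus ennreal_mult)
        finally show "ennreal ((g i \<omega> - \<sigma> * V i \<omega>)\<^sup>2) \<le> Q s" .
      qed auto
      also have "\<dots> = 3 * (\<integral>\<^sup>+s\<in>{0..T}. ennreal ((H s \<omega> - \<sigma> * X s \<omega>)\<^sup>2) \<partial>lborel) + ennreal K * ennreal T"
        unfolding tn Qi using \<open>0 < T\<close> by (simp add: nn_integral_add nn_integral_cmult nn_integral_cmult_indicator)
      also have "\<dots> \<le> 3 * ennreal e + ennreal K * ennreal T"
        using g4[OF \<omega>] by (intro add_mono mult_left_mono) auto
      also have "\<dots> = ennreal (3 * e + K * T)"
        using e(4) K \<open>0 < T\<close> by (simp add: ennreal_mult ennreal_plus)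
      finally have s: "(\<Sum>i<n. (g i \<omega> - \<sigma> * V i \<omega>)\<^sup>2 * (t (Suc i) - t i)) \<le> 3 * e + K * T"
        using e(4) K \<open>0 < T\<close> by (subst (asm) ennreal_le_iff) auto
      have "(\<Sum>i<n. (R (t i) \<omega> * (g i \<omega> - \<sigma> * V i \<omega>))\<^sup>2 * (t (Suc i) - t i)) \<le> (\<Sum>i<n. N\<^sup>2 * ((g i \<omega> - \<sigma> * V i \<omega>)\<^sup>2 * (t (Suc i) - t i)))"
      proof (rule sum_mono)
        fix i assume i: "i \<in> {..<n}"
        have "(R (t i) \<omega>)\<^sup>2 * ((g i \<omega> - \<sigma> * V i \<omega>)\<^sup>2 * (t (Suc i) - t i)) \<le> N\<^sup>2 * ((g i \<omega> - \<sigma> * V i \<omega>)\<^sup>2 * (t (Suc i) - t i))"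
          using RN[OF \<omega>, of i] i ti[of i] by (intro mult_right_mono) auto
        then show "(R (t i) \<omega> * (g i \<omega> - \<sigma> * V i \<omega>))\<^sup>2 * (t (Suc i) - t i) \<le> N\<^sup>2 * ((g i \<omega> - \<sigma> * V i \<omega>)\<^sup>2 * (t (Suc i) - t i))"
          by (simp add: power_mult_distrib mult.assoc)
      qed
      also have "\<dots> \<le> N\<^sup>2 * (3 * e + K * T)"
        unfolding sum_distrib_left[symmetric] using s by (intro mult_left_mono) auto
      finally show ?thesis using e(2) by (simp add: K_def)
    qed
    let ?S = "{\<omega>\<in>space M. 3 * \<epsilon> \<le> \<bar>V n \<omega> * R (t n) \<omega> - X (t 0) \<omega> * R (t 0) \<omega>\<bar>}"
    have XtF: "X (t i) \<in> borel_measurable (F (t i))" if "i \<le> n" for i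
      using XF tT[OF that] by simp
    have r': "r \<le> 1" "\<bar>\<sigma>\<^sup>2 - \<mu>\<bar> * r \<le> 1" "\<bar>3 * \<sigma>\<^sup>2 - 2 * \<mu>\<bar> * r \<le> 1"
      using r by auto
    have es: "prob ?S \<le> 3 * (prob (space M - G) + (2 * C + 2 * C\<^sup>2 * t n) * \<delta> / \<epsilon>\<^sup>2)" "?S \<in> events"
      unfolding C_def R_def V_def
      by (rule euler_scheme_bound[where n=n and r=r and G=G and \<delta>=\<delta>];
          use t0 ti tr r' XtF gF \<delta> \<open>0 < \<epsilon>\<close> Gev t1 t2 t3 in \<open>unfold R_def V_def, blast\<close>)+
    have "prob ?S \<le> 3 * (prob (space M - G) + (2 * C + 2 * C\<^sup>2 * t n) * \<delta> / \<epsilon>\<^sup>2)"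
      by (rule es(1))
    also have "\<dots> = 3 * (prob B + \<eta>)"
      using C' \<open>0 < \<epsilon>\<close> unfolding tn C'_def[symmetric] GB by (simp add: \<delta>_def)
    finally have pS: "prob ?S \<le> 18 * \<eta>"
      using pB by simp
    have Sev: "?S \<in> events"
      by (rule es(2))
    \<comment> \<open>\<open>3 * \<epsilon>\<close> is the threshold of the scheme estimate; the
      fourth \<open>\<epsilon>\<close> pays for replacing \<open>V n\<close> by
      \<open>X T\<close>.\<close>
    have "?E \<subseteq> ?S \<union> B"
    proof
      fix \<omega> assume \<omega>: "\<omega> \<in> ?E"
      show "\<omega> \<in> ?S \<union> B"
      proof (cases "\<omega> \<in> B")
        case False
        then have G: "\<omega> \<in> G" using \<omega> by (simp add: G_def)
        have "\<bar>(V n \<omega> - X T \<omega>) * R T \<omega>\<bar> \<le> (b * e) * N"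
          using VX[OF G, of n] g1[OF G, of T] tn \<open>0 < T\<close> be unfolding abs_mult by (intro mult_mono) auto
        then have "\<bar>V n \<omega> * R T \<omega> - X T \<omega> * R T \<omega>\<bar> \<le> \<epsilon>"
          using e(3) mult.commute[of N "b * e"] unfolding left_diff_distrib[symmetric] by linarith
        then have "3 * \<epsilon> \<le> \<bar>V n \<omega> * R T \<omega> - X 0 \<omega> * R 0 \<omega>\<bar>"
          using \<omega> by auto
        then show ?thesis using \<omega> tn t0 by simp
      qed simp
    qed
    then have "prob ?E \<le> prob (?S \<union> B)"
      using Sev Bev by (intro finite_measure_mono) auto
    also have "\<dots> \<le> prob ?S + prob B"
      using Sev Bev by (rule measure_Un_le)
    finally show ?thesis
      using pS pB that by simp
  qed
  have "prob ?E \<le> 0 + x" if "0 < x" for x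
    using bound[of "x / 27"] that by simp
  then have "prob ?E \<le> 0"
    by (rule field_le_epsilon)
  then show ?thesis
    using measure_nonneg[of M ?E] by linarith
qed

lemma gbm_explicit_at:
  assumes sde: "sde_solution M F W (\<lambda>x. \<mu> * x) (\<lambda>x. \<sigma> * x) x0 X" and "0 < T"
  shows "AE \<omega> in M. X T \<omega> = x0 * exp (\<sigma> * (W T \<omega> - W 0 \<omega>) + (\<mu> - \<sigma>\<^sup>2 / 2) * T)"
proof -
  define R where "R t \<omega> = exp (- \<sigma> * W t \<omega> + (\<sigma>\<^sup>2 / 2 - \<mu>) * t)" for t \<omega>
  define Z where "Z \<omega> = \<bar>X T \<omega> * R T \<omega> - X 0 \<omega> * R 0 \<omega>\<bar>" for \<omega>
  have XM: "X t \<in> borel_measurable M" if "0 \<le> t" for t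
    using sde that measurable_F_M by (auto simp: sde_solution_def)
  have Zm [measurable]: "Z \<in> borel_measurable M"
    unfolding Z_def R_def using XM[of T] XM[of 0] W_measurable[of T] W_measurable[of 0] \<open>0 < T\<close> by simp
  have "AE \<omega> in M. Z \<omega> < 4 * (1 / Suc k)" for k
  proof -
    have "prob {\<omega> \<in> space M. 4 * (1 / Suc k) \<le> Z \<omega>} = 0"
      using gbm_reciprocal_tail_zero[OF sde \<open>0 < T\<close>, of "1 / Suc k"] by (simp add: Z_def R_def)
    moreover have "{\<omega> \<in> space M. 4 * (1 / Suc k) \<le> Z \<omega>} \<in> events" by measurable
    ultimately have "{\<omega> \<in> space M. 4 * (1 / Suc k) \<le> Z \<omega>} \<in> null_sets M"
      by (simp add: null_sets_def emeasure_eq_measure)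
    then show ?thesis
      by (rule AE_I') (auto simp: not_less)
  qed
  then have "AE \<omega> in M. \<forall>k. Z \<omega> < 4 * (1 / Suc k)"
    by (simp add: AE_all_countable)
  moreover have "AE \<omega> in M. X 0 \<omega> = x0"
    using sde by (simp add: sde_solution_def)
  ultimately show ?thesis
  proof eventually_elim
    case (elim \<omega>)
    have "Z \<omega> \<le> 0"
    proof (rule ccontr)
      assume "\<not> Z \<omega> \<le> 0"
      then obtain k :: nat where "1 / Suc k < Z \<omega> / 4"
        using nat_approx_posE[of "Z \<omega> / 4"] by (metis divide_pos_pos not_le zero_less_numeral)
      then show False using elim(1)[rule_format, of k] by simp
    qed
    then have "X T \<omega> * R T \<omega> = x0 * R 0 \<omega>"
      using elim(2) by (simp add: Z_def)
    then have "X T \<omega> = x0 * (R 0 \<omega> * inverse (R T \<omega>))"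
      by (simp add: R_def field_simps)
    also have "R 0 \<omega> * inverse (R T \<omega>) = exp (\<sigma> * (W T \<omega> - W 0 \<omega>) + (\<mu> - \<sigma>\<^sup>2 / 2) * T)"
      unfolding R_def exp_minus[symmetric] exp_add[symmetric] by (simp add: algebra_simps)
    finally show ?case .
  qed
qed

lemma gbm_explicit:
  assumes sde: "sde_solution M F W (\<lambda>x. \<mu> * x) (\<lambda>x. \<sigma> * x) x0 X" and "0 < T"
  shows "AE \<omega> in M. \<forall>t\<in>{0..T}. X t \<omega> = x0 * exp (\<sigma> * (W t \<omega> - W 0 \<omega>) + (\<mu> - \<sigma>\<^sup>2 / 2) * t)"
proof -
  define E where "E t \<omega> = x0 * exp (\<sigma> * (W t \<omega> - W 0 \<omega>) + (\<mu> - \<sigma>\<^sup>2 / 2) * t)" for t \<omega>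
  have X0: "AE \<omega> in M. X 0 \<omega> = x0" and Xc: "\<And>\<omega>. \<omega> \<in> space M \<Longrightarrow> continuous_on {0..} (\<lambda>t. X t \<omega>)"
    using sde by (auto simp: sde_solution_def)
  have "AE \<omega> in M. X q \<omega> = E q \<omega>" if "q \<in> \<rat> \<inter> {0..T}" for q
    using that gbm_explicit_at[OF sde, of q] X0 by (cases "q = 0") (auto simp: E_def)
  moreover have "countable (\<rat> \<inter> {0..T})" using countable_rat by blast
  ultimately have "AE \<omega> in M. \<forall>q\<in>\<rat> \<inter> {0..T}. X q \<omega> = E q \<omega>"
    by (simp add: AE_ball_countable)
  then have "AE \<omega> in M. \<forall>t\<in>{0..T}. X t \<omega> = E t \<omega>"
    using AE_space
  proof eventually_elim
    case (elim \<omega>)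
    have "continuous_on {0..T} (\<lambda>t. W t \<omega>)" "continuous_on {0..T} (\<lambda>t. X t \<omega>)"
      using Xc[of \<omega>] continuous_paths[of \<omega>] elim(2) by (auto elim: continuous_on_subset)
    then have "continuous_on {0..T} (\<lambda>t. \<bar>X t \<omega> - E t \<omega>\<bar>)"
      unfolding E_def by (intro continuous_intros)
    then have "\<bar>X t \<omega> - E t \<omega>\<bar> \<le> 0" if "t \<in> {0..T}" for t
      using le_on_rationals_imp_le[OF \<open>0 < T\<close>, of "\<lambda>t. \<bar>X t \<omega> - E t \<omega>\<bar>" UNIV 0 t] elim(1) that by auto
    then show ?case by force
  qed
  then show ?thesis by (simp add: E_def)
qed

end

section \<open>Exponential moments on the barrier event\<close>

text \<open>The probability that a standard normal exceeds 1, equivalently that a Brownian increment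
  exceeds its own standard deviation. It does not depend on the length of the time interval, so it
  bounds from below the chance of ending above a level after a first passage at any time.\<close>

definition normal_tail_one :: real where
  "normal_tail_one = (\<integral>x. std_normal_density x * indicator {1..} x \<partial>lborel)"

lemma normal_tail_one_nn_integral:
  "(\<integral>\<^sup>+x. ennreal (std_normal_density x) * indicator {1..} x \<partial>lborel) = ennreal normal_tail_one"
proof -
  have i: "integrable lborel (\<lambda>x. std_normal_density x * indicator {1..} x)"
    by (intro integrable_real_mult_indicator) auto
  have "(\<integral>\<^sup>+x. ennreal (std_normal_density x * indicator {1..} x) \<partial>lborel) = ennreal normal_tail_one"
    unfolding normal_tail_one_def by (rule nn_integral_eq_integral[OF i]) auto
  then show ?thesis
    by (simp add: ennreal_mult' ennreal_indicator)
qed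

lemma normal_tail_one_pos: "0 < normal_tail_one"
proof -
  have "\<not> (AE x in lborel. ennreal (std_normal_density x) * indicator {1..} x = 0)"
  proof
    assume "AE x in lborel. ennreal (std_normal_density x) * indicator {1..} x = 0"
    then have "AE x in lborel. x \<notin> {1..2::real}"
      by eventually_elim (auto simp: indicator_def normal_density_def split: if_splits)
    then have "{1..2::real} \<in> null_sets lborel"
      by (subst AE_iff_null_sets) auto
    then show False by (simp add: null_sets_def)
  qed
  then have "(\<integral>\<^sup>+x. ennreal (std_normal_density x) * indicator {1..} x \<partial>lborel) \<noteq> 0"
    by (subst nn_integral_0_iff_AE) auto
  then show ?thesis
    unfolding normal_tail_one_nn_integral by (simp add: ennreal_eq_0_iff)
qed

lemma normal_tail_scaled:
  assumes "0 < h" "s = 1 \<or> s = -1"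
  shows "(\<integral>\<^sup>+x. ennreal (normal_density 0 (sqrt h) x) * indicator {x. sqrt h \<le> s * x} x \<partial>lborel) = ennreal normal_tail_one"
proof -
  have s: "s * sqrt h \<noteq> 0" "s * s = 1" "\<bar>s\<bar> = 1" using assms by auto
  have m: "(\<lambda>x. ennreal (normal_density 0 (sqrt h) x) * indicator {x. sqrt h \<le> s * x} x) \<in> borel_measurable borel"
    by measurable
  have "(\<integral>\<^sup>+x. ennreal (normal_density 0 (sqrt h) x) * indicator {x. sqrt h \<le> s * x} x \<partial>lborel) =
    ennreal \<bar>s * sqrt h\<bar> * (\<integral>\<^sup>+x. ennreal (normal_density 0 (sqrt h) (0 + (s * sqrt h) * x)) * indicator {x. sqrt h \<le> s * x} (0 + (s * sqrt h) * x) \<partial>lborel)"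
    by (rule nn_integral_real_affine[OF m s(1)])
  also have "\<dots> = (\<integral>\<^sup>+x. ennreal \<bar>s * sqrt h\<bar> * (ennreal (normal_density 0 (sqrt h) (0 + (s * sqrt h) * x)) * indicator {x. sqrt h \<le> s * x} (0 + (s * sqrt h) * x)) \<partial>lborel)"
    by (rule nn_integral_cmult[symmetric]) measurable
  also have "\<dots> = (\<integral>\<^sup>+x. ennreal (std_normal_density x) * indicator {1..} x \<partial>lborel)"
  proof (intro nn_integral_cong)
    fix x
    have "\<bar>s * sqrt h\<bar> * normal_density 0 (sqrt h) (s * sqrt h * x) = std_normal_density x"
      using assms s by (auto simp: normal_density_def abs_mult power_mult_distrib real_sqrt_mult field_simps)
    then have 1: "ennreal \<bar>s * sqrt h\<bar> * ennreal (normal_density 0 (sqrt h) (s * sqrt h * x)) = ennreal (std_normal_density x)"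
      by (simp add: ennreal_mult[symmetric])
    have "(sqrt h \<le> s * (s * sqrt h * x)) = (1 \<le> x)"
      using assms by (elim disjE) auto
    then have 2: "indicator {x. sqrt h \<le> s * x} (s * sqrt h * x) = (indicator {1..} x :: ennreal)"
      by (simp add: indicator_def)
    show "ennreal \<bar>s * sqrt h\<bar> * (ennreal (normal_density 0 (sqrt h) (0 + (s * sqrt h) * x)) * indicator {x. sqrt h \<le> s * x} (0 + (s * sqrt h) * x)) =
      ennreal (std_normal_density x) * indicator {1..} x"
      unfolding add_0 mult.assoc[symmetric] 1 2 ..
  qed
  finally show ?thesis
    using normal_tail_one_nn_integral by simp
qed

lemma nn_integral_normal_density: "0 < h \<Longrightarrow> (\<integral>\<^sup>+x. ennreal (normal_density m (sqrt h) x) \<partial>lborel) = 1"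
  by (subst nn_integral_eq_integral) auto

lemma nn_integral_normal_exp:
  assumes "0 < h"
  shows "(\<integral>\<^sup>+x. ennreal (normal_density 0 (sqrt h) x) * ennreal (exp (s * x)) \<partial>lborel) = ennreal (exp (s\<^sup>2 * h / 2))"
proof -
  have "(\<integral>\<^sup>+x. ennreal (normal_density 0 (sqrt h) x) * ennreal (exp (s * x)) \<partial>lborel) =
      (\<integral>\<^sup>+x. ennreal (exp (s\<^sup>2 * h / 2)) * ennreal (normal_density (s * h) (sqrt h) x) \<partial>lborel)"
    by (simp add: ennreal_mult[symmetric] normal_density_exp[OF assms])
  also have "\<dots> = ennreal (exp (s\<^sup>2 * h / 2))"
    using nn_integral_normal_density[OF assms] by (simp add: nn_integral_cmult)
  finally show ?thesis .
qed

text \<open>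
  With \<open>s = \<alpha> + z\<close>, substituting \<open>z = 2 y\<close> turns the exponential weight into a bounded factor: the quadratic
  term gained from the Gaussian density absorbs every linear term once \<open>\<alpha>\<close> is bounded below.
\<close>

lemma normal_overshoot_exp_moment:
  assumes T: "0 < T" and \<alpha>: "- sqrt T \<le> \<alpha>" and \<beta>: "0 \<le> \<beta>"
  shows "(\<integral>\<^sup>+y. ennreal (normal_density 0 (sqrt T) y) * (ennreal (exp (\<beta> * (y - \<alpha>) / sqrt T)) * indicator {\<alpha>..} y) \<partial>lborel)
    \<le> ennreal (2 * exp ((2 * \<beta> + 1)\<^sup>2 / 6)) * (\<integral>\<^sup>+y. ennreal (normal_density 0 (sqrt T) y) * indicator {\<alpha>..} y \<partial>lborel)"
proof -
  let ?\<phi> = "normal_density 0 (sqrt T)" and ?C = "exp ((2 * \<beta> + 1)\<^sup>2 / 6)"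
  have "(\<integral>\<^sup>+y. ennreal (?\<phi> y) * (ennreal (exp (\<beta> * (y - \<alpha>) / sqrt T)) * indicator {\<alpha>..} y) \<partial>lborel) =
    ennreal \<bar>2\<bar> * (\<integral>\<^sup>+y. ennreal (?\<phi> (\<alpha> + 2 * y)) * (ennreal (exp (\<beta> * (\<alpha> + 2 * y - \<alpha>) / sqrt T)) * indicator {\<alpha>..} (\<alpha> + 2 * y)) \<partial>lborel)"
    by (rule nn_integral_real_affine) auto
  also have "\<dots> \<le> ennreal \<bar>2\<bar> * (\<integral>\<^sup>+y. ennreal ?C * (ennreal (?\<phi> (\<alpha> + 1 * y)) * indicator {\<alpha>..} (\<alpha> + 1 * y)) \<partial>lborel)"
  proof (intro mult_left_mono nn_integral_mono)
    fix y
    show "ennreal (?\<phi> (\<alpha> + 2 * y)) * (ennreal (exp (\<beta> * (\<alpha> + 2 * y - \<alpha>) / sqrt T)) * indicator {\<alpha>..} (\<alpha> + 2 * y)) \<le>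
      ennreal ?C * (ennreal (?\<phi> (\<alpha> + 1 * y)) * indicator {\<alpha>..} (\<alpha> + 1 * y))"
    proof (cases "0 \<le> y")
      case True
      define z where "z = y / sqrt T"
      have y: "y = z * sqrt T" and z: "0 \<le> z" using T True by (auto simp: z_def)
      have T': "sqrt T * sqrt T = T" using T by simp
      have sq: "(\<alpha> + 2 * y)\<^sup>2 = (\<alpha> + y)\<^sup>2 + 2 * \<alpha> * y + 3 * y\<^sup>2"
        by (simp add: power2_eq_square algebra_simps)
      have "- (2 * \<alpha> * y) \<le> 2 * sqrt T * y"
        using mult_right_mono[OF \<alpha> True] by (simp add: algebra_simps)
      also have "\<dots> = 2 * T * z"
        unfolding y using T' by (simp add: mult_ac)
      finally have "- (2 * \<alpha> * y) \<le> 2 * T * z" .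
      moreover have "y\<^sup>2 = T * z\<^sup>2"
        unfolding y using T by (simp add: power_mult_distrib)
      ultimately have "- (2 * \<alpha> * y + 3 * y\<^sup>2) \<le> (2 * T) * (z - 3 / 2 * z\<^sup>2)"
        by (simp add: algebra_simps)
      then have 1: "- (2 * \<alpha> * y + 3 * y\<^sup>2) / (2 * T) \<le> z - 3 / 2 * z\<^sup>2"
        using T by (simp add: pos_divide_le_eq mult.commute)
      \<comment> \<open>Completing the square:
        \<open>(2 * \<beta> + 1) * z - 3 / 2 * z\<^sup>2\<close> has its maximum at
        \<open>z = (2 * \<beta> + 1) / 3\<close>, and this maximum is the exponent in the constant.
        The factor 2 in front of the constant is the Jacobian of the substitution.\<close>
      have "0 \<le> (3 * z - (2 * \<beta> + 1))\<^sup>2 / 6" by simp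
      then have 2: "(2 * \<beta> + 1) * z - 3 / 2 * z\<^sup>2 \<le> (2 * \<beta> + 1)\<^sup>2 / 6"
        by (simp add: power2_eq_square algebra_simps)
      have 3: "\<beta> * (\<alpha> + 2 * y - \<alpha>) / sqrt T = 2 * \<beta> * z"
        by (simp add: z_def)
      have "- (\<alpha> + 2 * y)\<^sup>2 / (2 * T) = - (\<alpha> + y)\<^sup>2 / (2 * T) + - (2 * \<alpha> * y + 3 * y\<^sup>2) / (2 * T)"
        unfolding sq add_divide_distrib[symmetric] by (simp add: algebra_simps)
      then have 4: "- (\<alpha> + 2 * y)\<^sup>2 / (2 * T) + \<beta> * (\<alpha> + 2 * y - \<alpha>) / sqrt T \<le> - (\<alpha> + y)\<^sup>2 / (2 * T) + (2 * \<beta> + 1)\<^sup>2 / 6"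
        using 1 2 distrib_right[of "2 * \<beta>" 1 z] unfolding 3 by linarith
      have "?\<phi> (\<alpha> + 2 * y) * exp (\<beta> * (\<alpha> + 2 * y - \<alpha>) / sqrt T) =
          1 / sqrt (2 * pi * T) * exp (- (\<alpha> + 2 * y)\<^sup>2 / (2 * T) + \<beta> * (\<alpha> + 2 * y - \<alpha>) / sqrt T)"
        using T by (simp add: normal_density_def exp_add[symmetric])
      also have "\<dots> \<le> 1 / sqrt (2 * pi * T) * exp (- (\<alpha> + y)\<^sup>2 / (2 * T) + (2 * \<beta> + 1)\<^sup>2 / 6)"
        using 4 T by (intro mult_left_mono) auto
      also have "\<dots> = ?C * ?\<phi> (\<alpha> + 1 * y)"
        using T by (simp add: normal_density_def exp_add[symmetric])
      finally have "ennreal (?\<phi> (\<alpha> + 2 * y) * exp (\<beta> * (\<alpha> + 2 * y - \<alpha>) / sqrt T)) \<le> ennreal (?C * ?\<phi> (\<alpha> + 1 * y))"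
        by (rule ennreal_leI)
      then show ?thesis
        using True by (simp add: ennreal_mult)
    qed (auto simp: indicator_def)
  qed auto
  also have "\<dots> = ennreal 2 * ennreal ?C * (\<integral>\<^sup>+y. ennreal (?\<phi> (\<alpha> + 1 * y)) * indicator {\<alpha>..} (\<alpha> + 1 * y) \<partial>lborel)"
    by (subst nn_integral_cmult) (auto simp: mult.assoc)
  also have "(\<integral>\<^sup>+y. ennreal (?\<phi> (\<alpha> + 1 * y)) * indicator {\<alpha>..} (\<alpha> + 1 * y) \<partial>lborel) =
      (\<integral>\<^sup>+y. ennreal (?\<phi> y) * indicator {\<alpha>..} y \<partial>lborel)"
    using nn_integral_real_affine[of "\<lambda>y. ennreal (?\<phi> y) * indicator {\<alpha>..} y" 1 \<alpha>] by simp
  finally show ?thesis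
    by (simp add: ennreal_mult)
qed

text \<open>
  For independent centred normals with variances \<open>A\<close> and \<open>B\<close>, the sum \<open>u\<close> is independent of the
  bridge coordinate \<open>v = s - A / (A + B) u\<close>.
\<close>

lemma normal_bridge_change_of_variables:
  fixes K :: "real \<times> real \<Rightarrow> ennreal"
  assumes A: "0 < A" and B: "0 < B" and K [measurable]: "K \<in> borel_measurable (borel \<Otimes>\<^sub>M borel)"
  shows "(\<integral>\<^sup>+s. ennreal (normal_density 0 (sqrt A) s) *
      (\<integral>\<^sup>+x. ennreal (normal_density 0 (sqrt B) x) * K (s - A / (A + B) * (s + x), s + x) \<partial>lborel) \<partial>lborel) =
    (\<integral>\<^sup>+u. ennreal (normal_density 0 (sqrt (A + B)) u) *
      (\<integral>\<^sup>+v. ennreal (normal_density 0 (sqrt (A * B / (A + B))) v) * K (v, u) \<partial>lborel) \<partial>lborel)"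
proof -
  define \<tau> where "\<tau> = A / (A + B)"
  let ?a = "\<lambda>s. ennreal (normal_density 0 (sqrt A) s)" and ?b = "\<lambda>x. ennreal (normal_density 0 (sqrt B) x)"
  let ?c = "\<lambda>u. ennreal (normal_density 0 (sqrt (A + B)) u)" and ?d = "\<lambda>v. ennreal (normal_density 0 (sqrt (A * B / (A + B))) v)"
  have dens: "?a (\<tau> * u + v) * ?b (u - (\<tau> * u + v)) = ?c u * ?d v" for u v
  proof -
    let ?s = "\<tau> * u + v"
    have AB: "0 < A + B" "0 < A * B" using A B by auto
    have q: "?s\<^sup>2 / (2 * A) + (u - ?s)\<^sup>2 / (2 * B) = u\<^sup>2 / (2 * (A + B)) + v\<^sup>2 / (2 * (A * B / (A + B)))"
    proof -
      have s: "?s = (A * u + (A + B) * v) / (A + B)" "u - ?s = (B * u - (A + B) * v) / (A + B)"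
        using AB by (auto simp: \<tau>_def field_simps)
      show ?thesis
        unfolding s using A B AB by (simp add: power2_eq_square divide_simps) algebra
    qed
    have c: "sqrt (2 * pi * A) * sqrt (2 * pi * B) = sqrt (2 * pi * (A + B)) * sqrt (2 * pi * (A * B / (A + B)))"
      unfolding real_sqrt_mult[symmetric] using AB by simp
    have nd: "normal_density 0 (sqrt c) x = 1 / sqrt (2 * pi * c) * exp (- (x\<^sup>2 / (2 * c)))" if "0 < c" for c x
      using that by (simp add: normal_density_def)
    have two: "(1 / p * exp (- x)) * (1 / q * exp (- y)) = 1 / (p * q) * exp (- (x + y))" for p q x y :: real
      by (simp add: exp_add[symmetric])
    have "normal_density 0 (sqrt A) ?s * normal_density 0 (sqrt B) (u - ?s) =
        normal_density 0 (sqrt (A + B)) u * normal_density 0 (sqrt (A * B / (A + B))) v"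
      unfolding nd[OF A] nd[OF B] nd[OF AB(1)] nd[OF divide_pos_pos[OF AB(2,1)]] two q c ..
    then show ?thesis
      by (simp add: ennreal_mult[symmetric])
  qed
  have "(\<integral>\<^sup>+s. ?a s * (\<integral>\<^sup>+x. ?b x * K (s - \<tau> * (s + x), s + x) \<partial>lborel) \<partial>lborel) =
      (\<integral>\<^sup>+s. (\<integral>\<^sup>+u. ?a s * (?b (u - s) * K (s - \<tau> * u, u)) \<partial>lborel) \<partial>lborel)"
  proof (intro nn_integral_cong)
    fix s :: real
    have "(\<integral>\<^sup>+x. ?b x * K (s - \<tau> * (s + x), s + x) \<partial>lborel) = (\<integral>\<^sup>+u. ?b (u - s) * K (s - \<tau> * u, u) \<partial>lborel)"
      using nn_integral_real_affine[of "\<lambda>x. ?b x * K (s - \<tau> * (s + x), s + x)" 1 "- s"]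
      by (simp add: algebra_simps)
    then show "?a s * (\<integral>\<^sup>+x. ?b x * K (s - \<tau> * (s + x), s + x) \<partial>lborel) = (\<integral>\<^sup>+u. ?a s * (?b (u - s) * K (s - \<tau> * u, u)) \<partial>lborel)"
      by (simp add: nn_integral_cmult)
  qed
  also have "\<dots> = (\<integral>\<^sup>+u. (\<integral>\<^sup>+s. ?a s * (?b (u - s) * K (s - \<tau> * u, u)) \<partial>lborel) \<partial>lborel)"
    by (rule lborel_pair.Fubini') measurable
  also have "\<dots> = (\<integral>\<^sup>+u. ?c u * (\<integral>\<^sup>+v. ?d v * K (v, u) \<partial>lborel) \<partial>lborel)"
  proof (intro nn_integral_cong)
    fix u :: real
    have "(\<integral>\<^sup>+s. ?a s * (?b (u - s) * K (s - \<tau> * u, u)) \<partial>lborel) =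
        (\<integral>\<^sup>+v. ?a (\<tau> * u + v) * (?b (u - (\<tau> * u + v)) * K (v, u)) \<partial>lborel)"
      using nn_integral_real_affine[of "\<lambda>s. ?a s * (?b (u - s) * K (s - \<tau> * u, u))" 1 "\<tau> * u"] by simp
    also have "\<dots> = (\<integral>\<^sup>+v. ?c u * (?d v * K (v, u)) \<partial>lborel)"
      by (simp only: mult.assoc[symmetric] dens)
    finally show "(\<integral>\<^sup>+s. ?a s * (?b (u - s) * K (s - \<tau> * u, u)) \<partial>lborel) = ?c u * (\<integral>\<^sup>+v. ?d v * K (v, u) \<partial>lborel)"
      by (simp add: nn_integral_cmult)
  qed
  finally show ?thesis
    unfolding \<tau>_def .
qed

text \<open>A geometric series over the levels \<open>m * sqrt T\<close>: a factor 2 for the two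
  signs, \<open>1 / normal_tail_one\<close> from the first passage, and weights
  \<open>exp (\<kappa> * (m + 1))\<close> against tails
  \<open>exp (2 * \<kappa>\<^sup>2 - 2 * \<kappa> * m)\<close>. The added 1 makes the constant at
  least 1, which covers a time interval of length zero.\<close>

definition maximal_const :: "real \<Rightarrow> real" where
  "maximal_const \<kappa> = 2 / normal_tail_one * exp (2 * \<kappa>\<^sup>2 + \<kappa>) / (1 - exp (- \<kappa>)) + 1"

lemma maximal_const_ge_1:
  assumes "0 < \<kappa>"
  shows "1 \<le> maximal_const \<kappa>"
  using assms normal_tail_one_pos by (simp add: maximal_const_def)

lemma normal_tail_one_le_1: "normal_tail_one \<le> 1"
proof -
  have "ennreal normal_tail_one \<le> (\<integral>\<^sup>+x. ennreal (std_normal_density x) \<partial>lborel)"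
    unfolding normal_tail_one_nn_integral[symmetric] by (intro nn_integral_mono) (auto simp: indicator_def)
  also have "\<dots> = 1" using nn_integral_normal_density[of 1 0] by simp
  finally show ?thesis by simp
qed

section \<open>Maximal inequalities by first passage\<close>

context brownian_motion
begin

text \<open>Splitting the event by the first \<open>j\<close> with \<open>P j\<close> gives disjoint
  sets, each decided at time \<open>t j\<close>, so it suffices to compare \<open>L\<close> and
  \<open>U\<close> on past events where \<open>P j\<close> holds. On a grid this takes the place of
  the strong Markov property.\<close>

lemma first_passage_comparison:
  fixes t :: "nat \<Rightarrow> real" and L U :: "'a \<Rightarrow> ennreal"
  assumes mono: "\<And>i j. i \<le> j \<Longrightarrow> j \<le> n \<Longrightarrow> t i \<le> t j"
    and P: "\<And>j. k \<le> j \<Longrightarrow> j \<le> n \<Longrightarrow> {\<omega>\<in>space M. P j \<omega>} \<in> sets (F (t j))"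
    and L [measurable]: "L \<in> borel_measurable M" and U [measurable]: "U \<in> borel_measurable M"
    and step: "\<And>j A. k \<le> j \<Longrightarrow> j \<le> n \<Longrightarrow> A \<in> sets (F (t j)) \<Longrightarrow> (\<And>\<omega>. \<omega> \<in> A \<Longrightarrow> P j \<omega>) \<Longrightarrow>
      (\<integral>\<^sup>+\<omega>\<in>A. L \<omega> \<partial>M) \<le> (\<integral>\<^sup>+\<omega>\<in>A. U \<omega> \<partial>M)"
  shows "(\<integral>\<^sup>+\<omega>\<in>{\<omega>\<in>space M. \<exists>j\<in>{k..n}. P j \<omega>}. L \<omega> \<partial>M) \<le> (\<integral>\<^sup>+\<omega>. U \<omega> \<partial>M)"
proof -
  define A where "A j = {\<omega>\<in>space M. P j \<omega>} - (\<Union>i\<in>{k..<j}. {\<omega>\<in>space M. P i \<omega>})" for j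
  have AF: "A j \<in> sets (F (t j))" if "k \<le> j" "j \<le> n" for j
  proof -
    have "{\<omega>\<in>space M. P i \<omega>} \<in> sets (F (t j))" if "i \<in> {k..<j}" for i
      using P[of i] sets_F_mono[OF mono[of i j]] that \<open>j \<le> n\<close> by auto
    then show ?thesis
      unfolding A_def using P[OF that] by auto
  qed
  have AM [measurable]: "A j \<in> events" if "j \<in> {k..n}" for j
    using AF[of j] sets_F_subset that by auto
  have un: "{\<omega>\<in>space M. \<exists>j\<in>{k..n}. P j \<omega>} = (\<Union>j\<in>{k..n}. A j)"
  proof (intro equalityI subsetI)
    fix \<omega> assume "\<omega> \<in> {\<omega>\<in>space M. \<exists>j\<in>{k..n}. P j \<omega>}"
    then obtain j where j: "\<omega> \<in> space M" "j \<in> {k..n}" "P j \<omega>" by blast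
    define i where "i = (LEAST i. k \<le> i \<and> P i \<omega>)"
    have i: "k \<le> i" "P i \<omega>"
      using LeastI[of "\<lambda>i. k \<le> i \<and> P i \<omega>" j] j by (auto simp: i_def)
    have "i \<le> j"
      using Least_le[of "\<lambda>i. k \<le> i \<and> P i \<omega>" j] j by (auto simp: i_def)
    moreover have "\<not> P l \<omega>" if "l \<in> {k..<i}" for l
      using not_less_Least[of l "\<lambda>i. k \<le> i \<and> P i \<omega>"] that by (auto simp: i_def)
    ultimately show "\<omega> \<in> (\<Union>j\<in>{k..n}. A j)"
      using i j by (auto simp: A_def intro!: bexI[of _ i])
  qed (auto simp: A_def)
  have dis: "indicator (\<Union>j\<in>{k..n}. A j) \<omega> = (\<Sum>j\<in>{k..n}. indicator (A j) \<omega> :: ennreal)" for \<omega>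
  proof (rule indicator_UN_disjoint)
    show "disjoint_family_on A {k..n}"
      unfolding disjoint_family_on_def
    proof (intro ballI impI)
      fix i j assume "i \<in> {k..n}" "j \<in> {k..n}" "i \<noteq> j"
      then show "A i \<inter> A j = {}"
        by (cases "i < j") (auto simp: A_def)
    qed
  qed simp
  have "(\<integral>\<^sup>+\<omega>\<in>{\<omega>\<in>space M. \<exists>j\<in>{k..n}. P j \<omega>}. L \<omega> \<partial>M) = (\<Sum>j\<in>{k..n}. \<integral>\<^sup>+\<omega>\<in>A j. L \<omega> \<partial>M)"
    unfolding un dis sum_distrib_left by (intro nn_integral_sum) auto
  also have "\<dots> \<le> (\<Sum>j\<in>{k..n}. \<integral>\<^sup>+\<omega>\<in>A j. U \<omega> \<partial>M)"
    using AF by (intro sum_mono step) (auto simp: A_def)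
  also have "\<dots> = (\<integral>\<^sup>+\<omega>. U \<omega> * indicator (\<Union>j\<in>{k..n}. A j) \<omega> \<partial>M)"
    unfolding dis sum_distrib_left by (intro nn_integral_sum[symmetric]) auto
  also have "\<dots> \<le> (\<integral>\<^sup>+\<omega>. U \<omega> \<partial>M)"
    by (intro nn_integral_mono) (auto simp: indicator_def)
  finally show ?thesis .
qed

text \<open>After the first passage over \<open>x\<close> the remaining increment has the sign
  \<open>s\<close> with conditional probability at least \<open>normal_tail_one\<close>, and then
  the endpoint lies beyond \<open>x\<close> too. The exponential Chebyshev bound for the endpoint
  concludes. The weight \<open>G\<close> makes the estimate conditional on the past of
  \<open>t k\<close>.\<close>

lemma maximal_increment_tail:
  fixes t :: "nat \<Rightarrow> real" and G :: "'a \<Rightarrow> ennreal"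
  assumes t0: "0 \<le> t 0" and inc: "\<And>i j. i < j \<Longrightarrow> j \<le> n \<Longrightarrow> t i < t j" and k: "k < n"
    and G: "G \<in> borel_measurable (F (t k))" and s: "s = 1 \<or> s = -1" and \<kappa>: "0 \<le> \<kappa>"
  shows "ennreal normal_tail_one * (\<integral>\<^sup>+\<omega>\<in>{\<omega>\<in>space M. \<exists>j\<in>{k..n}. x \<le> s * (W (t j) \<omega> - W (t k) \<omega>)}. G \<omega> \<partial>M)
    \<le> ennreal (exp (\<kappa>\<^sup>2 * (t n - t k) / 2 - \<kappa> * x)) * (\<integral>\<^sup>+\<omega>. G \<omega> \<partial>M)"
proof -
  let ?U = "\<lambda>\<omega>. G \<omega> * ennreal (exp (\<kappa> * (s * (W (t n) \<omega> - W (t k) \<omega>) - x)))"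
  have mono: "t i \<le> t j" if "i \<le> j" "j \<le> n" for i j
    using inc[of i j] that by (cases "i = j") auto
  have tpos: "0 \<le> t i" if "i \<le> n" for i
    using mono[of 0 i] t0 that by simp
  have GM [measurable]: "G \<in> borel_measurable M"
    using G measurable_F_M by blast
  have WM [measurable]: "W (t i) \<in> borel_measurable M" if "i \<le> n" for i
    using tpos[OF that] by measurable
  have UM: "?U \<in> borel_measurable M"
  proof -
    have [measurable]: "W (t n) \<in> borel_measurable M" "W (t k) \<in> borel_measurable M" using WM k by auto
    show ?thesis by measurable
  qed
  have "ennreal normal_tail_one * (\<integral>\<^sup>+\<omega>\<in>{\<omega>\<in>space M. \<exists>j\<in>{k..n}. x \<le> s * (W (t j) \<omega> - W (t k) \<omega>)}. G \<omega> \<partial>M) =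
    (\<integral>\<^sup>+\<omega>\<in>{\<omega>\<in>space M. \<exists>j\<in>{k..n}. x \<le> s * (W (t j) \<omega> - W (t k) \<omega>)}. (ennreal normal_tail_one * G \<omega>) \<partial>M)"
  proof -
    have "{\<omega>\<in>space M. \<exists>j\<in>{k..n}. x \<le> s * (W (t j) \<omega> - W (t k) \<omega>)} = (\<Union>j\<in>{k..n}. {\<omega>\<in>space M. x \<le> s * (W (t j) \<omega> - W (t k) \<omega>)})"
      by auto
    also have "\<dots> \<in> events"
    proof (intro sets.finite_UN)
      fix j assume "j \<in> {k..n}"
      then have [measurable]: "W (t j) \<in> borel_measurable M" "W (t k) \<in> borel_measurable M" using WM k by auto
      show "{\<omega>\<in>space M. x \<le> s * (W (t j) \<omega> - W (t k) \<omega>)} \<in> events" by measurable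
    qed simp
    finally show ?thesis
      by (subst nn_integral_cmult[symmetric]) (auto simp: mult.assoc)
  qed
  also have "\<dots> \<le> (\<integral>\<^sup>+\<omega>. ?U \<omega> \<partial>M)"
  proof (rule first_passage_comparison[where t=t])
    show "{\<omega> \<in> space M. x \<le> s * (W (t j) \<omega> - W (t k) \<omega>)} \<in> sets (F (t j))" if "k \<le> j" "j \<le> n" for j
    proof -
      have [measurable]: "W (t j) \<in> borel_measurable (F (t j))" "W (t k) \<in> borel_measurable (F (t j))"
        using that tpos mono by (auto intro!: adapted_mono)
      have "{\<omega> \<in> space (F (t j)). x \<le> s * (W (t j) \<omega> - W (t k) \<omega>)} \<in> sets (F (t j))"
        by measurable
      then show ?thesis by (simp add: space_F)
    qed
    fix j A assume j: "k \<le> j" "j \<le> n" and A: "A \<in> sets (F (t j))" and PA: "\<And>\<omega>. \<omega> \<in> A \<Longrightarrow> x \<le> s * (W (t j) \<omega> - W (t k) \<omega>)"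
    show "(\<integral>\<^sup>+\<omega>\<in>A. (ennreal normal_tail_one * G \<omega>) \<partial>M) \<le> (\<integral>\<^sup>+\<omega>\<in>A. ?U \<omega> \<partial>M)"
    proof (cases "j = n")
      case True
      show ?thesis
      proof (intro nn_integral_mono)
        fix \<omega>
        have "ennreal normal_tail_one * G \<omega> \<le> ?U \<omega>" if "\<omega> \<in> A"
        proof -
          have "normal_tail_one \<le> exp (\<kappa> * (s * (W (t n) \<omega> - W (t k) \<omega>) - x))"
            using normal_tail_one_le_1 PA[OF that] True \<kappa> by (intro order_trans[OF normal_tail_one_le_1]) auto
          then show ?thesis
            by (subst mult.commute) (intro mult_left_mono ennreal_leI, auto)
        qed
        then show "ennreal normal_tail_one * G \<omega> * indicator A \<omega> \<le> ?U \<omega> * indicator A \<omega>"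
          by (auto simp: indicator_def)
      qed
    next
      case False
      then have jn: "j < n" using j by simp
      have GA: "(\<lambda>\<omega>. G \<omega> * indicator A \<omega>) \<in> borel_measurable (F (t j))"
        using measurable_F_mono[OF G mono[OF j]] A by measurable
      let ?f = "indicator {y. sqrt (t n - t j) \<le> s * y} :: real \<Rightarrow> ennreal"
      have "(\<integral>\<^sup>+\<omega>\<in>A. (ennreal normal_tail_one * G \<omega>) \<partial>M) = (\<integral>\<^sup>+\<omega>. G \<omega> * indicator A \<omega> \<partial>M) * ennreal normal_tail_one"
        using measurable_F_M[OF GA] by (subst nn_integral_multc[symmetric]) (auto simp: mult_ac)
      also have "\<dots> = (\<integral>\<^sup>+\<omega>. G \<omega> * indicator A \<omega> \<partial>M) *
          (\<integral>\<^sup>+x. ennreal (normal_density 0 (sqrt (t n - t j)) x) * ?f x \<partial>lborel)"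
        using normal_tail_scaled[of "t n - t j" s] inc[OF jn] s by simp
      also have "\<dots> = (\<integral>\<^sup>+\<omega>. G \<omega> * indicator A \<omega> * ?f (W (t n) \<omega> - W (t j) \<omega>) \<partial>M)"
        using tpos[OF j(2)] inc[OF jn] by (intro increment_nn_integral[symmetric] GA) auto
      also have "\<dots> \<le> (\<integral>\<^sup>+\<omega>\<in>A. ?U \<omega> \<partial>M)"
      proof (intro nn_integral_mono)
        fix \<omega>
        have "G \<omega> * 1 \<le> ?U \<omega>" if "\<omega> \<in> A" "sqrt (t n - t j) \<le> s * (W (t n) \<omega> - W (t j) \<omega>)"
        proof -
          have "0 \<le> s * (W (t n) \<omega> - W (t j) \<omega>)"
            using that(2) inc[OF jn] by (meson diff_ge_0_iff_ge less_imp_le order_refl order_trans real_sqrt_ge_zero)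
          then have "x \<le> s * (W (t n) \<omega> - W (t k) \<omega>)"
            using PA[OF that(1)] by (simp add: algebra_simps)
          then show ?thesis
            using \<kappa> by (intro mult_left_mono) auto
        qed
        then show "G \<omega> * indicator A \<omega> * ?f (W (t n) \<omega> - W (t j) \<omega>) \<le> ?U \<omega> * indicator A \<omega>"
          by (auto simp: indicator_def)
      qed
      finally show ?thesis .
    qed
  qed (use mono UM in auto)
  also have "\<dots> = (\<integral>\<^sup>+\<omega>. G \<omega> \<partial>M) * (\<integral>\<^sup>+y. ennreal (normal_density 0 (sqrt (t n - t k)) y) * ennreal (exp (\<kappa> * (s * y - x))) \<partial>lborel)"
    using tpos[of k] k inc[OF k] by (intro increment_nn_integral G) auto
  also have "(\<integral>\<^sup>+y. ennreal (normal_density 0 (sqrt (t n - t k)) y) * ennreal (exp (\<kappa> * (s * y - x))) \<partial>lborel) =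
      (\<integral>\<^sup>+y. ennreal (exp (- \<kappa> * x)) * (ennreal (normal_density 0 (sqrt (t n - t k)) y) * ennreal (exp ((\<kappa> * s) * y))) \<partial>lborel)"
    by (intro nn_integral_cong) (simp add: ennreal_mult[symmetric] exp_add[symmetric] algebra_simps)
  also have "\<dots> = ennreal (exp (- \<kappa> * x)) * ennreal (exp ((\<kappa> * s)\<^sup>2 * (t n - t k) / 2))"
    using inc[OF k] by (subst nn_integral_cmult) (auto simp: nn_integral_normal_exp)
  also have "\<dots> = ennreal (exp (\<kappa>\<^sup>2 * (t n - t k) / 2 - \<kappa> * x))"
    using s by (auto simp: ennreal_mult[symmetric] exp_add[symmetric])
  finally show ?thesis
    by (simp add: mult.commute)
qed

text \<open>Each value of the maximum is charged to the level \<open>m * sqrt T\<close> just below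
  it and to the sign of the increment that attains it; the tail estimates are then summed over
  \<open>m\<close> and both signs.\<close>

lemma maximal_increment_exp:
  fixes t :: "nat \<Rightarrow> real" and G :: "'a \<Rightarrow> ennreal"
  assumes t0: "0 \<le> t 0" and inc: "\<And>i j. i < j \<Longrightarrow> j \<le> n \<Longrightarrow> t i < t j" and k: "k \<le> n"
    and G: "G \<in> borel_measurable (F (t k))" and \<kappa>: "0 < \<kappa>" and T: "t n - t k \<le> T" "0 < T"
  shows "(\<integral>\<^sup>+\<omega>. G \<omega> * ennreal (exp (\<kappa> * (MAX j\<in>{k..n}. \<bar>W (t j) \<omega> - W (t k) \<omega>\<bar>) / sqrt T)) \<partial>M)
    \<le> ennreal (maximal_const \<kappa>) * (\<integral>\<^sup>+\<omega>. G \<omega> \<partial>M)"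
proof (cases "k = n")
  case True
  have "(\<integral>\<^sup>+\<omega>. G \<omega> * ennreal (exp (\<kappa> * (MAX j\<in>{k..n}. \<bar>W (t j) \<omega> - W (t k) \<omega>\<bar>) / sqrt T)) \<partial>M) = 1 * (\<integral>\<^sup>+\<omega>. G \<omega> \<partial>M)"
    using True by simp
  also have "\<dots> \<le> ennreal (maximal_const \<kappa>) * (\<integral>\<^sup>+\<omega>. G \<omega> \<partial>M)"
    using maximal_const_ge_1[OF \<kappa>] by (intro mult_right_mono) auto
  finally show ?thesis .
next
  case False
  then have kn: "k < n" using k by simp
  define Mx where "Mx \<omega> = (MAX j\<in>{k..n}. \<bar>W (t j) \<omega> - W (t k) \<omega>\<bar>)" for \<omega>
  define A where "A s m = {\<omega>\<in>space M. \<exists>j\<in>{k..n}. real m * sqrt T \<le> s * (W (t j) \<omega> - W (t k) \<omega>)}" for s :: real and m :: nat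
  have mono: "t i \<le> t j" if "i \<le> j" "j \<le> n" for i j
    using inc[of i j] that by (cases "i = j") auto
  have tpos: "0 \<le> t i" if "i \<le> n" for i
    using mono[of 0 i] t0 that by simp
  have GM [measurable]: "G \<in> borel_measurable M"
    using G measurable_F_M by blast
  have WM [measurable]: "W (t i) \<in> borel_measurable M" if "i \<le> n" for i
    using tpos[OF that] by measurable
  have AM [measurable]: "A s m \<in> events" for s m
  proof -
    have "A s m = (\<Union>j\<in>{k..n}. {\<omega>\<in>space M. real m * sqrt T \<le> s * (W (t j) \<omega> - W (t k) \<omega>)})"
      by (auto simp: A_def)
    also have "\<dots> \<in> events"
    proof (intro sets.finite_UN)
      fix j assume "j \<in> {k..n}"
      then have [measurable]: "W (t j) \<in> borel_measurable M" "W (t k) \<in> borel_measurable M" using WM k by auto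
      show "{\<omega>\<in>space M. real m * sqrt T \<le> s * (W (t j) \<omega> - W (t k) \<omega>)} \<in> events" by measurable
    qed simp
    finally show ?thesis .
  qed
  let ?c = "\<lambda>m::nat. ennreal (exp (\<kappa> * (real m + 1)))"
  have pt: "ennreal (exp (\<kappa> * Mx \<omega> / sqrt T)) \<le> (\<Sum>m. ?c m * (indicator (A 1 m) \<omega> + indicator (A (-1) m) \<omega>))" if \<omega>: "\<omega> \<in> space M" for \<omega>
  proof -
    have "Mx \<omega> \<in> (\<lambda>j. \<bar>W (t j) \<omega> - W (t k) \<omega>\<bar>) ` {k..n}"
      unfolding Mx_def using k by (intro Max_in) auto
    then obtain j where j: "j \<in> {k..n}" "Mx \<omega> = \<bar>W (t j) \<omega> - W (t k) \<omega>\<bar>" by blast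
    define m where "m = nat (floor (Mx \<omega> / sqrt T))"
    have "0 \<le> Mx \<omega> / sqrt T" using j T by simp
    then have m: "real m \<le> Mx \<omega> / sqrt T" "Mx \<omega> / sqrt T \<le> real m + 1"
      unfolding m_def by linarith+
    then have mT: "real m * sqrt T \<le> Mx \<omega>" using T by (simp add: field_simps)
    have "\<omega> \<in> A 1 m \<or> \<omega> \<in> A (-1) m"
    proof (cases "0 \<le> W (t j) \<omega> - W (t k) \<omega>")
      case True
      then have "\<omega> \<in> A 1 m" using j mT \<omega> by (auto simp: A_def intro!: bexI[of _ j])
      then show ?thesis ..
    next
      case False
      then have "\<omega> \<in> A (-1) m" using j mT \<omega> by (auto simp: A_def intro!: bexI[of _ j])
      then show ?thesis ..
    qed
    then have i1: "(1::ennreal) \<le> indicator (A 1 m) \<omega> + indicator (A (-1) m) \<omega>"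
      by (auto simp: indicator_def)
    have "\<kappa> * Mx \<omega> / sqrt T \<le> \<kappa> * (real m + 1)"
      using m(2) \<kappa> unfolding times_divide_eq_right[symmetric] by (intro mult_left_mono) auto
    then have "ennreal (exp (\<kappa> * Mx \<omega> / sqrt T)) \<le> ?c m * 1"
      by (simp add: ennreal_leI)
    also have "\<dots> \<le> ?c m * (indicator (A 1 m) \<omega> + indicator (A (-1) m) \<omega>)"
      using i1 by (intro mult_left_mono) auto
    also have "\<dots> \<le> (\<Sum>m. ?c m * (indicator (A 1 m) \<omega> + indicator (A (-1) m) \<omega>))"
      using sum_le_suminf[of "\<lambda>m. ?c m * (indicator (A 1 m) \<omega> + indicator (A (-1) m) \<omega>)" "{m}"] by simp
    finally show ?thesis .
  qed
  define p where "p = normal_tail_one"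
  have p: "0 < p" using normal_tail_one_pos by (simp add: p_def)
  have tail: "ennreal p * (\<integral>\<^sup>+\<omega>\<in>A s m. G \<omega> \<partial>M) \<le> ennreal (exp (2 * \<kappa>\<^sup>2 - 2 * \<kappa> * real m)) * (\<integral>\<^sup>+\<omega>. G \<omega> \<partial>M)"
    if s: "s = 1 \<or> s = -1" for s m
  proof -
    \<comment> \<open>The parameter \<open>2 * \<kappa> / sqrt T\<close> makes the tail decay like
      \<open>exp (- 2 * \<kappa> * m)\<close>, twice as fast as the weight grows, so the series
      converges geometrically.\<close>
    have "ennreal p * (\<integral>\<^sup>+\<omega>\<in>A s m. G \<omega> \<partial>M) \<le> ennreal (exp ((2 * \<kappa> / sqrt T)\<^sup>2 * (t n - t k) / 2 - (2 * \<kappa> / sqrt T) * (real m * sqrt T))) * (\<integral>\<^sup>+\<omega>. G \<omega> \<partial>M)"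
      unfolding A_def p_def using \<kappa> T by (intro maximal_increment_tail t0 inc kn G s) auto
    also have "\<dots> \<le> ennreal (exp (2 * \<kappa>\<^sup>2 - 2 * \<kappa> * real m)) * (\<integral>\<^sup>+\<omega>. G \<omega> \<partial>M)"
    proof (intro mult_right_mono ennreal_leI)
      have "(2 * \<kappa> / sqrt T)\<^sup>2 * (t n - t k) / 2 = 2 * \<kappa>\<^sup>2 * ((t n - t k) / T)"
        using T by (simp add: power_divide power_mult_distrib)
      also have "\<dots> \<le> 2 * \<kappa>\<^sup>2 * 1"
        using T by (intro mult_left_mono) auto
      finally show "exp ((2 * \<kappa> / sqrt T)\<^sup>2 * (t n - t k) / 2 - (2 * \<kappa> / sqrt T) * (real m * sqrt T)) \<le> exp (2 * \<kappa>\<^sup>2 - 2 * \<kappa> * real m)"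
        using T by simp
    qed simp
    finally show ?thesis .
  qed
  let ?I = "\<integral>\<^sup>+\<omega>. G \<omega> \<partial>M"
  have "ennreal p * (\<integral>\<^sup>+\<omega>. G \<omega> * ennreal (exp (\<kappa> * Mx \<omega> / sqrt T)) \<partial>M) \<le>
     ennreal p * (\<integral>\<^sup>+\<omega>. (\<Sum>m. ?c m * (G \<omega> * indicator (A 1 m) \<omega> + G \<omega> * indicator (A (-1) m) \<omega>)) \<partial>M)"
  proof (intro mult_left_mono nn_integral_mono)
    fix \<omega> assume "\<omega> \<in> space M"
    then have "G \<omega> * ennreal (exp (\<kappa> * Mx \<omega> / sqrt T)) \<le> G \<omega> * (\<Sum>m. ?c m * (indicator (A 1 m) \<omega> + indicator (A (-1) m) \<omega>))"
      by (intro mult_left_mono pt) auto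
    also have "\<dots> = (\<Sum>m. G \<omega> * (?c m * (indicator (A 1 m) \<omega> + indicator (A (-1) m) \<omega>)))"
      by (rule ennreal_suminf_cmult[symmetric])
    also have "\<dots> = (\<Sum>m. ?c m * (G \<omega> * indicator (A 1 m) \<omega> + G \<omega> * indicator (A (-1) m) \<omega>))"
      by (simp add: distrib_left mult_ac)
    finally show "G \<omega> * ennreal (exp (\<kappa> * Mx \<omega> / sqrt T)) \<le> (\<Sum>m. ?c m * (G \<omega> * indicator (A 1 m) \<omega> + G \<omega> * indicator (A (-1) m) \<omega>))" .
  qed simp
  also have "\<dots> = (\<Sum>m. ?c m * (ennreal p * (\<integral>\<^sup>+\<omega>\<in>A 1 m. G \<omega> \<partial>M) + ennreal p * (\<integral>\<^sup>+\<omega>\<in>A (-1) m. G \<omega> \<partial>M)))"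
  proof -
    have "(\<integral>\<^sup>+\<omega>. (\<Sum>m. ?c m * (G \<omega> * indicator (A 1 m) \<omega> + G \<omega> * indicator (A (-1) m) \<omega>)) \<partial>M) =
        (\<Sum>m. ?c m * ((\<integral>\<^sup>+\<omega>\<in>A 1 m. G \<omega> \<partial>M) + (\<integral>\<^sup>+\<omega>\<in>A (-1) m. G \<omega> \<partial>M)))"
      by (subst nn_integral_suminf) (auto simp: nn_integral_cmult nn_integral_add)
    then show ?thesis
      by (simp only: ennreal_suminf_cmult[symmetric]) (simp add: distrib_left mult_ac)
  qed
  also have "\<dots> \<le> (\<Sum>m. ?c m * (ennreal (exp (2 * \<kappa>\<^sup>2 - 2 * \<kappa> * real m)) * ?I + ennreal (exp (2 * \<kappa>\<^sup>2 - 2 * \<kappa> * real m)) * ?I))"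
    by (intro suminf_le mult_left_mono add_mono tail) auto
  also have "\<dots> = (\<Sum>m. ennreal (2 * exp (2 * \<kappa>\<^sup>2 + \<kappa>) * exp (- \<kappa>) ^ m) * ?I)"
  proof (intro suminf_cong)
    fix m
    have e: "exp (\<kappa> * (real m + 1)) * exp (2 * \<kappa>\<^sup>2 - 2 * \<kappa> * real m) = exp (2 * \<kappa>\<^sup>2 + \<kappa>) * exp (- \<kappa>) ^ m"
      by (simp add: exp_add[symmetric] exp_of_nat_mult[symmetric] algebra_simps)
    have "?c m * (ennreal (exp (2 * \<kappa>\<^sup>2 - 2 * \<kappa> * real m)) * ?I + ennreal (exp (2 * \<kappa>\<^sup>2 - 2 * \<kappa> * real m)) * ?I) =
        (ennreal (exp (\<kappa> * (real m + 1)) * exp (2 * \<kappa>\<^sup>2 - 2 * \<kappa> * real m)) + ennreal (exp (\<kappa> * (real m + 1)) * exp (2 * \<kappa>\<^sup>2 - 2 * \<kappa> * real m))) * ?I"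
      by (simp only: ennreal_mult exp_ge_zero distrib_left distrib_right mult.assoc)
    also have "\<dots> = ennreal (2 * exp (2 * \<kappa>\<^sup>2 + \<kappa>) * exp (- \<kappa>) ^ m) * ?I"
      unfolding e by (simp add: mult_ac flip: ennreal_plus)
    finally show "?c m * (ennreal (exp (2 * \<kappa>\<^sup>2 - 2 * \<kappa> * real m)) * ?I + ennreal (exp (2 * \<kappa>\<^sup>2 - 2 * \<kappa> * real m)) * ?I) =
        ennreal (2 * exp (2 * \<kappa>\<^sup>2 + \<kappa>) * exp (- \<kappa>) ^ m) * ?I" .
  qed
  also have "\<dots> = (\<Sum>m. ennreal (2 * exp (2 * \<kappa>\<^sup>2 + \<kappa>) * exp (- \<kappa>) ^ m)) * ?I"
    by (rule ennreal_suminf_multc)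
  also have "(\<Sum>m. ennreal (2 * exp (2 * \<kappa>\<^sup>2 + \<kappa>) * exp (- \<kappa>) ^ m)) = ennreal (2 * exp (2 * \<kappa>\<^sup>2 + \<kappa>) / (1 - exp (- \<kappa>)))"
  proof -
    have "(\<lambda>m. 2 * exp (2 * \<kappa>\<^sup>2 + \<kappa>) * exp (- \<kappa>) ^ m) sums (2 * exp (2 * \<kappa>\<^sup>2 + \<kappa>) * (1 / (1 - exp (- \<kappa>))))"
      using \<kappa> by (intro sums_mult geometric_sums) auto
    then show ?thesis
      by (subst suminf_ennreal_eq) auto
  qed
  also have "\<dots> = ennreal p * ennreal (2 / p * exp (2 * \<kappa>\<^sup>2 + \<kappa>) / (1 - exp (- \<kappa>)))"
    using p \<kappa> by (simp add: ennreal_mult[symmetric])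
  finally have "ennreal p * (\<integral>\<^sup>+\<omega>. G \<omega> * ennreal (exp (\<kappa> * Mx \<omega> / sqrt T)) \<partial>M) \<le>
      ennreal p * (ennreal (2 / p * exp (2 * \<kappa>\<^sup>2 + \<kappa>) / (1 - exp (- \<kappa>))) * ?I)"
    by (simp add: mult.assoc)
  then have "(\<integral>\<^sup>+\<omega>. G \<omega> * ennreal (exp (\<kappa> * Mx \<omega> / sqrt T)) \<partial>M) \<le> ennreal (2 / p * exp (2 * \<kappa>\<^sup>2 + \<kappa>) / (1 - exp (- \<kappa>))) * ?I"
    using p by (subst (asm) ennreal_mult_le_mult_iff) auto
  also have "\<dots> \<le> ennreal (maximal_const \<kappa>) * ?I"
    unfolding maximal_const_def p_def by (intro mult_right_mono ennreal_leI) auto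
  finally show ?thesis
    unfolding Mx_def .
qed

end

section \<open>Independence of the bridge and the endpoint\<close>

definition bridge_extend :: "(nat \<Rightarrow> real) \<Rightarrow> nat \<Rightarrow> (nat \<Rightarrow> real) \<times> real \<Rightarrow> nat \<Rightarrow> real" where
  "bridge_extend t n z i = (if i \<le> n then fst z i + t i / t n * snd z else 0)"

lemma bridge_extend_measurable [measurable]:
  "bridge_extend t n \<in> (\<Pi>\<^sub>M i\<in>UNIV. borel) \<Otimes>\<^sub>M borel \<rightarrow>\<^sub>M (\<Pi>\<^sub>M i\<in>UNIV. borel)"
proof -
  have "(\<lambda>z i. bridge_extend t n z i) \<in> (\<Pi>\<^sub>M i\<in>UNIV. borel) \<Otimes>\<^sub>M borel \<rightarrow>\<^sub>M (\<Pi>\<^sub>M i\<in>UNIV. borel)"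
  proof (rule measurable_PiM_single')
    fix i :: nat
    have "(\<lambda>z. fst z i) \<in> borel_measurable ((\<Pi>\<^sub>M i\<in>UNIV. borel :: real measure) \<Otimes>\<^sub>M (borel :: real measure))"
      by (rule measurable_compose[OF measurable_fst measurable_component_singleton]) simp
    then show "(\<lambda>z. bridge_extend t n z i) \<in> borel_measurable ((\<Pi>\<^sub>M i\<in>UNIV. borel) \<Otimes>\<^sub>M borel)"
      unfolding bridge_extend_def by (cases "i \<le> n") auto
  qed (auto simp: PiE_def)
  then show ?thesis by simp
qed

context brownian_motion
begin

text \<open>Continued by 0 beyond \<open>n\<close>, so that the bridges for all \<open>n\<close>
  live in one product space and the induction on \<open>n\<close> does not change the domain of the
  functionals.\<close>

definition bridge :: "(nat \<Rightarrow> real) \<Rightarrow> nat \<Rightarrow> 'a \<Rightarrow> nat \<Rightarrow> real" where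
  "bridge t n \<omega> i = (if i \<le> n then (W (t i) \<omega> - W 0 \<omega>) - t i / t n * (W (t n) \<omega> - W 0 \<omega>) else 0)"

lemma bridge_measurable:
  assumes "t 0 = 0" and mono: "\<And>i j. i \<le> j \<Longrightarrow> j \<le> n \<Longrightarrow> t i \<le> t j"
  shows "bridge t n \<in> F (t n) \<rightarrow>\<^sub>M (\<Pi>\<^sub>M i\<in>UNIV. borel)"
proof -
  have tpos: "0 \<le> t i" if "i \<le> n" for i
    using mono[of 0 i] assms(1) that by simp
  have "(\<lambda>\<omega> i. bridge t n \<omega> i) \<in> F (t n) \<rightarrow>\<^sub>M (\<Pi>\<^sub>M i\<in>UNIV. borel)"
  proof (rule measurable_PiM_single')
    fix i :: nat
    have [measurable]: "W (t i) \<in> borel_measurable (F (t n))" if "i \<le> n" for i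
      using tpos[OF that] mono[of i n] that by (intro adapted_mono) auto
    have [measurable]: "W 0 \<in> borel_measurable (F (t n))"
      using tpos[of n] by (intro adapted_mono) auto
    show "(\<lambda>\<omega>. bridge t n \<omega> i) \<in> borel_measurable (F (t n))"
    proof (cases "i \<le> n")
      case True
      then show ?thesis by (simp add: bridge_def)
    qed (simp add: bridge_def)
  qed (auto simp: PiE_def)
  then show ?thesis by simp
qed

text \<open>Given the past, one more increment is integrated out. The Gaussian change of variables
  from old endpoint and increment to new endpoint and new bridge coordinate then makes the new
  endpoint independent of the enlarged bridge.\<close>

lemma bridge_disintegration:
  fixes t :: "nat \<Rightarrow> real"
  assumes t0: "t 0 = 0" and n: "1 \<le> n" and inc: "\<And>i j. i < j \<Longrightarrow> j \<le> n \<Longrightarrow> t i < t j"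
    and K: "K \<in> borel_measurable ((\<Pi>\<^sub>M i\<in>UNIV. borel) \<Otimes>\<^sub>M borel)"
  shows "(\<integral>\<^sup>+\<omega>. K (bridge t n \<omega>, W (t n) \<omega> - W 0 \<omega>) \<partial>M) =
    (\<integral>\<^sup>+\<omega>. (\<integral>\<^sup>+s. ennreal (normal_density 0 (sqrt (t n)) s) * K (bridge t n \<omega>, s) \<partial>lborel) \<partial>M)"
  using n inc K
proof (induction n arbitrary: K rule: dec_induct)
  case base
  \<comment> \<open>A grid with one cell has the zero bridge, so the claim is just the law of the
    endpoint.\<close>
  have b: "bridge t 1 \<omega> = (\<lambda>i. 0)" for \<omega>
    using base(1)[of 0 1] t0 by (auto simp: bridge_def fun_eq_iff le_Suc_eq)
  have "(\<lambda>_. (\<lambda>i::nat. 0)) \<in> F 0 \<rightarrow>\<^sub>M (\<Pi>\<^sub>M i\<in>UNIV. borel :: real measure)"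
    by (rule measurable_const) (auto simp: space_PiM PiE_def)
  from increment_disintegration[OF order_refl _ this base(2), of "t 1"] base(1)[of 0 1] t0
  show ?case by (simp add: b[simplified])
next
  case (step n)
  have tn: "0 < t n" and tS: "t n < t (Suc n)"
    using step(4)[of 0 n] step(4)[of n "Suc n"] step(1) t0 by auto
  let ?N = "\<Pi>\<^sub>M i\<in>UNIV. borel :: real measure"
  have mono: "t i \<le> t j" if "i \<le> j" "j \<le> n" for i j
    using step(4)[of i j] that by (cases "i = j") auto
  define h where "h = t (Suc n) - t n"
  define \<tau> where "\<tau> = t n / t (Suc n)"
  let ?f = "\<lambda>x. ennreal (normal_density 0 (sqrt h) x)" and ?g = "\<lambda>x. ennreal (normal_density 0 (sqrt (t n)) x)"
    and ?u = "\<lambda>x. ennreal (normal_density 0 (sqrt (t (Suc n))) x)"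
    and ?v = "\<lambda>x. ennreal (normal_density 0 (sqrt (t n * h / t (Suc n))) x)"
  have h: "0 < h" "t n + h = t (Suc n)" using tS by (auto simp: h_def)
  \<comment> \<open>The bridge over the longer interval is the old one plus a linear function,
    determined by one new coordinate: the value of the longer bridge at \<open>t n\<close>.\<close>
  have bS: "bridge t (Suc n) \<omega> = bridge_extend t n (bridge t n \<omega>, (W (t n) \<omega> - W 0 \<omega>) - \<tau> * (W (t (Suc n)) \<omega> - W 0 \<omega>))" for \<omega>
  proof
    fix i
    consider "i \<le> n" | "i = Suc n" | "Suc n < i" by linarith
    then show "bridge t (Suc n) \<omega> i = bridge_extend t n (bridge t n \<omega>, (W (t n) \<omega> - W 0 \<omega>) - \<tau> * (W (t (Suc n)) \<omega> - W 0 \<omega>)) i"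
      using tn tS by cases (auto simp: bridge_def bridge_extend_def \<tau>_def field_simps)
  qed
  have main: "(\<integral>\<^sup>+\<omega>. K (bridge t (Suc n) \<omega>, W (t (Suc n)) \<omega> - W 0 \<omega>) \<partial>M) =
      (\<integral>\<^sup>+\<omega>. (\<integral>\<^sup>+u. ?u u * (\<integral>\<^sup>+v. ?v v * K (bridge_extend t n (bridge t n \<omega>, v), u) \<partial>lborel) \<partial>lborel) \<partial>M)"
    if K [measurable]: "K \<in> borel_measurable (?N \<Otimes>\<^sub>M borel)" for K
  proof -
    define K1 where "K1 z = K (bridge_extend t n (fst (fst z), snd (fst z) - \<tau> * (snd (fst z) + snd z)), snd (fst z) + snd z)" for z
    have K1 [measurable]: "K1 \<in> borel_measurable ((?N \<Otimes>\<^sub>M borel) \<Otimes>\<^sub>M borel)"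
      unfolding K1_def by measurable
    define G where "G \<omega> = (bridge t n \<omega>, W (t n) \<omega> - W 0 \<omega>)" for \<omega>
    have "W (t n) \<in> borel_measurable (F (t n))" "W 0 \<in> borel_measurable (F (t n))"
      using tn by (auto intro!: adapted_mono)
    then have G: "G \<in> F (t n) \<rightarrow>\<^sub>M ?N \<Otimes>\<^sub>M borel"
      unfolding G_def using bridge_measurable[of t n, OF t0 mono] by measurable
    have "(\<integral>\<^sup>+\<omega>. K (bridge t (Suc n) \<omega>, W (t (Suc n)) \<omega> - W 0 \<omega>) \<partial>M) = (\<integral>\<^sup>+\<omega>. K1 (G \<omega>, W (t (Suc n)) \<omega> - W (t n) \<omega>) \<partial>M)"
      unfolding bS K1_def G_def by (simp add: algebra_simps)
    also have "\<dots> = (\<integral>\<^sup>+\<omega>. (\<integral>\<^sup>+x. ?f x * K1 (G \<omega>, x) \<partial>lborel) \<partial>M)"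
      unfolding h_def using tn tS by (intro increment_disintegration[OF _ _ G K1]) auto
    also have "\<dots> = (\<integral>\<^sup>+\<omega>. (\<integral>\<^sup>+s. ?g s * (\<integral>\<^sup>+x. ?f x * K1 ((bridge t n \<omega>, s), x) \<partial>lborel) \<partial>lborel) \<partial>M)"
    proof -
      have "(\<lambda>y. \<integral>\<^sup>+x. ?f x * K1 (y, x) \<partial>lborel) \<in> borel_measurable (?N \<Otimes>\<^sub>M borel)"
        by measurable
      from step(3)[OF _ this] step(4) show ?thesis
        unfolding G_def by simp
    qed
    also have "\<dots> = (\<integral>\<^sup>+\<omega>. (\<integral>\<^sup>+u. ?u u * (\<integral>\<^sup>+v. ?v v * K (bridge_extend t n (bridge t n \<omega>, v), u) \<partial>lborel) \<partial>lborel) \<partial>M)"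
    proof (rule nn_integral_cong)
      fix \<omega>
      have [measurable]: "(\<lambda>z. K (bridge_extend t n (bridge t n \<omega>, fst z), snd z)) \<in> borel_measurable (borel \<Otimes>\<^sub>M borel)"
      proof -
        have [measurable]: "bridge t n \<omega> \<in> space ?N"
          by (auto simp: space_PiM PiE_def)
        show ?thesis by measurable
      qed
      from normal_bridge_change_of_variables[OF tn h(1) this]
      show "(\<integral>\<^sup>+s. ?g s * (\<integral>\<^sup>+x. ?f x * K1 ((bridge t n \<omega>, s), x) \<partial>lborel) \<partial>lborel) =
         (\<integral>\<^sup>+u. ?u u * (\<integral>\<^sup>+v. ?v v * K (bridge_extend t n (bridge t n \<omega>, v), u) \<partial>lborel) \<partial>lborel)"
        unfolding h(2) K1_def \<tau>_def by simp
    qed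
    finally show ?thesis .
  qed
  have K [measurable]: "K \<in> borel_measurable (?N \<Otimes>\<^sub>M borel)" by (rule step(5))
  \<comment> \<open>The identity for arbitrary kernels is applied a second time, to the kernel with
    its endpoint already integrated out. The spare Gaussian variable \<open>u'\<close> then
    integrates to 1, and both sides become the same double integral.\<close>
  have [measurable]: "(\<lambda>z. \<integral>\<^sup>+u. ?u u * K (fst z, u) \<partial>lborel) \<in> borel_measurable (?N \<Otimes>\<^sub>M (borel :: real measure))"
    by measurable
  from main[OF this]
  have "(\<integral>\<^sup>+\<omega>. (\<integral>\<^sup>+u. ?u u * K (bridge t (Suc n) \<omega>, u) \<partial>lborel) \<partial>M) =
      (\<integral>\<^sup>+\<omega>. (\<integral>\<^sup>+u'. ?u u' * (\<integral>\<^sup>+v. ?v v * (\<integral>\<^sup>+u. ?u u * K (bridge_extend t n (bridge t n \<omega>, v), u) \<partial>lborel) \<partial>lborel) \<partial>lborel) \<partial>M)"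
    by simp
  also have "\<dots> = (\<integral>\<^sup>+\<omega>. (\<integral>\<^sup>+u. ?u u * (\<integral>\<^sup>+v. ?v v * K (bridge_extend t n (bridge t n \<omega>, v), u) \<partial>lborel) \<partial>lborel) \<partial>M)"
  proof (rule nn_integral_cong)
    fix \<omega>
    have [measurable]: "bridge t n \<omega> \<in> space ?N"
      by (auto simp: space_PiM PiE_def)
    have "(\<integral>\<^sup>+u'. ?u u' * (\<integral>\<^sup>+v. ?v v * (\<integral>\<^sup>+u. ?u u * K (bridge_extend t n (bridge t n \<omega>, v), u) \<partial>lborel) \<partial>lborel) \<partial>lborel) =
        (\<integral>\<^sup>+v. ?v v * (\<integral>\<^sup>+u. ?u u * K (bridge_extend t n (bridge t n \<omega>, v), u) \<partial>lborel) \<partial>lborel)"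
      using nn_integral_normal_density[of "t (Suc n)" 0] tn tS by (simp add: nn_integral_multc)
    also have "\<dots> = (\<integral>\<^sup>+v. (\<integral>\<^sup>+u. ?v v * (?u u * K (bridge_extend t n (bridge t n \<omega>, v), u)) \<partial>lborel) \<partial>lborel)"
      by (intro nn_integral_cong nn_integral_cmult[symmetric]) measurable
    also have "\<dots> = (\<integral>\<^sup>+u. (\<integral>\<^sup>+v. ?v v * (?u u * K (bridge_extend t n (bridge t n \<omega>, v), u)) \<partial>lborel) \<partial>lborel)"
      by (rule lborel_pair.Fubini') measurable
    also have "\<dots> = (\<integral>\<^sup>+u. ?u u * (\<integral>\<^sup>+v. ?v v * K (bridge_extend t n (bridge t n \<omega>, v), u) \<partial>lborel) \<partial>lborel)"
      by (intro nn_integral_cong, subst nn_integral_cmult[symmetric]) (auto simp: mult_ac)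
    finally show "(\<integral>\<^sup>+u'. ?u u' * (\<integral>\<^sup>+v. ?v v * (\<integral>\<^sup>+u. ?u u * K (bridge_extend t n (bridge t n \<omega>, v), u) \<partial>lborel) \<partial>lborel) \<partial>lborel) =
      (\<integral>\<^sup>+u. ?u u * (\<integral>\<^sup>+v. ?v v * K (bridge_extend t n (bridge t n \<omega>, v), u) \<partial>lborel) \<partial>lborel)" .
  qed
  finally show ?case
    using main[OF K] by simp
qed

lemma bridge_endpoint_indep:
  fixes \<Phi> :: "(nat \<Rightarrow> real) \<Rightarrow> ennreal" and f :: "real \<Rightarrow> ennreal"
  assumes "t 0 = 0" "1 \<le> n" "\<And>i j. i < j \<Longrightarrow> j \<le> n \<Longrightarrow> t i < t j"
    and [measurable]: "\<Phi> \<in> borel_measurable (\<Pi>\<^sub>M i\<in>UNIV. borel)" "f \<in> borel_measurable borel"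
  shows "(\<integral>\<^sup>+\<omega>. \<Phi> (bridge t n \<omega>) * f (W (t n) \<omega> - W 0 \<omega>) \<partial>M) =
    (\<integral>\<^sup>+\<omega>. \<Phi> (bridge t n \<omega>) \<partial>M) * (\<integral>\<^sup>+s. ennreal (normal_density 0 (sqrt (t n)) s) * f s \<partial>lborel)"
proof -
  have mono: "t i \<le> t j" if "i \<le> j" "j \<le> n" for i j
    using assms(3)[of i j] that by (cases "i = j") auto
  have [measurable]: "bridge t n \<in> M \<rightarrow>\<^sub>M (\<Pi>\<^sub>M i\<in>UNIV. borel)"
    using measurable_F_M[OF bridge_measurable[of t n, OF assms(1) mono]] .
  have "(\<integral>\<^sup>+\<omega>. \<Phi> (bridge t n \<omega>) * f (W (t n) \<omega> - W 0 \<omega>) \<partial>M) =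
      (\<integral>\<^sup>+\<omega>. (\<integral>\<^sup>+s. ennreal (normal_density 0 (sqrt (t n)) s) * (\<Phi> (bridge t n \<omega>) * f s) \<partial>lborel) \<partial>M)"
    using bridge_disintegration[of t n, OF assms(1-3), of "\<lambda>z. \<Phi> (fst z) * f (snd z)"] by simp
  also have "\<dots> = (\<integral>\<^sup>+\<omega>. \<Phi> (bridge t n \<omega>) * (\<integral>\<^sup>+s. ennreal (normal_density 0 (sqrt (t n)) s) * f s \<partial>lborel) \<partial>M)"
    by (intro nn_integral_cong) (simp add: nn_integral_cmult[symmetric] mult_ac)
  finally show ?thesis
    by (simp add: nn_integral_multc)
qed

end

text \<open>The product of the constants of two grid estimates at \<open>\<kappa> = 2\<close>. The
  part up to the division by \<open>normal_tail_one\<close> passes from the barrier event to the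
  endpoint event; the rest bounds the deviation on the endpoint event, where
  \<open>4 * \<kappa> * \<sigma> = 8 * \<sigma>\<close>.\<close>

definition hitting_const :: "real \<Rightarrow> real" where
  "hitting_const \<sigma> = exp (2 * \<sigma>) * maximal_const (2 * \<sigma>) / normal_tail_one * maximal_const (8 * \<sigma>) * (2 * exp ((8 * \<sigma> + 1)\<^sup>2 / 6))"

section \<open>The barrier event on a grid\<close>

context brownian_motion
begin

text \<open>
  At the first grid time \<open>j\<close> with \<open>Y j \<ge> a\<close>, the later deviation from the line is at most the deviation so far
  plus the later oscillation, because \<open>a (1 - t j / T) \<le> Y j - a t j / T\<close>. The later oscillation has bounded
  exponential moments given the past, and \<open>Y\<close> ends above \<open>Y j\<close> with a conditional probability bounded below.
\<close>

lemma hitting_grid_le_endpoint: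
  fixes t :: "nat \<Rightarrow> real" and \<sigma> \<nu> a T \<kappa> :: real
  defines "Y \<equiv> \<lambda>i \<omega>. \<sigma> * (W (t i) \<omega> - W 0 \<omega>) + \<nu> * t i"
  defines "D \<equiv> \<lambda>k \<omega>. MAX i\<in>{0..k::nat}. \<bar>Y i \<omega> - a * t i / T\<bar>"
  assumes t0: "t 0 = 0" and inc: "\<And>i j. i < j \<Longrightarrow> j \<le> n \<Longrightarrow> t i < t j" and tn: "t n = T" and T: "0 < T"
    and \<sigma>: "0 < \<sigma>" "\<bar>\<nu>\<bar> * sqrt T \<le> \<sigma>" and a: "0 \<le> a" and \<kappa>: "0 < \<kappa>"
  shows "(\<integral>\<^sup>+\<omega>\<in>{\<omega>\<in>space M. \<exists>j\<in>{0..n}. a \<le> Y j \<omega>}. ennreal (exp (\<kappa> * D n \<omega> / sqrt T)) \<partial>M) \<le>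
    ennreal (exp (\<kappa> * \<sigma>) * maximal_const (\<kappa> * \<sigma>) / normal_tail_one) *
      (\<integral>\<^sup>+\<omega>. ennreal (exp (2 * \<kappa> * D n \<omega> / sqrt T)) * indicator {\<omega>. a \<le> Y n \<omega>} \<omega> \<partial>M)"
proof -
  define C where "C = exp (\<kappa> * \<sigma>) * maximal_const (\<kappa> * \<sigma>)"
  define p where "p = normal_tail_one"
  have p: "0 < p" "p \<le> 1" using normal_tail_one_pos normal_tail_one_le_1 by (auto simp: p_def)
  have mc: "1 \<le> maximal_const (\<kappa> * \<sigma>)" using \<kappa> \<sigma> by (intro maximal_const_ge_1) auto
  have C: "0 \<le> C" using mc by (simp add: C_def)
  have mono: "t i \<le> t j" if "i \<le> j" "j \<le> n" for i j
    using inc[of i j] that by (cases "i = j") auto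
  have tpos: "0 \<le> t i" "t i \<le> T" if "i \<le> n" for i
    using mono[of 0 i] mono[of i n] t0 tn that by auto
  have YF: "Y i \<in> borel_measurable (F (t j))" if "i \<le> j" "j \<le> n" for i j
  proof -
    have [measurable]: "W (t i) \<in> borel_measurable (F (t j))" "W 0 \<in> borel_measurable (F (t j))"
      using that tpos mono by (auto intro!: adapted_mono)
    show ?thesis unfolding Y_def by measurable
  qed
  have DF: "D k \<in> borel_measurable (F (t k))" if "k \<le> n" for k
    unfolding D_def
  proof (rule borel_measurable_Max)
    fix i assume "i \<in> {0..k}"
    then have "Y i \<in> borel_measurable (F (t k))" using YF that by auto
    then show "(\<lambda>\<omega>. \<bar>Y i \<omega> - a * t i / T\<bar>) \<in> borel_measurable (F (t k))" by measurable
  qed simp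
  have DM [measurable]: "D k \<in> borel_measurable M" if "k \<le> n" for k
    using measurable_F_M[OF DF[OF that]] .
  have YM [measurable]: "Y k \<in> borel_measurable M" if "k \<le> n" for k
    using measurable_F_M[OF YF[OF order_refl that]] .
  have D_ge: "\<bar>Y i \<omega> - a * t i / T\<bar> \<le> D k \<omega>" if "i \<le> k" for i k \<omega>
    unfolding D_def using that by (intro Max_ge) auto
  have D_mono: "D j \<omega> \<le> D k \<omega>" if "j \<le> k" for j k \<omega>
    unfolding D_def using that by (intro Max_mono) auto
  let ?L = "\<lambda>\<omega>. ennreal p * ennreal (exp (\<kappa> * D n \<omega> / sqrt T))"
  let ?U = "\<lambda>\<omega>. ennreal C * (ennreal (exp (2 * \<kappa> * D n \<omega> / sqrt T)) * indicator {\<omega>. a \<le> Y n \<omega>} \<omega>)"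
  have main: "(\<integral>\<^sup>+\<omega>\<in>{\<omega>\<in>space M. \<exists>j\<in>{0..n}. a \<le> Y j \<omega>}. ?L \<omega> \<partial>M) \<le> (\<integral>\<^sup>+\<omega>. ?U \<omega> \<partial>M)"
  proof (rule first_passage_comparison[where t=t])
    fix j assume j: "0 \<le> j" "j \<le> n"
    have [measurable]: "Y j \<in> borel_measurable (F (t j))" using YF j by auto
    have "{\<omega>\<in>space (F (t j)). a \<le> Y j \<omega>} \<in> sets (F (t j))" by measurable
    then show "{\<omega>\<in>space M. a \<le> Y j \<omega>} \<in> sets (F (t j))" by (simp add: space_F)
    fix A assume A: "A \<in> sets (F (t j))" and PA: "\<And>\<omega>. \<omega> \<in> A \<Longrightarrow> a \<le> Y j \<omega>"
    have AM [measurable]: "A \<in> events" using A sets_F_subset by blast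
    \<comment> \<open>The doubled exponent comes from the factor 2 in front of \<open>D j\<close> in
      the deviation bound below. Since \<open>D j \<le> D n\<close>, this weight can later be raised
      to the one at the endpoint.\<close>
    define G where "G \<omega> = ennreal (exp (2 * \<kappa> * D j \<omega> / sqrt T)) * indicator A \<omega>" for \<omega>
    have GF: "G \<in> borel_measurable (F (t j))"
      unfolding G_def using DF[OF j(2)] A by measurable
    define R where "R \<omega> = (MAX i\<in>{j..n}. \<bar>W (t i) \<omega> - W (t j) \<omega>\<bar>)" for \<omega>
    have Dn: "D n \<omega> \<le> 2 * D j \<omega> + (\<sigma> * R \<omega> + \<bar>\<nu>\<bar> * T)" if \<omega>: "\<omega> \<in> A" for \<omega>
    proof -
      have nn: "0 \<le> D j \<omega>" using D_ge[of j j \<omega>] by (meson abs_ge_zero order_refl order_trans)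
      have Rn: "\<bar>W (t i) \<omega> - W (t j) \<omega>\<bar> \<le> R \<omega>" if "i \<in> {j..n}" for i
        unfolding R_def using that by (intro Max_ge) auto
      have R0: "0 \<le> R \<omega>" using Rn[of j] j by (meson abs_ge_zero atLeastAtMost_iff order_refl order_trans)
      have "\<bar>Y i \<omega> - a * t i / T\<bar> \<le> 2 * D j \<omega> + (\<sigma> * R \<omega> + \<bar>\<nu>\<bar> * T)" if i: "i \<in> {0..n}" for i
      proof (cases "i \<le> j")
        case True
        then show ?thesis
          using D_ge[OF True, of \<omega>] nn R0 \<sigma> T by (smt (verit) abs_ge_zero mult_nonneg_nonneg)
      next
        case False
        then have ij: "i \<in> {j..n}" using i by auto
        have d1: "\<bar>Y i \<omega> - Y j \<omega>\<bar> \<le> \<sigma> * R \<omega> + \<bar>\<nu>\<bar> * T"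
        proof -
          have "Y i \<omega> - Y j \<omega> = \<sigma> * (W (t i) \<omega> - W (t j) \<omega>) + \<nu> * (t i - t j)"
            by (simp add: Y_def algebra_simps)
          moreover have "\<bar>\<sigma> * (W (t i) \<omega> - W (t j) \<omega>)\<bar> \<le> \<sigma> * R \<omega>"
            using Rn[OF ij] \<sigma> by (simp add: abs_mult)
          moreover have "\<bar>\<nu> * (t i - t j)\<bar> \<le> \<bar>\<nu>\<bar> * T"
            using mono[of j i] tpos(2)[of i] tpos(1)[of j] ij j by (auto simp: abs_mult intro!: mult_left_mono)
          ultimately show ?thesis by linarith
        qed
        have ti: "t i / T \<le> 1" "t j / T \<le> t i / T"
          using tpos(2)[of i] mono[of j i] ij T by (auto simp: divide_right_mono)
        have "a * t i / T \<le> a"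
          using mult_left_mono[OF ti(1) a] by simp
        moreover have "a * t j / T \<le> a * t i / T"
          using mult_left_mono[OF ti(2) a] by simp
        moreover have "Y j \<omega> - a * t j / T \<le> D j \<omega>" using D_ge[of j j \<omega>] by linarith
        moreover have "\<bar>Y j \<omega> - a * t j / T\<bar> \<le> D j \<omega>" using D_ge[of j j \<omega>] by simp
        ultimately show ?thesis
          using PA[OF \<omega>] d1 by linarith
      qed
      moreover have "D n \<omega> = (MAX i\<in>{0..n}. \<bar>Y i \<omega> - a * t i / T\<bar>)"
        by (simp add: D_def)
      ultimately show ?thesis by simp
    qed
    \<comment> \<open>With conditional probability \<open>p\<close> the last increment is at least
      its standard deviation \<open>sqrt h\<close>. The drift takes away at most
      \<open>\<bar>\<nu>\<bar> * h \<le> \<sigma> * sqrt h\<close>, so \<open>Y\<close> still ends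
      above \<open>a\<close>.\<close>
    have endpoint: "(\<integral>\<^sup>+\<omega>. G \<omega> \<partial>M) * ennreal p \<le> (\<integral>\<^sup>+\<omega>\<in>A. (ennreal (exp (2 * \<kappa> * D n \<omega> / sqrt T)) * indicator {\<omega>. a \<le> Y n \<omega>} \<omega>) \<partial>M)"
    proof (cases "j = n")
      case True
      have "(\<integral>\<^sup>+\<omega>. G \<omega> \<partial>M) * ennreal p \<le> (\<integral>\<^sup>+\<omega>. G \<omega> \<partial>M) * ennreal 1"
        using p by (intro mult_left_mono ennreal_leI) auto
      also have "\<dots> \<le> (\<integral>\<^sup>+\<omega>\<in>A. (ennreal (exp (2 * \<kappa> * D n \<omega> / sqrt T)) * indicator {\<omega>. a \<le> Y n \<omega>} \<omega>) \<partial>M)"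
        using True PA by (auto simp: G_def indicator_def intro!: nn_integral_mono)
      finally show ?thesis .
    next
      case False
      then have jn: "j < n" using j by simp
      let ?f = "indicator {y. sqrt (t n - t j) \<le> 1 * y} :: real \<Rightarrow> ennreal"
      have "(\<integral>\<^sup>+\<omega>. G \<omega> \<partial>M) * ennreal p = (\<integral>\<^sup>+\<omega>. G \<omega> \<partial>M) * (\<integral>\<^sup>+x. ennreal (normal_density 0 (sqrt (t n - t j)) x) * ?f x \<partial>lborel)"
        using normal_tail_scaled[of "t n - t j" 1] inc[OF jn] by (simp add: p_def)
      also have "\<dots> = (\<integral>\<^sup>+\<omega>. G \<omega> * ?f (W (t n) \<omega> - W (t j) \<omega>) \<partial>M)"
        using tpos[OF j(2)] inc[OF jn] by (intro increment_nn_integral[symmetric] GF) auto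
      also have "\<dots> \<le> (\<integral>\<^sup>+\<omega>\<in>A. (ennreal (exp (2 * \<kappa> * D n \<omega> / sqrt T)) * indicator {\<omega>. a \<le> Y n \<omega>} \<omega>) \<partial>M)"
      proof (rule nn_integral_mono)
        fix \<omega>
        have "a \<le> Y n \<omega>" if "\<omega> \<in> A" and w: "sqrt (t n - t j) \<le> W (t n) \<omega> - W (t j) \<omega>"
        proof -
          define h where "h = t n - t j"
          have h: "0 \<le> h" "h \<le> T" using inc[OF jn] tpos[of j] j tn by (auto simp: h_def)
          have "\<bar>\<nu>\<bar> * h = (\<bar>\<nu>\<bar> * sqrt h) * sqrt h" using h by simp
          also have "\<dots> \<le> \<sigma> * sqrt h"
            using h \<sigma> by (intro mult_right_mono order_trans[OF _ \<sigma>(2)] mult_left_mono) auto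
          also have "\<dots> \<le> \<sigma> * (W (t n) \<omega> - W (t j) \<omega>)"
            using w \<sigma> by (auto simp: h_def)
          finally have "0 \<le> \<sigma> * (W (t n) \<omega> - W (t j) \<omega>) + \<nu> * h"
            using h abs_ge_minus_self[of "\<nu> * h"] by (simp add: abs_mult)
          moreover have "Y n \<omega> = Y j \<omega> + (\<sigma> * (W (t n) \<omega> - W (t j) \<omega>) + \<nu> * h)"
            by (simp add: Y_def h_def algebra_simps)
          ultimately show ?thesis using PA[OF that(1)] by simp
        qed
        moreover have "ennreal (exp (2 * \<kappa> * D j \<omega> / sqrt T)) \<le> ennreal (exp (2 * \<kappa> * D n \<omega> / sqrt T))"
          using D_mono[OF j(2), of \<omega>] \<kappa> T by (intro ennreal_leI) (auto intro!: divide_right_mono mult_left_mono)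
        ultimately show "G \<omega> * ?f (W (t n) \<omega> - W (t j) \<omega>) \<le> ennreal (exp (2 * \<kappa> * D n \<omega> / sqrt T)) * indicator {\<omega>. a \<le> Y n \<omega>} \<omega> * indicator A \<omega>"
          by (auto simp: G_def indicator_def)
      qed
      finally show ?thesis .
    qed
    have "(\<integral>\<^sup>+\<omega>\<in>A. ?L \<omega> \<partial>M) \<le> (\<integral>\<^sup>+\<omega>. (ennreal p * ennreal (exp (\<kappa> * \<sigma>))) * (G \<omega> * ennreal (exp ((\<kappa> * \<sigma>) * R \<omega> / sqrt T))) \<partial>M)"
    proof (rule nn_integral_mono)
      fix \<omega>
      show "?L \<omega> * indicator A \<omega> \<le> (ennreal p * ennreal (exp (\<kappa> * \<sigma>))) * (G \<omega> * ennreal (exp ((\<kappa> * \<sigma>) * R \<omega> / sqrt T)))"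
      proof (cases "\<omega> \<in> A")
        case True
        have "\<kappa> * D n \<omega> \<le> \<kappa> * (2 * D j \<omega> + (\<sigma> * R \<omega> + \<bar>\<nu>\<bar> * T))"
          using Dn[OF True] \<kappa> by (intro mult_left_mono) auto
        then have "\<kappa> * D n \<omega> / sqrt T \<le> \<kappa> * (2 * D j \<omega> + (\<sigma> * R \<omega> + \<bar>\<nu>\<bar> * T)) / sqrt T"
          using T by (intro divide_right_mono) auto
        also have "\<dots> = 2 * \<kappa> * D j \<omega> / sqrt T + (\<kappa> * \<sigma>) * R \<omega> / sqrt T + \<kappa> * (\<bar>\<nu>\<bar> * (T / sqrt T))"
          by (simp add: algebra_simps add_divide_distrib)
        \<comment> \<open>On the scale \<open>sqrt T\<close> the drift contributes at most
          \<open>\<sigma>\<close>, which is the origin of the factor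
          \<open>exp (\<kappa> * \<sigma>)\<close>.\<close>
        also have "\<kappa> * (\<bar>\<nu>\<bar> * (T / sqrt T)) \<le> \<kappa> * \<sigma>"
          using \<sigma> \<kappa> T by (intro mult_left_mono) (auto simp: real_div_sqrt)
        finally have "exp (\<kappa> * D n \<omega> / sqrt T) \<le> exp (\<kappa> * \<sigma>) * (exp (2 * \<kappa> * D j \<omega> / sqrt T) * exp ((\<kappa> * \<sigma>) * R \<omega> / sqrt T))"
          by (simp add: exp_add[symmetric])
        then have "ennreal (exp (\<kappa> * D n \<omega> / sqrt T)) \<le> ennreal (exp (\<kappa> * \<sigma>)) * (ennreal (exp (2 * \<kappa> * D j \<omega> / sqrt T)) * ennreal (exp ((\<kappa> * \<sigma>) * R \<omega> / sqrt T)))"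
          by (simp add: ennreal_mult[symmetric] ennreal_leI)
        then have "ennreal p * ennreal (exp (\<kappa> * D n \<omega> / sqrt T)) \<le> ennreal p * (ennreal (exp (\<kappa> * \<sigma>)) * (ennreal (exp (2 * \<kappa> * D j \<omega> / sqrt T)) * ennreal (exp ((\<kappa> * \<sigma>) * R \<omega> / sqrt T))))"
          by (rule mult_left_mono) simp
        then show ?thesis
          using True by (simp add: G_def mult.assoc)
      qed simp
    qed
    also have "\<dots> = (ennreal p * ennreal (exp (\<kappa> * \<sigma>))) * (\<integral>\<^sup>+\<omega>. (G \<omega> * ennreal (exp ((\<kappa> * \<sigma>) * R \<omega> / sqrt T))) \<partial>M)"
    proof (rule nn_integral_cmult)
      have "R \<in> borel_measurable M"
        unfolding R_def
      proof (rule borel_measurable_Max)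
        fix i assume "i \<in> {j..n}"
        then have [measurable]: "W (t i) \<in> borel_measurable M" "W (t j) \<in> borel_measurable M"
          using tpos j by auto
        show "(\<lambda>\<omega>. \<bar>W (t i) \<omega> - W (t j) \<omega>\<bar>) \<in> borel_measurable M" by measurable
      qed simp
      then show "(\<lambda>\<omega>. G \<omega> * ennreal (exp ((\<kappa> * \<sigma>) * R \<omega> / sqrt T))) \<in> borel_measurable M"
        using measurable_F_M[OF GF] by measurable
    qed
    also have "\<dots> \<le> (ennreal p * ennreal (exp (\<kappa> * \<sigma>))) * (ennreal (maximal_const (\<kappa> * \<sigma>)) * (\<integral>\<^sup>+\<omega>. G \<omega> \<partial>M))"
      unfolding R_def using t0 inc j GF \<kappa> \<sigma> T tn tpos[of j]
      by (intro mult_left_mono maximal_increment_exp[where t=t]) auto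
    also have "\<dots> = ennreal C * ((\<integral>\<^sup>+\<omega>. G \<omega> \<partial>M) * ennreal p)"
      using mc by (simp add: C_def ennreal_mult mult_ac)
    also have "\<dots> \<le> ennreal C * (\<integral>\<^sup>+\<omega>\<in>A. (ennreal (exp (2 * \<kappa> * D n \<omega> / sqrt T)) * indicator {\<omega>. a \<le> Y n \<omega>} \<omega>) \<partial>M)"
      using endpoint by (rule mult_left_mono) simp
    also have "ennreal C * (\<integral>\<^sup>+\<omega>\<in>A. (ennreal (exp (2 * \<kappa> * D n \<omega> / sqrt T)) * indicator {\<omega>. a \<le> Y n \<omega>} \<omega>) \<partial>M) = (\<integral>\<^sup>+\<omega>\<in>A. ?U \<omega> \<partial>M)"
    proof -
      have [measurable]: "D n \<in> borel_measurable M" "Y n \<in> borel_measurable M" by auto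
      have "{\<omega>\<in>space M. a \<le> Y n \<omega>} \<in> events" by measurable
      then have "(\<lambda>\<omega>. indicator {\<omega>. a \<le> Y n \<omega>} \<omega> :: ennreal) \<in> borel_measurable M"
        by (intro borel_measurable_indicator') auto
      then show ?thesis
        by (subst nn_integral_cmult[symmetric]) (auto simp: mult.assoc)
    qed
    finally show "(\<integral>\<^sup>+\<omega>\<in>A. ?L \<omega> \<partial>M) \<le> (\<integral>\<^sup>+\<omega>\<in>A. ?U \<omega> \<partial>M)"
      by (simp add: mult_left_mono)
  next
    have [measurable]: "D n \<in> borel_measurable M" "Y n \<in> borel_measurable M" by auto
    show "?L \<in> borel_measurable M" by measurable
    have "{\<omega>\<in>space M. a \<le> Y n \<omega>} \<in> events" by measurable
    then have "(\<lambda>\<omega>. indicator {\<omega>. a \<le> Y n \<omega>} \<omega> :: ennreal) \<in> borel_measurable M"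
      by (intro borel_measurable_indicator') auto
    then show "?U \<in> borel_measurable M" by measurable
  qed (use mono in auto)
  let ?H = "{\<omega>\<in>space M. \<exists>j\<in>{0..n}. a \<le> Y j \<omega>}"
  have [measurable]: "?H \<in> events"
  proof -
    have "?H = (\<Union>j\<in>{0..n}. {\<omega>\<in>space M. a \<le> Y j \<omega>})" by auto
    also have "\<dots> \<in> events"
    proof (intro sets.finite_UN)
      fix j assume "j \<in> {0..n}"
      then have [measurable]: "Y j \<in> borel_measurable M" by auto
      show "{\<omega>\<in>space M. a \<le> Y j \<omega>} \<in> events" by measurable
    qed simp
    finally show ?thesis .
  qed
  have [measurable]: "D n \<in> borel_measurable M" "Y n \<in> borel_measurable M" by auto
  have "{\<omega>\<in>space M. a \<le> Y n \<omega>} \<in> events" by measurable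
  then have im [measurable]: "(\<lambda>\<omega>. indicator {\<omega>. a \<le> Y n \<omega>} \<omega> :: ennreal) \<in> borel_measurable M"
    by (intro borel_measurable_indicator') auto
  have 1: "(\<integral>\<^sup>+\<omega>\<in>?H. ?L \<omega> \<partial>M) = ennreal p * (\<integral>\<^sup>+\<omega>\<in>?H. ennreal (exp (\<kappa> * D n \<omega> / sqrt T)) \<partial>M)"
    by (subst nn_integral_cmult[symmetric]) (auto simp: mult.assoc)
  have 2: "(\<integral>\<^sup>+\<omega>. ?U \<omega> \<partial>M) = ennreal p * (ennreal (C / p) * (\<integral>\<^sup>+\<omega>. ennreal (exp (2 * \<kappa> * D n \<omega> / sqrt T)) * indicator {\<omega>. a \<le> Y n \<omega>} \<omega> \<partial>M))"
  proof -
    have "ennreal p * ennreal (C / p) = ennreal C"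
      using p C by (simp add: ennreal_mult[symmetric])
    then show ?thesis
      by (subst nn_integral_cmult) (auto simp: mult.assoc[symmetric])
  qed
  show ?thesis
    using main p unfolding 1 2 by (subst (asm) ennreal_mult_le_mult_iff) (auto simp: C_def p_def)
qed

text \<open>On the endpoint event the deviation splits exactly into \<open>\<sigma>\<close> times
  the bridge and the fraction \<open>t i / T\<close> of the overshoot, and independence factors the
  two exponential moments. Both start from \<open>2 * \<kappa> * \<sigma>\<close>; the bridge is at
  most twice the maximum of the path, and the overshoot bound doubles its parameter, so
  \<open>4 * \<kappa> * \<sigma>\<close> appears in both constants.\<close>

lemma endpoint_deviation_exp_moment:
  fixes t :: "nat \<Rightarrow> real" and \<sigma> \<nu> a T \<kappa> :: real
  defines "Y \<equiv> \<lambda>i \<omega>. \<sigma> * (W (t i) \<omega> - W 0 \<omega>) + \<nu> * t i"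
  defines "D \<equiv> \<lambda>k \<omega>. MAX i\<in>{0..k::nat}. \<bar>Y i \<omega> - a * t i / T\<bar>"
  assumes t0: "t 0 = 0" and n: "1 \<le> n" and inc: "\<And>i j. i < j \<Longrightarrow> j \<le> n \<Longrightarrow> t i < t j" and tn: "t n = T" and T: "0 < T"
    and \<sigma>: "0 < \<sigma>" "\<bar>\<nu>\<bar> * sqrt T \<le> \<sigma>" and a: "0 \<le> a" and \<kappa>: "0 < \<kappa>"
  shows "(\<integral>\<^sup>+\<omega>. ennreal (exp (2 * \<kappa> * D n \<omega> / sqrt T)) * indicator {\<omega>. a \<le> Y n \<omega>} \<omega> \<partial>M) \<le>
    ennreal (maximal_const (4 * \<kappa> * \<sigma>) * (2 * exp ((4 * \<kappa> * \<sigma> + 1)\<^sup>2 / 6))) * emeasure M {\<omega>\<in>space M. a \<le> Y n \<omega>}"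
proof -
  \<comment> \<open>The level that the Brownian increment must reach. A nonnegative \<open>a\<close>
    and a drift dominated by the noise put it at or above \<open>- sqrt T\<close>, as the overshoot
    estimate requires.\<close>
  define \<alpha> where "\<alpha> = (a - \<nu> * T) / \<sigma>"
  have mono: "t i \<le> t j" if "i \<le> j" "j \<le> n" for i j
    using inc[of i j] that by (cases "i = j") auto
  have tpos: "0 \<le> t i" "t i \<le> T" if "i \<le> n" for i
    using mono[of 0 i] mono[of i n] t0 tn that by auto
  have T': "sqrt T * sqrt T = T" using T by simp
  have \<alpha>_ge: "- sqrt T \<le> \<alpha>"
  proof -
    have "\<nu> * T \<le> (\<bar>\<nu>\<bar> * sqrt T) * sqrt T"
      using T T' by (simp add: mult.assoc mult_right_mono)
    also have "\<dots> \<le> \<sigma> * sqrt T" using \<sigma> T by (intro mult_right_mono) auto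
    finally show ?thesis
      using a \<sigma>(1) unfolding \<alpha>_def by (simp add: pos_le_divide_eq mult.commute)
  qed
  have \<alpha>_iff: "a \<le> \<sigma> * w + \<nu> * T \<longleftrightarrow> \<alpha> \<le> w" for w
    using \<sigma>(1) unfolding \<alpha>_def by (simp add: pos_divide_le_eq mult.commute algebra_simps)
  have \<alpha>_eq: "\<sigma> * w + \<nu> * T - a = \<sigma> * (w - \<alpha>)" for w
  proof -
    have "\<sigma> * \<alpha> = a - \<nu> * T" using \<sigma>(1) by (simp add: \<alpha>_def)
    then show ?thesis by (simp add: right_diff_distrib)
  qed
  define \<Phi> where "\<Phi> \<beta> = ennreal (exp (2 * \<kappa> * \<sigma> * (MAX i\<in>{0..n}. \<bar>\<beta> i\<bar>) / sqrt T))" for \<beta> :: "nat \<Rightarrow> real"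
  define f where "f w = ennreal (exp ((2 * \<kappa> * \<sigma>) * (w - \<alpha>) / sqrt T)) * indicator {\<alpha>..} w" for w
  have \<Phi>m [measurable]: "\<Phi> \<in> borel_measurable (\<Pi>\<^sub>M i\<in>UNIV. borel)"
  proof -
    have [measurable]: "(\<lambda>\<beta>::nat \<Rightarrow> real. MAX i\<in>{0..n}. \<bar>\<beta> i\<bar>) \<in> borel_measurable (\<Pi>\<^sub>M i\<in>UNIV. borel)"
    proof (rule borel_measurable_Max)
      fix i
      have [measurable]: "(\<lambda>\<beta>. \<beta> i) \<in> borel_measurable (\<Pi>\<^sub>M i\<in>UNIV. borel :: real measure)"
        by (rule measurable_component_singleton) simp
      show "(\<lambda>\<beta>. \<bar>\<beta> i\<bar>) \<in> borel_measurable (\<Pi>\<^sub>M i\<in>UNIV. borel :: real measure)" by measurable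
    qed simp
    show ?thesis unfolding \<Phi>_def by measurable
  qed
  have fm [measurable]: "f \<in> borel_measurable borel" unfolding f_def by measurable
  have pt: "ennreal (exp (2 * \<kappa> * D n \<omega> / sqrt T)) * indicator {\<omega>. a \<le> Y n \<omega>} \<omega> \<le> \<Phi> (bridge t n \<omega>) * f (W (t n) \<omega> - W 0 \<omega>)" for \<omega>
  proof (cases "a \<le> Y n \<omega>")
    case True
    define m where "m = (MAX i\<in>{0..n}. \<bar>bridge t n \<omega> i\<bar>)"
    have w: "\<alpha> \<le> W (t n) \<omega> - W 0 \<omega>" using True \<alpha>_iff by (simp add: Y_def tn)
    have "\<bar>Y i \<omega> - a * t i / T\<bar> \<le> \<sigma> * m + (Y n \<omega> - a)" if i: "i \<in> {0..n}" for i
    proof -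
      have eq: "Y i \<omega> - a * t i / T = \<sigma> * bridge t n \<omega> i + (t i / T) * (Y n \<omega> - a)"
        using i T by (simp add: Y_def bridge_def tn) (simp add: field_simps)
      have "\<bar>bridge t n \<omega> i\<bar> \<le> m" unfolding m_def using i by (intro Max_ge) auto
      then have "\<bar>\<sigma> * bridge t n \<omega> i\<bar> \<le> \<sigma> * m" using \<sigma> by (simp add: abs_mult)
      moreover have "(t i / T) * (Y n \<omega> - a) \<le> 1 * (Y n \<omega> - a)"
        using tpos[of i] i T True by (intro mult_right_mono) auto
      moreover have "0 \<le> (t i / T) * (Y n \<omega> - a)"
        using tpos[of i] i T True by (intro mult_nonneg_nonneg) auto
      moreover have "\<bar>x + y\<bar> \<le> p + q" if "\<bar>x\<bar> \<le> p" "y \<le> 1 * q" "0 \<le> y" for x y p q :: real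
        using that by linarith
      ultimately show ?thesis unfolding eq by blast
    qed
    moreover have "D n \<omega> = (MAX i\<in>{0..n}. \<bar>Y i \<omega> - a * t i / T\<bar>)"
      by (simp add: D_def)
    ultimately have "D n \<omega> \<le> \<sigma> * m + (Y n \<omega> - a)" by simp
    also have "Y n \<omega> - a = \<sigma> * ((W (t n) \<omega> - W 0 \<omega>) - \<alpha>)"
      using \<alpha>_eq[of "W (t n) \<omega> - W 0 \<omega>"] by (simp add: Y_def tn)
    finally have "2 * \<kappa> * D n \<omega> / sqrt T \<le> 2 * \<kappa> * (\<sigma> * m + \<sigma> * ((W (t n) \<omega> - W 0 \<omega>) - \<alpha>)) / sqrt T"
      using \<kappa> T by (intro divide_right_mono mult_left_mono) auto
    also have "\<dots> = 2 * \<kappa> * \<sigma> * m / sqrt T + (2 * \<kappa> * \<sigma>) * ((W (t n) \<omega> - W 0 \<omega>) - \<alpha>) / sqrt T"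
      unfolding add_divide_distrib[symmetric] by (simp add: algebra_simps)
    finally have "exp (2 * \<kappa> * D n \<omega> / sqrt T) \<le> exp (2 * \<kappa> * \<sigma> * m / sqrt T) * exp ((2 * \<kappa> * \<sigma>) * ((W (t n) \<omega> - W 0 \<omega>) - \<alpha>) / sqrt T)"
      by (simp add: exp_add[symmetric])
    then have "ennreal (exp (2 * \<kappa> * D n \<omega> / sqrt T)) \<le> ennreal (exp (2 * \<kappa> * \<sigma> * m / sqrt T)) * ennreal (exp ((2 * \<kappa> * \<sigma>) * ((W (t n) \<omega> - W 0 \<omega>) - \<alpha>) / sqrt T))"
      by (simp add: ennreal_mult[symmetric] ennreal_leI)
    then show ?thesis
      using True w by (simp add: \<Phi>_def f_def m_def)
  qed simp
  have "(\<integral>\<^sup>+\<omega>. ennreal (exp (2 * \<kappa> * D n \<omega> / sqrt T)) * indicator {\<omega>. a \<le> Y n \<omega>} \<omega> \<partial>M) \<le> (\<integral>\<^sup>+\<omega>. \<Phi> (bridge t n \<omega>) * f (W (t n) \<omega> - W 0 \<omega>) \<partial>M)"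
    by (intro nn_integral_mono pt)
  also have "\<dots> = (\<integral>\<^sup>+\<omega>. \<Phi> (bridge t n \<omega>) \<partial>M) * (\<integral>\<^sup>+s. ennreal (normal_density 0 (sqrt T) s) * f s \<partial>lborel)"
    using bridge_endpoint_indep[of t n, OF t0 n inc \<Phi>m fm] tn by simp
  also have "\<dots> \<le> ennreal (maximal_const (4 * \<kappa> * \<sigma>)) * (ennreal (2 * exp ((2 * (2 * \<kappa> * \<sigma>) + 1)\<^sup>2 / 6)) * emeasure M {\<omega>\<in>space M. a \<le> Y n \<omega>})"
  proof (rule mult_mono)
    have "(\<integral>\<^sup>+\<omega>. \<Phi> (bridge t n \<omega>) \<partial>M) \<le> (\<integral>\<^sup>+\<omega>. 1 * ennreal (exp ((4 * \<kappa> * \<sigma>) * (MAX j\<in>{0..n}. \<bar>W (t j) \<omega> - W (t 0) \<omega>\<bar>) / sqrt T)) \<partial>M)"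
    proof (rule nn_integral_mono)
      fix \<omega>
      define m where "m = (MAX j\<in>{0..n}. \<bar>W (t j) \<omega> - W (t 0) \<omega>\<bar>)"
      have mge: "\<bar>W (t j) \<omega> - W 0 \<omega>\<bar> \<le> m" if "j \<le> n" for j
        unfolding m_def using that t0 by (intro Max_ge) auto
      have m0: "0 \<le> m" using mge[of 0] by linarith
      have "\<bar>bridge t n \<omega> i\<bar> \<le> 2 * m" if i: "i \<in> {0..n}" for i
      proof -
        have "\<bar>t i / T * (W (t n) \<omega> - W 0 \<omega>)\<bar> \<le> 1 * m"
          using tpos[of i] i T mge[of n] unfolding abs_mult by (intro mult_mono) auto
        moreover have "bridge t n \<omega> i = (W (t i) \<omega> - W 0 \<omega>) - t i / T * (W (t n) \<omega> - W 0 \<omega>)"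
          using i by (simp add: bridge_def tn)
        moreover have "\<bar>W (t i) \<omega> - W 0 \<omega>\<bar> \<le> m" using mge[of i] i by simp
        moreover have "\<bar>x - y\<bar> \<le> 2 * m" if "\<bar>x\<bar> \<le> m" "\<bar>y\<bar> \<le> 1 * m" for x y
          using that by linarith
        ultimately show ?thesis by simp
      qed
      then have "(MAX i\<in>{0..n}. \<bar>bridge t n \<omega> i\<bar>) \<le> 2 * m" by simp
      then have "2 * \<kappa> * \<sigma> * (MAX i\<in>{0..n}. \<bar>bridge t n \<omega> i\<bar>) / sqrt T \<le> 2 * \<kappa> * \<sigma> * (2 * m) / sqrt T"
        using \<kappa> \<sigma> T by (intro divide_right_mono mult_left_mono) auto
      then show "\<Phi> (bridge t n \<omega>) \<le> 1 * ennreal (exp ((4 * \<kappa> * \<sigma>) * (MAX j\<in>{0..n}. \<bar>W (t j) \<omega> - W (t 0) \<omega>\<bar>) / sqrt T))"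
        unfolding \<Phi>_def m_def[symmetric] by (auto intro!: ennreal_leI)
    qed
    also have "\<dots> \<le> ennreal (maximal_const (4 * \<kappa> * \<sigma>)) * (\<integral>\<^sup>+\<omega>. 1 \<partial>M)"
      using t0 inc \<kappa> \<sigma> T tn by (intro maximal_increment_exp[where t=t]) auto
    finally show "(\<integral>\<^sup>+\<omega>. \<Phi> (bridge t n \<omega>) \<partial>M) \<le> ennreal (maximal_const (4 * \<kappa> * \<sigma>))"
      by (simp add: emeasure_space_1)
    have "(\<integral>\<^sup>+s. ennreal (normal_density 0 (sqrt T) s) * f s \<partial>lborel) \<le>
        ennreal (2 * exp ((2 * (2 * \<kappa> * \<sigma>) + 1)\<^sup>2 / 6)) * (\<integral>\<^sup>+y. ennreal (normal_density 0 (sqrt T) y) * indicator {\<alpha>..} y \<partial>lborel)"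
      unfolding f_def using \<kappa> \<sigma> by (intro normal_overshoot_exp_moment T \<alpha>_ge) auto
    also have "(\<integral>\<^sup>+y. ennreal (normal_density 0 (sqrt T) y) * indicator {\<alpha>..} y \<partial>lborel) = (\<integral>\<^sup>+\<omega>. 1 * indicator {\<alpha>..} (W T \<omega> - W 0 \<omega>) \<partial>M)"
      using increment_nn_integral[of 0 T "\<lambda>_. 1" "indicator {\<alpha>..}"] T by (simp add: emeasure_space_1)
    also have "\<dots> = (\<integral>\<^sup>+\<omega>. indicator {\<omega>\<in>space M. a \<le> Y n \<omega>} \<omega> \<partial>M)"
      by (intro nn_integral_cong) (auto simp: indicator_def Y_def tn \<alpha>_iff)
    also have "\<dots> = emeasure M {\<omega>\<in>space M. a \<le> Y n \<omega>}"
    proof (rule nn_integral_indicator)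
      have [measurable]: "W T \<in> borel_measurable M" "W 0 \<in> borel_measurable M" using T by auto
      show "{\<omega>\<in>space M. a \<le> Y n \<omega>} \<in> events"
        unfolding Y_def tn by measurable
    qed
    finally show "(\<integral>\<^sup>+s. ennreal (normal_density 0 (sqrt T) s) * f s \<partial>lborel) \<le>
        ennreal (2 * exp ((2 * (2 * \<kappa> * \<sigma>) + 1)\<^sup>2 / 6)) * emeasure M {\<omega>\<in>space M. a \<le> Y n \<omega>}" .
  qed auto
  also have "\<dots> = ennreal (maximal_const (4 * \<kappa> * \<sigma>) * (2 * exp ((4 * \<kappa> * \<sigma> + 1)\<^sup>2 / 6))) * emeasure M {\<omega>\<in>space M. a \<le> Y n \<omega>}"
    using maximal_const_ge_1[of "4 * \<kappa> * \<sigma>"] \<kappa> \<sigma> by (simp add: ennreal_mult mult.assoc)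
  finally show ?thesis .
qed

lemma hitting_grid_bound:
  fixes n :: nat and \<sigma> \<nu> a T :: real
  defines "Y \<equiv> \<lambda>s \<omega>. \<sigma> * (W s \<omega> - W 0 \<omega>) + \<nu> * s"
  defines "t \<equiv> \<lambda>i. real i * T / real n"
  assumes n: "1 \<le> n" and T: "0 < T" and \<sigma>: "0 < \<sigma>" "\<bar>\<nu>\<bar> * sqrt T \<le> \<sigma>" and a: "0 \<le> a"
  shows "(\<integral>\<^sup>+\<omega>\<in>{\<omega>\<in>space M. \<exists>j\<in>{0..n}. a \<le> Y (t j) \<omega>}. ennreal (exp (2 * (MAX i\<in>{0..n}. \<bar>Y (t i) \<omega> - a * t i / T\<bar>) / sqrt T)) \<partial>M) \<le>
    ennreal (hitting_const \<sigma>) * emeasure M {\<omega>\<in>space M. a \<le> Y T \<omega>}"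
proof -
  have t: "t 0 = 0" "t n = T" "\<And>i j. i < j \<Longrightarrow> j \<le> n \<Longrightarrow> t i < t j"
    using n T by (auto simp: t_def divide_strict_right_mono)
  have "(\<integral>\<^sup>+\<omega>\<in>{\<omega>\<in>space M. \<exists>j\<in>{0..n}. a \<le> Y (t j) \<omega>}. ennreal (exp (2 * (MAX i\<in>{0..n}. \<bar>Y (t i) \<omega> - a * t i / T\<bar>) / sqrt T)) \<partial>M) \<le>
     ennreal (exp (2 * \<sigma>) * maximal_const (2 * \<sigma>) / normal_tail_one) *
      (\<integral>\<^sup>+\<omega>. ennreal (exp (2 * 2 * (MAX i\<in>{0..n}. \<bar>Y (t i) \<omega> - a * t i / T\<bar>) / sqrt T)) * indicator {\<omega>. a \<le> Y (t n) \<omega>} \<omega> \<partial>M)"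
    unfolding Y_def by (rule hitting_grid_le_endpoint[of t, OF t(1,3,2) T \<sigma> a]) auto
  also have "\<dots> \<le> ennreal (exp (2 * \<sigma>) * maximal_const (2 * \<sigma>) / normal_tail_one) *
      (ennreal (maximal_const (4 * 2 * \<sigma>) * (2 * exp ((4 * 2 * \<sigma> + 1)\<^sup>2 / 6))) * emeasure M {\<omega>\<in>space M. a \<le> Y (t n) \<omega>})"
    unfolding Y_def by (intro mult_left_mono endpoint_deviation_exp_moment[of t, OF t(1) n t(3,2) T \<sigma> a]) auto
  also have "\<dots> = ennreal (hitting_const \<sigma>) * emeasure M {\<omega>\<in>space M. a \<le> Y T \<omega>}"
    using maximal_const_ge_1[of "2 * \<sigma>"] maximal_const_ge_1[of "8 * \<sigma>"] normal_tail_one_pos \<sigma>(1)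
    unfolding hitting_const_def t(2) by (simp add: mult.assoc[symmetric] ennreal_mult[symmetric])
  finally show ?thesis .
qed

end

section \<open>From grids to continuous paths\<close>

lemma eventually_grid_approx:
  fixes f :: "real \<Rightarrow> real"
  assumes f: "continuous_on {0..T} f" and T: "0 < T" and s: "s \<in> {0..T}" and e: "0 < e"
  shows "\<forall>\<^sub>F n in sequentially. \<exists>j\<in>{0..Suc n}. \<bar>f (real j * T / real (Suc n)) - f s\<bar> < e"
proof -
  obtain d where d: "0 < d" "\<And>x. x \<in> {0..T} \<Longrightarrow> dist x s < d \<Longrightarrow> dist (f x) (f s) < e"
    using f s e unfolding continuous_on_iff by metis
  obtain n0 :: nat where n0: "T / d < real n0"
    using reals_Archimedean2 by blast
  have "\<exists>j\<in>{0..Suc n}. \<bar>f (real j * T / real (Suc n)) - f s\<bar> < e" if n: "n0 \<le> n" for n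
  proof -
    define N where "N = real (Suc n)"
    have N: "0 < N" "T / d < N" using n n0 by (auto simp: N_def)
    define j where "j = nat (floor (s * N / T))"
    have s0: "0 \<le> s * N / T" using s N T by simp
    then have j: "real j \<le> s * N / T" "s * N / T < real j + 1"
      unfolding j_def by linarith+
    have "s * N / T \<le> N" using s N T by (simp add: pos_divide_le_eq mult.commute)
    then have "j \<le> Suc n" using j(1) by (simp add: N_def)
    have x1: "real j * T / N \<le> s" using j(1) N T by (simp add: field_simps)
    have x2: "s < real j * T / N + T / N" using j(2) N T by (simp add: field_simps)
    have "T / N < d" using N d T by (simp add: field_simps)
    then have "dist (real j * T / N) s < d" "real j * T / N \<in> {0..T}"
      using x1 x2 s N T by (auto simp: dist_real_def)
    then have "\<bar>f (real j * T / N) - f s\<bar> < e"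
      using d(2) by (auto simp: dist_real_def)
    then show ?thesis
      using \<open>j \<le> Suc n\<close> by (auto simp: N_def)
  qed
  then show ?thesis
    unfolding eventually_sequentially by blast
qed

context brownian_motion
begin

text \<open>A grid may miss the passage over \<open>a\<close>, but for a continuous path a fine grid
  sees the lower level \<open>a - d\<close>, so Fatou's lemma applies; letting \<open>d\<close> tend
  to 0 uses that \<open>a \<le> Y T\<close> is a closed condition. Measurability is asked of the
  dominated function \<open>Q\<close> and not of the supremum.\<close>

lemma hitting_exp_moment:
  fixes \<sigma> \<nu> a T :: real and Q :: "'a \<Rightarrow> ennreal"
  defines "Y \<equiv> \<lambda>s \<omega>. \<sigma> * (W s \<omega> - W 0 \<omega>) + \<nu> * s"
  assumes T: "0 < T" and \<sigma>: "0 < \<sigma>" "\<bar>\<nu>\<bar> * sqrt T \<le> \<sigma>" and a: "0 < a"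
    and Q [measurable]: "Q \<in> borel_measurable M"
    and Q_hit: "\<And>\<omega>. \<omega> \<in> space M \<Longrightarrow> \<exists>s\<in>{0..T}. a \<le> Y s \<omega> \<Longrightarrow>
      Q \<omega> \<le> ennreal (exp (2 * (SUP s\<in>{0..T}. \<bar>Y s \<omega> - a * s / T\<bar>) / sqrt T))"
    and Q_0: "\<And>\<omega>. \<omega> \<in> space M \<Longrightarrow> \<not> (\<exists>s\<in>{0..T}. a \<le> Y s \<omega>) \<Longrightarrow> Q \<omega> = 0"
  shows "(\<integral>\<^sup>+\<omega>. Q \<omega> \<partial>M) \<le> ennreal (hitting_const \<sigma>) * emeasure M {\<omega>\<in>space M. a \<le> Y T \<omega>}"
proof -
  have YM [measurable]: "Y s \<in> borel_measurable M" if "0 \<le> s" for s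
  proof -
    have [measurable]: "W s \<in> borel_measurable M" "W 0 \<in> borel_measurable M" using that by auto
    show ?thesis unfolding Y_def by measurable
  qed
  have [measurable]: "Y T \<in> borel_measurable M" using T by simp
  have Yc: "continuous_on {0..T} (\<lambda>s. Y s \<omega>)" if "\<omega> \<in> space M" for \<omega>
  proof -
    have "continuous_on {0..T} (\<lambda>s. W s \<omega>)"
      using continuous_paths[OF that] by (rule continuous_on_subset) auto
    then show ?thesis unfolding Y_def by (intro continuous_intros)
  qed
  \<comment> \<open>The factor \<open>exp (4 * d / sqrt T)\<close> pays for an error
    \<open>2 * d\<close> in the deviation: one \<open>d\<close> for replacing the maximiser by a
    grid point, one for tilting the line from slope \<open>a / T\<close> to
    \<open>(a - d) / T\<close>.\<close>
  have step: "(\<integral>\<^sup>+\<omega>. Q \<omega> \<partial>M) \<le> ennreal (exp (4 * d / sqrt T)) * (ennreal (hitting_const \<sigma>) * emeasure M {\<omega>\<in>space M. a - d \<le> Y T \<omega>})"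
    if d: "0 < d" "d < a" for d
  proof -
    define t where "t n j = real j * T / real (Suc n)" for n j
    define D where "D n \<omega> = (MAX i\<in>{0..Suc n}. \<bar>Y (t n i) \<omega> - (a - d) * t n i / T\<bar>)" for n \<omega>
    define H where "H n = {\<omega>\<in>space M. \<exists>j\<in>{0..Suc n}. a - d \<le> Y (t n j) \<omega>}" for n
    define h where "h n \<omega> = ennreal (exp (2 * D n \<omega> / sqrt T)) * indicator (H n) \<omega>" for n \<omega>
    have tn: "0 \<le> t n j" for n j using T by (simp add: t_def)
    have HM [measurable]: "H n \<in> events" for n
    proof -
      have "H n = (\<Union>j\<in>{0..Suc n}. {\<omega>\<in>space M. a - d \<le> Y (t n j) \<omega>})" by (auto simp: H_def)
      also have "\<dots> \<in> events"
      proof (intro sets.finite_UN)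
        fix j
        have [measurable]: "Y (t n j) \<in> borel_measurable M" using YM[OF tn] .
        show "{\<omega>\<in>space M. a - d \<le> Y (t n j) \<omega>} \<in> events" by measurable
      qed simp
      finally show ?thesis .
    qed
    have DM [measurable]: "D n \<in> borel_measurable M" for n
      unfolding D_def
    proof (rule borel_measurable_Max)
      fix i
      show "(\<lambda>\<omega>. \<bar>Y (t n i) \<omega> - (a - d) * t n i / T\<bar>) \<in> borel_measurable M"
        using YM[OF tn[of n i]] by measurable
    qed simp
    have hM: "h n \<in> borel_measurable M" for n
      unfolding h_def by measurable
    have pt: "Q \<omega> \<le> ennreal (exp (4 * d / sqrt T)) * liminf (\<lambda>n. h n \<omega>)" if \<omega>: "\<omega> \<in> space M" for \<omega>
    proof (cases "\<exists>s\<in>{0..T}. a \<le> Y s \<omega>")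
      case True
      then obtain s where s: "s \<in> {0..T}" "a \<le> Y s \<omega>" by blast
      let ?g = "\<lambda>s. Y s \<omega> - a * s / T"
      have gc: "continuous_on {0..T} ?g"
        using T by (intro continuous_intros Yc[OF \<omega>]) auto
      then have gc': "continuous_on {0..T} (\<lambda>s. \<bar>?g s\<bar>)" by (rule continuous_on_rabs)
      obtain x where x: "x \<in> {0..T}" "\<And>y. y \<in> {0..T} \<Longrightarrow> \<bar>?g y\<bar> \<le> \<bar>?g x\<bar>"
        using continuous_attains_sup[OF compact_Icc _ gc'] T by auto
      have "(SUP s\<in>{0..T}. \<bar>?g s\<bar>) \<le> \<bar>?g x\<bar>"
        using x T by (intro cSUP_least) auto
      then have "2 * (SUP s\<in>{0..T}. \<bar>?g s\<bar>) / sqrt T \<le> 2 * \<bar>?g x\<bar> / sqrt T"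
        using T by (intro divide_right_mono) auto
      then have Q1: "Q \<omega> \<le> ennreal (exp (2 * \<bar>?g x\<bar> / sqrt T))"
        using Q_hit[OF \<omega> True] by (meson ennreal_leI exp_le_cancel_iff order_trans)
      have "\<forall>\<^sub>F n in sequentially. Q \<omega> \<le> ennreal (exp (4 * d / sqrt T)) * h n \<omega>"
        using eventually_grid_approx[OF Yc[OF \<omega>] T s(1) d(1)] eventually_grid_approx[OF gc T x(1) d(1)]
      proof eventually_elim
        case (elim n)
        from elim(1) obtain j where "j \<in> {0..Suc n}" "\<bar>Y (t n j) \<omega> - Y s \<omega>\<bar> < d" by (auto simp: t_def)
        then have hit: "\<omega> \<in> H n"
          using s(2) \<omega> by (auto simp: H_def intro!: bexI[of _ j])
        from elim(2) obtain i where i: "i \<in> {0..Suc n}" "\<bar>?g (t n i) - ?g x\<bar> < d" by (auto simp: t_def)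
        have "real i * T \<le> real (Suc n) * T" using i(1) T by (intro mult_right_mono) auto
        then have "t n i \<le> T" by (simp add: t_def pos_divide_le_eq mult.commute)
        then have tiT: "t n i / T \<le> 1" using T by simp
        have "d * (t n i / T) \<le> d * 1" using tiT d by (intro mult_left_mono) auto
        moreover have "0 \<le> d * (t n i / T)" using d tn[of n i] T by simp
        moreover have "Y (t n i) \<omega> - (a - d) * t n i / T = ?g (t n i) + d * (t n i / T)"
          by (simp add: left_diff_distrib diff_divide_distrib)
        moreover have "\<bar>u\<bar> \<le> \<bar>z\<bar> + 2 * d" if "y \<le> d * 1" "0 \<le> y" "z = v + y" "\<bar>v - u\<bar> < d" for u v y z
          using that by linarith
        ultimately have "\<bar>?g x\<bar> \<le> \<bar>Y (t n i) \<omega> - (a - d) * t n i / T\<bar> + 2 * d"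
          using i(2) by blast
        also have "\<bar>Y (t n i) \<omega> - (a - d) * t n i / T\<bar> \<le> D n \<omega>"
          unfolding D_def using i(1) by (intro Max_ge) auto
        finally have "2 * \<bar>?g x\<bar> / sqrt T \<le> 2 * (D n \<omega> + 2 * d) / sqrt T"
          using T by (intro divide_right_mono) auto
        also have "\<dots> = 4 * d / sqrt T + 2 * D n \<omega> / sqrt T"
          by (simp add: add_divide_distrib)
        finally have "exp (2 * \<bar>?g x\<bar> / sqrt T) \<le> exp (4 * d / sqrt T) * exp (2 * D n \<omega> / sqrt T)"
          by (simp add: exp_add[symmetric])
        then have "ennreal (exp (2 * \<bar>?g x\<bar> / sqrt T)) \<le> ennreal (exp (4 * d / sqrt T)) * ennreal (exp (2 * D n \<omega> / sqrt T))"
          by (simp add: ennreal_mult[symmetric] ennreal_leI)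
        then show ?case
          using Q1 hit by (auto simp: h_def intro: order_trans)
      qed
      then have "\<forall>\<^sub>F n in sequentially. ennreal (exp (- (4 * d / sqrt T))) * Q \<omega> \<le> h n \<omega>"
      proof eventually_elim
        case (elim n)
        have "ennreal (exp (- (4 * d / sqrt T))) * Q \<omega> \<le> ennreal (exp (- (4 * d / sqrt T))) * (ennreal (exp (4 * d / sqrt T)) * h n \<omega>)"
          using elim by (rule mult_left_mono) simp
        also have "\<dots> = h n \<omega>"
          by (simp add: mult.assoc[symmetric] ennreal_mult[symmetric] exp_add[symmetric])
        finally show ?case .
      qed
      then have "ennreal (exp (- (4 * d / sqrt T))) * Q \<omega> \<le> liminf (\<lambda>n. h n \<omega>)"
        by (rule Liminf_bounded)
      then have "ennreal (exp (4 * d / sqrt T)) * (ennreal (exp (- (4 * d / sqrt T))) * Q \<omega>) \<le> ennreal (exp (4 * d / sqrt T)) * liminf (\<lambda>n. h n \<omega>)"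
        by (rule mult_left_mono) simp
      then show ?thesis
        by (simp add: mult.assoc[symmetric] ennreal_mult[symmetric] exp_add[symmetric])
    next
      case False
      then show ?thesis using Q_0[OF \<omega>] by simp
    qed
    have "(\<integral>\<^sup>+\<omega>. Q \<omega> \<partial>M) \<le> (\<integral>\<^sup>+\<omega>. ennreal (exp (4 * d / sqrt T)) * liminf (\<lambda>n. h n \<omega>) \<partial>M)"
      by (intro nn_integral_mono pt)
    also have "\<dots> = ennreal (exp (4 * d / sqrt T)) * (\<integral>\<^sup>+\<omega>. liminf (\<lambda>n. h n \<omega>) \<partial>M)"
      using hM by (intro nn_integral_cmult) measurable
    also have "\<dots> \<le> ennreal (exp (4 * d / sqrt T)) * liminf (\<lambda>n. \<integral>\<^sup>+\<omega>. h n \<omega> \<partial>M)"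
      using hM by (intro mult_left_mono nn_integral_liminf) auto
    also have "\<dots> \<le> ennreal (exp (4 * d / sqrt T)) * liminf (\<lambda>n. ennreal (hitting_const \<sigma>) * emeasure M {\<omega>\<in>space M. a - d \<le> Y T \<omega>})"
    proof (intro mult_left_mono Liminf_mono always_eventually allI)
      fix n
      show "(\<integral>\<^sup>+\<omega>. h n \<omega> \<partial>M) \<le> ennreal (hitting_const \<sigma>) * emeasure M {\<omega>\<in>space M. a - d \<le> Y T \<omega>}"
        unfolding h_def D_def H_def t_def Y_def
        by (rule hitting_grid_bound) (use T \<sigma> d in auto)
    qed simp
    finally show ?thesis by (simp add: Liminf_const)
  qed
  have hc: "0 \<le> hitting_const \<sigma>"
    using maximal_const_ge_1[of "2 * \<sigma>"] maximal_const_ge_1[of "8 * \<sigma>"] normal_tail_one_pos \<sigma>(1)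
    by (simp add: hitting_const_def)
  \<comment> \<open>The shift by 2 keeps \<open>d m\<close> below \<open>a\<close> already at
    \<open>m = 0\<close>.\<close>
  define d where "d m = a / (real m + 2)" for m :: nat
  have d: "0 < d m" "d m < a" for m
    using a by (auto simp: d_def pos_divide_less_eq)
  define A where "A m = {\<omega>\<in>space M. a - d m \<le> Y T \<omega>}" for m
  have d0: "d \<longlonglongrightarrow> 0"
    using LIMSEQ_ignore_initial_segment[OF lim_const_over_n[of a], of 2] by (simp add: d_def[abs_def] add.commute)
  have "(\<lambda>m. prob (A m)) \<longlonglongrightarrow> prob (\<Inter>m. A m)"
  proof (rule finite_Lim_measure_decseq)
    show "range A \<subseteq> events" unfolding A_def by auto
    have "d n \<le> d m" if "m \<le> n" for m n
      unfolding d_def using a that by (intro divide_left_mono) auto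
    then show "decseq A"
      unfolding A_def decseq_def by (auto, metis diff_left_mono order_trans)
  qed
  moreover have "(\<Inter>m. A m) = {\<omega>\<in>space M. a \<le> Y T \<omega>}"
  proof (intro equalityI subsetI)
    fix \<omega> assume \<omega>: "\<omega> \<in> (\<Inter>m. A m)"
    then have "a - d m \<le> Y T \<omega>" for m by (auto simp: A_def)
    moreover have "(\<lambda>m. a - d m) \<longlonglongrightarrow> a - 0" by (intro tendsto_intros d0)
    ultimately have "a - 0 \<le> Y T \<omega>" by (intro LIMSEQ_le_const2) auto
    then show "\<omega> \<in> {\<omega>\<in>space M. a \<le> Y T \<omega>}" using \<omega> by (auto simp: A_def)
  next
    fix \<omega> assume \<omega>: "\<omega> \<in> {\<omega>\<in>space M. a \<le> Y T \<omega>}"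
    have "a - d m \<le> Y T \<omega>" for m
      using \<omega> d(1)[of m] by simp
    then show "\<omega> \<in> (\<Inter>m. A m)"
      using \<omega> by (auto simp: A_def)
  qed
  ultimately have "(\<lambda>m. exp (4 * d m / sqrt T) * (hitting_const \<sigma> * prob (A m))) \<longlonglongrightarrow>
      exp (4 * 0 / sqrt T) * (hitting_const \<sigma> * prob {\<omega>\<in>space M. a \<le> Y T \<omega>})"
    using T by (intro tendsto_intros d0) auto
  then have "(\<lambda>m. ennreal (exp (4 * d m / sqrt T) * (hitting_const \<sigma> * prob (A m)))) \<longlonglongrightarrow>
      ennreal (hitting_const \<sigma> * prob {\<omega>\<in>space M. a \<le> Y T \<omega>})"
    by (intro tendsto_ennrealI) simp
  moreover have "(\<integral>\<^sup>+\<omega>. Q \<omega> \<partial>M) \<le> ennreal (exp (4 * d m / sqrt T) * (hitting_const \<sigma> * prob (A m)))" for m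
    using step[OF d, of m] hc by (simp add: A_def emeasure_eq_measure ennreal_mult)
  ultimately have "(\<integral>\<^sup>+\<omega>. Q \<omega> \<partial>M) \<le> ennreal (hitting_const \<sigma> * prob {\<omega>\<in>space M. a \<le> Y T \<omega>})"
    by (intro LIMSEQ_le_const) auto
  then show ?thesis
    using hc by (simp add: emeasure_eq_measure ennreal_mult)
qed

end

section \<open>The barrier price\<close>

lemma mspace_path_spaceI:
  assumes "continuous_on {0..T} f"
  shows "(\<lambda>t\<in>{0..T}. f t) \<in> mspace (path_space T)"
proof -
  have "compactin (top_of_set {0..T}) (topspace (top_of_set {0..T}))"
    by (simp add: compactin_subtopology)
  moreover have "continuous_on {0..T} (\<lambda>t\<in>{0..T}. f t)"
    using continuous_on_eq[OF assms, of "\<lambda>t\<in>{0..T}. f t"] by simp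
  ultimately show ?thesis
    unfolding path_space_def by (subst compactin_mspace_cfunspace) auto
qed

lemma mdist_path_space_le:
  assumes "0 \<le> b" "\<And>t. t \<in> {0..T} \<Longrightarrow> \<bar>f t - g t\<bar> \<le> b"
  shows "mdist (path_space T) (\<lambda>t\<in>{0..T}. f t) (\<lambda>t\<in>{0..T}. g t) \<le> b"
  unfolding path_space_def using assms by (intro mdist_cfunspace_le) (auto simp: dist_real_def)

lemma lipschitz_payoff_diff:
  assumes \<Psi>: "lipschitz_payoff L T \<Psi>" and "continuous_on {0..T} f" "continuous_on {0..T} g"
    and "0 \<le> b" "\<And>t. t \<in> {0..T} \<Longrightarrow> \<bar>f t - g t\<bar> \<le> b"
  shows "\<bar>\<Psi> (\<lambda>t\<in>{0..T}. f t) - \<Psi> (\<lambda>t\<in>{0..T}. g t)\<bar> \<le> L * b"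
proof -
  have "\<bar>\<Psi> (\<lambda>t\<in>{0..T}. f t) - \<Psi> (\<lambda>t\<in>{0..T}. g t)\<bar> \<le> L * mdist (path_space T) (\<lambda>t\<in>{0..T}. f t) (\<lambda>t\<in>{0..T}. g t)"
    using \<Psi> mspace_path_spaceI[OF assms(2)] mspace_path_spaceI[OF assms(3)]
    unfolding lipschitz_payoff_def dist_real_def by blast
  also have "\<dots> \<le> L * b"
    using \<Psi> mdist_path_space_le[OF assms(4,5)] by (intro mult_left_mono) (auto simp: lipschitz_payoff_def)
  finally show ?thesis .
qed

text \<open>
  Bernstein polynomials with coefficients rounded to multiples of \<open>1 / n\<close> approximate every path uniformly and
  take only countably many values, which makes the payoff along them measurable without any topology on path space.
\<close>

lemma payoff_measurable:
  fixes X :: "real \<Rightarrow> 'a \<Rightarrow> real"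
  assumes T: "0 < T" and XM: "\<And>t. 0 \<le> t \<Longrightarrow> X t \<in> borel_measurable M"
    and Xc: "\<And>\<omega>. \<omega> \<in> space M \<Longrightarrow> continuous_on {0..T} (\<lambda>t. X t \<omega>)"
    and \<Psi>: "lipschitz_payoff L T \<Psi>"
  shows "(\<lambda>\<omega>. \<Psi> (\<lambda>t\<in>{0..T}. X t \<omega>)) \<in> borel_measurable M"
proof -
  define pol where "pol n z = (\<lambda>t. \<Sum>k\<le>n. (real_of_int (z ! k) / real n) * Bernstein n k (t / T))" for n :: nat and z :: "int list"
  define z where "z n \<omega> = map (\<lambda>k. \<lfloor>real n * X (real k / real n * T) \<omega>\<rfloor>) [0..<Suc n]" for n :: nat and \<omega>
  have zm: "z n \<in> M \<rightarrow>\<^sub>M count_space UNIV" for n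
  proof (subst measurable_count_space_eq_countable)
    show "countable (UNIV :: int list set)" by simp
    have "z n -` {l} \<inter> space M \<in> sets M" for l
    proof -
      have m: "{\<omega>\<in>space M. \<lfloor>real n * X (real k / real n * T) \<omega>\<rfloor> = l ! k} \<in> sets M" for k
      proof -
        have [measurable]: "X (real k / real n * T) \<in> borel_measurable M" using XM T by simp
        show ?thesis by measurable
      qed
      have iff: "z n \<omega> = l \<longleftrightarrow> length l = Suc n \<and> (\<forall>k\<in>{..<Suc n}. \<lfloor>real n * X (real k / real n * T) \<omega>\<rfloor> = l ! k)" for \<omega>
      proof -
        have 1: "length (z n \<omega>) = Suc n" by (simp add: z_def del: upt_Suc)
        have 2: "z n \<omega> ! k = \<lfloor>real n * X (real k / real n * T) \<omega>\<rfloor>" if "k < Suc n" for k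
          using that by (simp add: z_def del: upt_Suc)
        show ?thesis
          unfolding list_eq_iff_nth_eq 1 using 2 by (metis lessThan_iff)
      qed
      have "z n -` {l} \<inter> space M = (if length l = Suc n then {\<omega>\<in>space M. \<forall>k\<in>{..<Suc n}. \<lfloor>real n * X (real k / real n * T) \<omega>\<rfloor> = l ! k} else {})"
        using iff by auto
      also have "\<dots> \<in> sets M"
        using sets.sets_Collect_countable_All'[OF m, of "{..<Suc n}"] by (cases "length l = Suc n") auto
      finally show ?thesis .
    qed
    then show "z n \<in> space M \<rightarrow> UNIV \<and> (\<forall>a\<in>UNIV. z n -` {a} \<inter> space M \<in> sets M)" by simp
  qed
  have "(\<lambda>\<omega>. \<Psi> (\<lambda>t\<in>{0..T}. pol n (z n \<omega>) t)) \<in> borel_measurable M" for n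
    by (rule measurable_compose[OF zm]) simp
  then show ?thesis
  proof (rule borel_measurable_LIMSEQ_real[rotated])
    fix \<omega> assume \<omega>: "\<omega> \<in> space M"
    let ?g = "\<lambda>x. X (x * T) \<omega>"
    have gc: "continuous_on {0..1} ?g"
      using T by (intro continuous_on_compose2[OF Xc[OF \<omega>]] continuous_intros) (auto simp: mult_le_cancel_right1)
    have L: "0 \<le> L" using \<Psi> by (simp add: lipschitz_payoff_def)
    have polc: "continuous_on {0..T} (pol n l)" for n l
      unfolding pol_def Bernstein_def using T by (intro continuous_intros) auto
    show "(\<lambda>n. \<Psi> (\<lambda>t\<in>{0..T}. pol n (z n \<omega>) t)) \<longlonglongrightarrow> \<Psi> (\<lambda>t\<in>{0..T}. X t \<omega>)"
    proof (rule LIMSEQ_I)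
      fix r :: real assume r: "0 < r"
      \<comment> \<open>Rounding and Bernstein approximation cost \<open>e\<close> each. Using
        \<open>L + 1\<close> in place of \<open>L\<close> avoids a division by zero and makes the
        final inequality strict.\<close>
      define e where "e = r / (2 * (L + 1))"
      have e: "0 < e" using r L by (simp add: e_def)
      obtain N0 where N0: "\<And>n x. N0 \<le> n \<Longrightarrow> x \<in> {0..1} \<Longrightarrow> \<bar>?g x - (\<Sum>k\<le>n. ?g (real k / real n) * Bernstein n k x)\<bar> < e"
        using Bernstein_Weierstrass[OF gc e] by blast
      obtain N1 :: nat where N1: "1 / e < real N1" using reals_Archimedean2 by blast
      have "norm (\<Psi> (\<lambda>t\<in>{0..T}. pol n (z n \<omega>) t) - \<Psi> (\<lambda>t\<in>{0..T}. X t \<omega>)) < r" if n: "max N0 N1 \<le> n" for n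
      proof -
        have "0 < 1 / e" using e by simp
        then have n0: "0 < real n" "1 / e < real n" using n N1 by linarith+
        have ne: "1 / real n \<le> e" using n0 e by (simp add: field_simps)
        have "\<bar>pol n (z n \<omega>) t - X t \<omega>\<bar> \<le> 2 * e" if t: "t \<in> {0..T}" for t
        proof -
          let ?x = "t / T"
          have x: "?x \<in> {0..1}" using t T by simp
          have B0: "0 \<le> Bernstein n k ?x" for k
            using x by (auto intro: Bernstein_nonneg)
          have zk: "z n \<omega> ! k = \<lfloor>real n * ?g (real k / real n)\<rfloor>" if "k \<le> n" for k
            using that by (simp add: z_def del: upt_Suc)
          have rd: "\<bar>real_of_int \<lfloor>real n * y\<rfloor> / real n - y\<bar> \<le> 1 / real n" for y
          proof -
            have "real_of_int \<lfloor>real n * y\<rfloor> / real n - y = (real_of_int \<lfloor>real n * y\<rfloor> - real n * y) / real n"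
              using n0 by (simp add: diff_divide_distrib)
            also have "\<bar>\<dots>\<bar> \<le> 1 / real n"
              unfolding abs_divide using n0 by (intro divide_right_mono frac_le) (auto simp: abs_le_iff, linarith+)
            finally show ?thesis .
          qed
          have "pol n (z n \<omega>) t - (\<Sum>k\<le>n. ?g (real k / real n) * Bernstein n k ?x) =
              (\<Sum>k\<le>n. (real_of_int \<lfloor>real n * ?g (real k / real n)\<rfloor> / real n - ?g (real k / real n)) * Bernstein n k ?x)"
            unfolding pol_def sum_subtractf[symmetric] by (intro sum.cong) (auto simp: zk left_diff_distrib)
          \<comment> \<open>The Bernstein weights are nonnegative and sum to 1, so rounding all
            coefficients costs no more than rounding one.\<close>
          also have "\<bar>\<dots>\<bar> \<le> (\<Sum>k\<le>n. 1 / real n * Bernstein n k ?x)"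
            by (intro order_trans[OF sum_abs] sum_mono)
               (simp only: abs_mult abs_of_nonneg[OF B0] mult_right_mono[OF rd B0])
          also have "\<dots> = 1 / real n"
            by (simp only: sum_distrib_left[symmetric] sum_Bernstein mult_1_right)
          finally have "\<bar>pol n (z n \<omega>) t - (\<Sum>k\<le>n. ?g (real k / real n) * Bernstein n k ?x)\<bar> \<le> e"
            using ne by linarith
          moreover have "\<bar>?g ?x - (\<Sum>k\<le>n. ?g (real k / real n) * Bernstein n k ?x)\<bar> < e"
            using N0[OF _ x] n by simp
          moreover have "?g ?x = X t \<omega>" using T by simp
          ultimately show ?thesis by linarith
        qed
        then have "\<bar>\<Psi> (\<lambda>t\<in>{0..T}. pol n (z n \<omega>) t) - \<Psi> (\<lambda>t\<in>{0..T}. X t \<omega>)\<bar> \<le> L * (2 * e)"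
          using e by (intro lipschitz_payoff_diff[OF \<Psi> polc Xc[OF \<omega>]]) auto
        also have "\<dots> < (L + 1) * (2 * e)" using e by simp
        also have "\<dots> = r" using L by (simp add: e_def field_simps)
        finally show ?thesis by simp
      qed
      then show "\<exists>no. \<forall>n\<ge>no. norm (\<Psi> (\<lambda>t\<in>{0..T}. pol n (z n \<omega>) t) - \<Psi> (\<lambda>t\<in>{0..T}. X t \<omega>)) < r" by blast
    qed
  qed
qed

lemma exp_diff_le:
  fixes v w :: real
  assumes "v \<le> 0"
  shows "\<bar>exp (v + w) - exp v\<bar> \<le> \<bar>w\<bar> * exp \<bar>w\<bar>"
proof -
  have "\<bar>exp w - 1\<bar> \<le> \<bar>w\<bar> * exp \<bar>w\<bar>"
  proof (cases "0 \<le> w")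
    case True
    have "exp w * (1 - w) \<le> exp w * exp (- w)"
      using exp_ge_add_one_self[of "- w"] by (intro mult_left_mono) auto
    then show ?thesis
      using True by (simp add: exp_minus algebra_simps)
  next
    case False
    have "1 + w \<le> exp w" by (rule exp_ge_add_one_self)
    moreover have "- w * 1 \<le> - w * exp (- w)"
      using False by (intro mult_left_mono) auto
    ultimately have "1 - exp w \<le> - (w * exp (- w))" by linarith
    then show ?thesis using False by simp
  qed
  moreover have "\<bar>exp (v + w) - exp v\<bar> = exp v * \<bar>exp w - 1\<bar>"
  proof -
    have "exp (v + w) - exp v = exp v * (exp w - 1)" by (simp add: exp_add right_diff_distrib)
    then show ?thesis by (simp add: abs_mult)
  qed
  moreover have "exp v * \<bar>exp w - 1\<bar> \<le> 1 * \<bar>exp w - 1\<bar>"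
    using assms by (intro mult_right_mono) auto
  ultimately show ?thesis by linarith
qed

text \<open>The rate in the asymptotics originates here. With \<open>y = x / sqrt T\<close>, the
  factor \<open>x\<close> supplies \<open>sqrt T\<close>, while \<open>y \<le> exp y\<close> and,
  because \<open>T \<le> 1\<close>, also \<open>exp x \<le> exp y\<close>.\<close>

lemma times_exp_le_sqrt_scaled:
  fixes x T :: real
  assumes "0 \<le> x" "0 < T" "T \<le> 1"
  shows "x * exp x \<le> sqrt T * exp (2 * x / sqrt T)"
proof -
  define y where "y = x / sqrt T"
  have x: "x = sqrt T * y" and y: "0 \<le> y" using assms by (auto simp: y_def)
  have "sqrt T * y \<le> 1 * y" using assms y by (intro mult_right_mono) auto
  then have "exp x \<le> exp y" by (simp add: x)
  moreover have "y \<le> exp y" using exp_ge_add_one_self[of y] by linarith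
  ultimately have "y * exp x \<le> exp y * exp y" using y by (intro mult_mono) auto
  then have "sqrt T * (y * exp x) \<le> sqrt T * (exp y * exp y)"
    using assms by (intro mult_left_mono) auto
  moreover have "exp (2 * x / sqrt T) = exp y * exp y"
    by (simp add: y_def exp_add[symmetric])
  moreover have "x * exp x = sqrt T * (y * exp x)"
    unfolding mult.assoc[symmetric] x[symmetric] ..
  ultimately show ?thesis by simp
qed

lemma le_SUP_continuous_iff:
  fixes f :: "real \<Rightarrow> real"
  assumes "continuous_on {0..T} f" "0 \<le> T"
  shows "b \<le> (SUP t\<in>{0..T}. f t) \<longleftrightarrow> (\<exists>t\<in>{0..T}. b \<le> f t)"
proof -
  obtain x where x: "x \<in> {0..T}" "\<And>y. y \<in> {0..T} \<Longrightarrow> f y \<le> f x"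
    using continuous_attains_sup[OF compact_Icc _ assms(1)] assms(2) by auto
  have "(SUP t\<in>{0..T}. f t) = f x"
    using x by (intro cSup_eq_maximum) auto
  then show ?thesis
    using x by (auto intro: order_trans)
qed

text \<open>With \<open>S = B * exp (- a)\<close> both paths are \<open>B\<close> times
  exponentials, and the reference path has a nonpositive exponent \<open>v\<close> because its line
  ends at the barrier. The bound therefore involves \<open>B\<close> while its constant is free of
  \<open>S\<close>.\<close>

lemma lipschitz_deviation_bound:
  fixes y :: "real \<Rightarrow> real" and S B T L :: real
  assumes \<Psi>: "lipschitz_payoff L T \<Psi>" and S: "0 < S" "S < B" and T: "0 < T" "T \<le> 1"
    and y: "continuous_on {0..T} y"
  shows "\<bar>\<Psi> (\<lambda>t\<in>{0..T}. S * exp (y t)) - \<Psi> (\<lambda>t\<in>{0..T}. S * (B / S) powr (t / T))\<bar> \<le>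
    L * (B * (sqrt T * exp (2 * (SUP t\<in>{0..T}. \<bar>y t - ln (B / S) * t / T\<bar>) / sqrt T)))"
proof -
  define a where "a = ln (B / S)"
  have a: "0 < a" using S by (simp add: a_def)
  let ?D = "SUP t\<in>{0..T}. \<bar>y t - a * t / T\<bar>"
  have c: "continuous_on {0..T} (\<lambda>t. \<bar>y t - a * t / T\<bar>)"
    using y T by (intro continuous_intros) auto
  have bdd: "bdd_above ((\<lambda>t. \<bar>y t - a * t / T\<bar>) ` {0..T})"
    using c by (intro bounded_imp_bdd_above compact_imp_bounded compact_continuous_image) auto
  have le_D: "\<bar>y t - a * t / T\<bar> \<le> ?D" if "t \<in> {0..T}" for t
    using bdd that by (intro cSUP_upper) auto
  have D0: "0 \<le> ?D" using le_D[of 0] T by (meson abs_ge_zero atLeastAtMost_iff less_imp_le order_refl order_trans)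
  have powr: "(B / S) powr x = exp (a * x)" for x
    using S by (simp add: powr_def a_def mult.commute)
  have "\<bar>S * exp (y t) - S * (B / S) powr (t / T)\<bar> \<le> B * (sqrt T * exp (2 * ?D / sqrt T))" if t: "t \<in> {0..T}" for t
  proof -
    define v w where "v = a * (t / T) - a" and "w = y t - a * (t / T)"
    have "a * (t / T) \<le> a * 1" using t T a by (intro mult_left_mono) auto
    then have v: "v \<le> 0" by (simp add: v_def)
    have SB: "S = B * exp (- a)"
      using S by (simp add: a_def exp_minus)
    have "S * exp (y t) - S * (B / S) powr (t / T) = B * (exp (v + w) - exp v)"
      unfolding powr by (subst (1 2) SB) (simp add: v_def w_def right_diff_distrib exp_diff exp_minus field_simps)
    then have "\<bar>S * exp (y t) - S * (B / S) powr (t / T)\<bar> = B * \<bar>exp (v + w) - exp v\<bar>"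
      using S by (simp add: abs_mult)
    also have "\<dots> \<le> B * (\<bar>w\<bar> * exp \<bar>w\<bar>)"
      using S exp_diff_le[OF v] by (intro mult_left_mono) auto
    also have "\<dots> \<le> B * (?D * exp ?D)"
    proof -
      have "\<bar>w\<bar> \<le> ?D" using le_D[OF t] by (simp add: w_def)
      then show ?thesis
        using S D0 by (intro mult_left_mono mult_mono) auto
    qed
    also have "\<dots> \<le> B * (sqrt T * exp (2 * ?D / sqrt T))"
      using S times_exp_le_sqrt_scaled[OF D0 T] by (intro mult_left_mono) auto
    finally show ?thesis .
  qed
  then show ?thesis
    unfolding a_def[symmetric] using S T y
    by (intro lipschitz_payoff_diff[OF \<Psi>] continuous_intros) auto
qed

section \<open>The asymptotics of the price\<close>

context brownian_motion
begin

text \<open>The supremum of a continuous path lies strictly below \<open>B\<close> exactly if, for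
  some \<open>m\<close>, the path keeps the margin \<open>1 / Suc m\<close> at all rational times.
  This describes the complement by countably many conditions.\<close>

lemma hits_barrier_event:
  assumes XM: "\<And>t. 0 \<le> t \<Longrightarrow> X t \<in> borel_measurable M"
    and Xc: "\<And>\<omega>. \<omega> \<in> space M \<Longrightarrow> continuous_on {0..T} (\<lambda>t. X t \<omega>)" and T: "0 < T"
  shows "hits_barrier M X B T \<in> events"
proof -
  let ?A = "\<lambda>m. {\<omega>\<in>space M. \<forall>q\<in>\<rat> \<inter> {0..T}. X q \<omega> \<le> B - 1 / Suc m}"
  have "hits_barrier M X B T = space M - (\<Union>m. ?A m)"
  proof (intro equalityI subsetI)
    fix \<omega> assume "\<omega> \<in> hits_barrier M X B T"
    then have \<omega>: "\<omega> \<in> space M" and "B \<le> (SUP t\<in>{0..T}. X t \<omega>)" by (auto simp: hits_barrier_def)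
    then obtain t where t: "t \<in> {0..T}" "B \<le> X t \<omega>"
      using le_SUP_continuous_iff[OF Xc[OF \<omega>]] T by auto
    have "\<omega> \<notin> ?A m" for m
    proof
      assume "\<omega> \<in> ?A m"
      then have "X t \<omega> \<le> B - 1 / Suc m"
        using le_on_rationals_imp_le[OF T Xc[OF \<omega>] open_UNIV _ t(1) UNIV_I, of "B - 1 / Suc m"] by simp
      moreover have "0 < 1 / real (Suc m)" by simp
      ultimately show False using t(2) by linarith
    qed
    then show "\<omega> \<in> space M - (\<Union>m. ?A m)" using \<omega> by blast
  next
    fix \<omega> assume \<omega>: "\<omega> \<in> space M - (\<Union>m. ?A m)"
    show "\<omega> \<in> hits_barrier M X B T"
    proof (rule ccontr)
      assume "\<omega> \<notin> hits_barrier M X B T"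
      then have lt: "(SUP t\<in>{0..T}. X t \<omega>) < B" using \<omega> by (auto simp: hits_barrier_def)
      obtain m where m: "1 / real (Suc m) < B - (SUP t\<in>{0..T}. X t \<omega>)"
        using nat_approx_posE[of "B - (SUP t\<in>{0..T}. X t \<omega>)"] lt by auto
      have "bdd_above ((\<lambda>t. X t \<omega>) ` {0..T})"
        using \<omega> Xc by (intro bounded_imp_bdd_above compact_imp_bounded compact_continuous_image) auto
      then have "X q \<omega> \<le> (SUP t\<in>{0..T}. X t \<omega>)" if "q \<in> {0..T}" for q
        using that by (intro cSUP_upper)
      then have "\<omega> \<in> ?A m" using m \<omega> by force
      then show False using \<omega> by blast
    qed
  qed
  also have "\<dots> \<in> events"
  proof -
    have "?A m \<in> events" for m
    proof (rule sets.sets_Collect_countable_All')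
      fix q assume "q \<in> \<rat> \<inter> {0..T}"
      then have [measurable]: "X q \<in> borel_measurable M" using XM by simp
      show "{\<omega>\<in>space M. X q \<omega> \<le> B - 1 / Suc m} \<in> events" by measurable
    qed (use countable_rat in blast)
    then show ?thesis by auto
  qed
  finally show ?thesis .
qed

text \<open>The price minus its leading term is the mean of \<open>Z - c\<close> over the barrier
  event. The bound on the absolute mean also proves integrability, so that the integral in
  \<open>barrier_price\<close> is not a default value.\<close>

lemma barrier_price_asymptotics:
  assumes S: "0 < S" "S < B" and \<sigma>: "0 < \<sigma>" and T: "0 < T" "T \<le> 1" "\<bar>\<mu> - \<sigma>\<^sup>2 / 2\<bar> * sqrt T \<le> \<sigma>"
    and sde: "sde_solution M F W (\<lambda>x. \<mu> * x) (\<lambda>x. \<sigma> * x) S X"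
    and \<Psi>: "lipschitz_payoff L T \<Psi>"
  shows "\<bar>barrier_price M X \<Psi> B K T - hitting_prob M X B T * \<Psi> (\<lambda>t\<in>{0..T}. S * (B / S) powr (t / T))\<bar> \<le>
    B * hitting_const \<sigma> * L * sqrt T * hitting_prob M X B T"
proof -
  define \<nu> where "\<nu> = \<mu> - \<sigma>\<^sup>2 / 2"
  define a where "a = ln (B / S)"
  have a: "0 < a" using S by (simp add: a_def)
  have ea: "S * exp a = B" using S by (simp add: a_def)
  define Y where "Y s \<omega> = \<sigma> * (W s \<omega> - W 0 \<omega>) + \<nu> * s" for s \<omega>
  define c where "c = \<Psi> (\<lambda>t\<in>{0..T}. S * (B / S) powr (t / T))"
  define Z where "Z \<omega> = \<Psi> (\<lambda>t\<in>{0..T}. X t \<omega>)" for \<omega>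
  define H where "H = hits_barrier M X B T"
  define k where "k = L * (B * sqrt T)"
  have L: "0 \<le> L" using \<Psi> by (simp add: lipschitz_payoff_def)
  have k: "0 \<le> k" using L S T by (simp add: k_def)
  have hc: "0 \<le> hitting_const \<sigma>"
    using maximal_const_ge_1[of "2 * \<sigma>"] maximal_const_ge_1[of "8 * \<sigma>"] normal_tail_one_pos \<sigma>
    by (simp add: hitting_const_def)
  have XM: "X t \<in> borel_measurable M" if "0 \<le> t" for t
    using sde that measurable_F_M by (auto simp: sde_solution_def)
  have Xc: "continuous_on {0..T} (\<lambda>t. X t \<omega>)" if "\<omega> \<in> space M" for \<omega>
  proof -
    have "continuous_on {0..} (\<lambda>t. X t \<omega>)" using sde that by (simp add: sde_solution_def)
    then show ?thesis by (rule continuous_on_subset) auto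
  qed
  have Yc: "continuous_on {0..T} (\<lambda>s. Y s \<omega>)" if "\<omega> \<in> space M" for \<omega>
  proof -
    have "continuous_on {0..T} (\<lambda>s. W s \<omega>)"
      using continuous_paths[OF that] by (rule continuous_on_subset) auto
    then show ?thesis unfolding Y_def by (intro continuous_intros)
  qed
  have Zm [measurable]: "Z \<in> borel_measurable M"
    unfolding Z_def by (rule payoff_measurable[OF T(1) XM Xc \<Psi>])
  have Hm [measurable]: "H \<in> events"
    unfolding H_def by (rule hits_barrier_event[OF XM Xc T(1)])
  have "AE \<omega> in M. \<forall>t\<in>{0..T}. X t \<omega> = S * exp (Y t \<omega>)"
    using gbm_explicit[OF sde T(1)] by (simp add: Y_def \<nu>_def)
  then obtain N where N: "N \<in> null_sets M" "{\<omega>\<in>space M. \<not> (\<forall>t\<in>{0..T}. X t \<omega> = S * exp (Y t \<omega>))} \<subseteq> N"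
    unfolding eventually_ae_filter by blast
  have [measurable]: "N \<in> events" using N(1) by auto
  define G where "G = space M - N"
  have Gm [measurable]: "G \<in> events" by (simp add: G_def)
  have XG: "X t \<omega> = S * exp (Y t \<omega>)" if "\<omega> \<in> G" "t \<in> {0..T}" for t \<omega>
    using that N(2) unfolding G_def by blast
  have GM: "\<omega> \<in> space M" if "\<omega> \<in> G" for \<omega> using that by (simp add: G_def)
  have AEG: "AE \<omega> in M. \<omega> \<in> G"
    using AE_not_in[OF N(1)] AE_space by eventually_elim (simp add: G_def)
  have hit_iff: "\<omega> \<in> H \<longleftrightarrow> (\<exists>s\<in>{0..T}. a \<le> Y s \<omega>)" if \<omega>: "\<omega> \<in> G" for \<omega>
  proof -
    have "\<omega> \<in> H \<longleftrightarrow> (\<exists>t\<in>{0..T}. B \<le> X t \<omega>)"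
      using le_SUP_continuous_iff[OF Xc[OF GM[OF \<omega>]]] T(1) GM[OF \<omega>] by (simp add: H_def hits_barrier_def)
    also have "\<dots> \<longleftrightarrow> (\<exists>s\<in>{0..T}. a \<le> Y s \<omega>)"
      using XG[OF \<omega>] S(1) by (simp add: ea[symmetric])
    finally show ?thesis .
  qed
  \<comment> \<open>Dividing by \<open>k\<close> normalises the deviation to the exponential alone.
    For \<open>k = 0\<close>, that is \<open>L = 0\<close>, the quotient is 0 by convention, which
    is consistent because then \<open>Z = c\<close> on \<open>G\<close>.\<close>
  define Q where "Q \<omega> = ennreal (\<bar>Z \<omega> - c\<bar> / k) * indicator (H \<inter> G) \<omega>" for \<omega>
  have Qm: "Q \<in> borel_measurable M" unfolding Q_def by measurable
  have bound: "\<bar>Z \<omega> - c\<bar> \<le> k * exp (2 * (SUP s\<in>{0..T}. \<bar>Y s \<omega> - a * s / T\<bar>) / sqrt T)" if \<omega>: "\<omega> \<in> G" for \<omega>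
  proof -
    have "(\<lambda>t\<in>{0..T}. X t \<omega>) = (\<lambda>t\<in>{0..T}. S * exp (Y t \<omega>))"
      using XG[OF \<omega>] by (auto simp: restrict_def fun_eq_iff)
    then show ?thesis
      using lipschitz_deviation_bound[OF \<Psi> S T(1,2) Yc[OF GM[OF \<omega>]]]
      by (simp add: Z_def c_def k_def a_def mult.assoc)
  qed
  have Q_hit: "Q \<omega> \<le> ennreal (exp (2 * (SUP s\<in>{0..T}. \<bar>Y s \<omega> - a * s / T\<bar>) / sqrt T))" for \<omega>
  proof (cases "\<omega> \<in> H \<inter> G \<and> k \<noteq> 0")
    case True
    then have "\<bar>Z \<omega> - c\<bar> / k \<le> exp (2 * (SUP s\<in>{0..T}. \<bar>Y s \<omega> - a * s / T\<bar>) / sqrt T)"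
      using bound[of \<omega>] k by (simp add: pos_divide_le_eq mult.commute)
    then show ?thesis using True by (simp add: Q_def ennreal_leI)
  qed (auto simp: Q_def)
  have Q_0: "Q \<omega> = 0" if "\<not> (\<exists>s\<in>{0..T}. a \<le> Y s \<omega>)" for \<omega>
    using hit_iff[of \<omega>] that by (auto simp: Q_def indicator_def)
  have int_Q: "(\<integral>\<^sup>+\<omega>. Q \<omega> \<partial>M) \<le> ennreal (hitting_const \<sigma>) * emeasure M {\<omega>\<in>space M. a \<le> Y T \<omega>}"
    unfolding Y_def
    by (rule hitting_exp_moment[OF T(1) \<sigma> T(3)[folded \<nu>_def] a Qm]) (use Q_hit Q_0 in \<open>unfold Y_def, blast\<close>)+
  \<comment> \<open>Ending above the barrier is one way to hit it, so the endpoint probability turns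
    back into the hitting probability.\<close>
  have end_le: "emeasure M {\<omega>\<in>space M. a \<le> Y T \<omega>} \<le> emeasure M H"
  proof (rule emeasure_mono_AE)
    show "AE \<omega> in M. \<omega> \<in> {\<omega>\<in>space M. a \<le> Y T \<omega>} \<longrightarrow> \<omega> \<in> H"
      using AEG
    proof eventually_elim
      case (elim \<omega>)
      then show ?case using hit_iff[of \<omega>] T(1) by auto
    qed
  qed simp
  define g where "g \<omega> = (Z \<omega> - c) * indicator H \<omega>" for \<omega>
  have gm [measurable]: "g \<in> borel_measurable M" unfolding g_def by measurable
  have "(\<integral>\<^sup>+\<omega>. ennreal (norm (g \<omega>)) \<partial>M) = (\<integral>\<^sup>+\<omega>. ennreal k * Q \<omega> \<partial>M)"
  proof (rule nn_integral_cong_AE)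
    show "AE \<omega> in M. ennreal (norm (g \<omega>)) = ennreal k * Q \<omega>"
      using AEG
    proof eventually_elim
      case (elim \<omega>)
      have "\<bar>Z \<omega> - c\<bar> = k * (\<bar>Z \<omega> - c\<bar> / k)"
        using bound[OF elim] by (cases "k = 0") auto
      then have "ennreal \<bar>Z \<omega> - c\<bar> = ennreal k * ennreal (\<bar>Z \<omega> - c\<bar> / k)"
        using k by (simp flip: ennreal_mult)
      then show ?case
        using elim by (auto simp: g_def Q_def indicator_def)
    qed
  qed
  also have "\<dots> = ennreal k * (\<integral>\<^sup>+\<omega>. Q \<omega> \<partial>M)"
    by (rule nn_integral_cmult[OF Qm])
  also have "\<dots> \<le> ennreal k * (ennreal (hitting_const \<sigma>) * emeasure M H)"
    using int_Q end_le by (meson mult_left_mono order_trans zero_le)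
  also have "\<dots> = ennreal (k * (hitting_const \<sigma> * prob H))"
    using k hc by (simp add: emeasure_eq_measure ennreal_mult)
  finally have ng: "(\<integral>\<^sup>+\<omega>. ennreal (norm (g \<omega>)) \<partial>M) \<le> ennreal (k * (hitting_const \<sigma> * prob H))" .
  have gi: "integrable M g"
    by (rule integrableI_bounded[OF gm]) (use ng in \<open>auto simp: top_unique intro: le_less_trans\<close>)
  have "norm (\<integral>\<omega>. g \<omega> \<partial>M) \<le> (\<integral>\<omega>. norm (g \<omega>) \<partial>M)"
    by (rule integral_norm_bound)
  also have "\<dots> = enn2real (\<integral>\<^sup>+\<omega>. ennreal (norm (g \<omega>)) \<partial>M)"
    by (rule integral_eq_nn_integral) auto
  also have "\<dots> \<le> enn2real (ennreal (k * (hitting_const \<sigma> * prob H)))"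
    using ng by (intro enn2real_mono) auto
  also have "\<dots> = k * (hitting_const \<sigma> * prob H)"
    using k hc by simp
  finally have gb: "\<bar>\<integral>\<omega>. g \<omega> \<partial>M\<bar> \<le> k * (hitting_const \<sigma> * prob H)" by simp
  have "barrier_price M X \<Psi> B K T = (\<integral>\<omega>. g \<omega> + c * indicator H \<omega> \<partial>M)"
    unfolding barrier_price_def H_def[symmetric] by (intro Bochner_Integration.integral_cong) (auto simp: g_def Z_def algebra_simps)
  also have "\<dots> = (\<integral>\<omega>. g \<omega> \<partial>M) + c * prob H"
  proof -
    have "integrable M (indicator H :: 'a \<Rightarrow> real)"
      by (rule integrable_real_indicator) (auto simp: less_top[symmetric])
    then show ?thesis
      using gi by (subst Bochner_Integration.integral_add) auto
  qed
  finally show ?thesis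
    using gb by (simp add: c_def hitting_prob_def H_def k_def mult_ac)
qed

end

theorem theorem6:
  fixes \<mu> \<sigma> B :: real
  assumes "0 < \<mu>" and "0 < \<sigma>"
  shows "\<exists>c \<delta>. 0 < \<delta> \<and>
    (\<forall>(M :: 'a measure) F W X S K L T \<Psi>.
       0 < S \<longrightarrow> S < B \<longrightarrow> 0 < K \<longrightarrow> 0 < T \<longrightarrow> T < \<delta> \<longrightarrow>
       brownian_motion M F W \<longrightarrow>
       sde_solution M F W (\<lambda>x. \<mu> * x) (\<lambda>x. \<sigma> * x) S X \<longrightarrow>
       lipschitz_payoff L T \<Psi> \<longrightarrow>
       (\<exists>R. barrier_price M X \<Psi> B K T =
              hitting_prob M X B T * (\<Psi> (\<lambda>t\<in>{0..T}. S * (B / S) powr (t / T)) + R) \<and>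
            \<bar>R\<bar> \<le> c * L * sqrt T))"
proof -
  let ?\<nu> = "\<mu> - \<sigma>\<^sup>2 / 2"
  \<comment> \<open>The second entry forces
    \<open>\<bar>?\<nu>\<bar> * sqrt T \<le> \<sigma>\<close>, with \<open>+ 1\<close> keeping the
    denominator positive; the first is the condition \<open>T \<le> 1\<close> of the scaling of
    \<open>x exp x\<close>.\<close>
  let ?\<delta> = "min 1 ((\<sigma> / (\<bar>?\<nu>\<bar> + 1))\<^sup>2)"
  let ?c = "B * hitting_const \<sigma>"
  show ?thesis
  proof (rule exI[of _ ?c], rule exI[of _ ?\<delta>], rule conjI, goal_cases)
    case 1
    show ?case using assms by (simp add: add_nonneg_pos)
  next
    case 2
    show ?case
    proof (intro allI impI)
      fix M :: "'a measure" and F W X S K L T \<Psi>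
      assume S: "0 < S" "S < B" and T: "0 < T" "T < ?\<delta>" and bm: "brownian_motion M F W"
        and sde: "sde_solution M F W (\<lambda>x. \<mu> * x) (\<lambda>x. \<sigma> * x) S X" and \<Psi>: "lipschitz_payoff L T \<Psi>"
      interpret brownian_motion M F W by (rule bm)
      let ?p = "hitting_prob M X B T" and ?y = "\<Psi> (\<lambda>t\<in>{0..T}. S * (B / S) powr (t / T))" and ?C = "barrier_price M X \<Psi> B K T"
      have "sqrt T \<le> sqrt ((\<sigma> / (\<bar>?\<nu>\<bar> + 1))\<^sup>2)" using T by (intro real_sqrt_le_mono) simp
      also have "\<dots> = \<sigma> / (\<bar>?\<nu>\<bar> + 1)" using assms by simp
      finally have "(\<bar>?\<nu>\<bar> + 1) * sqrt T \<le> \<sigma>" by (simp add: pos_le_divide_eq add_nonneg_pos mult.commute)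
      moreover have "\<bar>?\<nu>\<bar> * sqrt T \<le> (\<bar>?\<nu>\<bar> + 1) * sqrt T" using T by (intro mult_right_mono) auto
      ultimately have \<nu>: "\<bar>?\<nu>\<bar> * sqrt T \<le> \<sigma>" by linarith
      have main: "\<bar>?C - ?p * ?y\<bar> \<le> ?c * L * sqrt T * ?p"
        using barrier_price_asymptotics[OF S assms(2) T(1) _ \<nu> sde \<Psi>] T by simp
      have p: "0 \<le> ?p" by (simp add: hitting_prob_def)
      have L: "0 \<le> L" using \<Psi> by (simp add: lipschitz_payoff_def)
      have c: "0 \<le> ?c * L * sqrt T"
        using maximal_const_ge_1[of "2 * \<sigma>"] maximal_const_ge_1[of "8 * \<sigma>"] normal_tail_one_pos assms S L T
        by (simp add: hitting_const_def)
      \<comment> \<open>\<open>R\<close> is the error divided by the hitting probability. If that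
        probability vanishes, the bound forces the price to be 0, and \<open>R = 0\<close>
        works.\<close>
      show "\<exists>R. ?C = ?p * (?y + R) \<and> \<bar>R\<bar> \<le> ?c * L * sqrt T"
      proof (cases "?p = 0")
        case True
        then show ?thesis using main c by (intro exI[of _ 0]) auto
      next
        case False
        then have "0 < ?p" using p by simp
        then have "\<bar>(?C - ?p * ?y) / ?p\<bar> \<le> ?c * L * sqrt T"
          using main by (simp add: pos_divide_le_eq)
        moreover have "?C = ?p * (?y + (?C - ?p * ?y) / ?p)"
          using False by (simp add: field_simps)
        ultimately show ?thesis by blast
      qed
    qed
  qed
qed

end
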